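(* Let $\mathcal{F}$ be a countable generating subset of $\mathcal{B}$, and let $W_1,W_2,\ldots$ be $\mathcal{Z}$-graphons such that: (i) for every $1\le p<\infty$ there is a constant $d_p>0$ with $\|W_n\|_p\le d_p$ for all $n$; (ii) the sequence $(t(\mathbf{F},W_n))_{n\ge1}$ is convergent for every $\mathcal{F}$-decorated graph $\mathbf{F}$. Then there exists a $\mathcal{Z}$-graphon $W$ such that $t(\mathbf{F},W_n)\to t(\mathbf{F},W)$ for every $\mathcal{B}$-decorated graph $\mathbf{F}$.
   Context: $\mathcal{B}$ is a separable real Banach space and $\mathcal{Z}$ its dual; $\langle b,z\rangle$ denotes the action of $b\in\mathcal{B}$ on $z\in\mathcal{Z}$. A function $W:[0,1]^2\to\mathcal{Z}$ is weak-* measurable if $(x,y)\mapsto\langle b,W(x,y)\rangle$ is measurable for every $b\in\mathcal{B}$. Let $\mathbb{L}=\bigcap_{1\le p<\infty}L^p_{\mathrm{sym}}([0,1]^2)$ (symmetric functions lying in every $L^p$, $p<\infty$). A $\mathcal{Z}$-graphon is a symmetric weak-* measurable $W:[0,1]^2\to\mathcal{Z}$ such that $(x,y)\mapsto\|W(x,y)\|_{\mathcal{Z}}$ lies in $\mathbb{L}$; $\|W\|_p$ denotes the $L^p([0,1]^2)$-norm of $(x,y)\mapsto\|W(x,y)\|_{\mathcal{Z}}$. A subset $\mathcal{F}\subseteq\mathcal{B}$ is generating if the closure of its linear span is $\mathcal{B}$. A $\mathcal{B}$-decorated graph $\mathbf{F}=(F,f)$ is a finite simple graph $F$ on vertex set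 $[k]$ together with a map $f:E(F)\to\mathcal{B}$; it is $\mathcal{F}$-decorated if $f$ takes values in $\mathcal{F}$. For a $\mathcal{Z}$-graphon $W$, $t(\mathbf{F},W)=\int_{[0,1]^k}\prod_{ij\in E(F)}\langle f(ij),W(x_i,x_j)\rangle\,dx_1\cdots dx_k$. *)

theory Defs
  imports "HOL-Analysis.Analysis"
begin

text \<open>
  The separable Banach space is a type \<open>'b\<close> of classes \<open>banach\<close> and \<open>second_countable_topology\<close>
  (for metric spaces, second countable means separable). Its dual is \<open>'b \<Rightarrow>\<^sub>L real\<close>, normed by the
  operator norm, and the action of \<open>b\<close> on \<open>z\<close> is \<open>blinfun_apply z b\<close>. Measurability is Lebesgue
  measurability. Kernels are total functions on \<open>real\<close>, but only their values on the unit square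
  are ever used.
\<close>

definition unit_square :: "(real \<times> real) measure" where
  "unit_square = lebesgue_on ({0..1} \<times> {0..1})"

text \<open>
  The completion makes this Lebesgue measure on the cube. Without it, \<open>x \<mapsto> g (x i, x j)\<close> need not be
  measurable for Lebesgue measurable \<open>g\<close>, and its Bochner integral would be \<open>0\<close> by convention.
\<close>

definition unit_cube :: "nat \<Rightarrow> (nat \<Rightarrow> real) measure" where
  "unit_cube k = completion (\<Pi>\<^sub>M i\<in>{1..k}. lebesgue_on {0..1})"

definition symmetric_kernel :: "(real \<Rightarrow> real \<Rightarrow> 'a) \<Rightarrow> bool" where
  "symmetric_kernel W \<longleftrightarrow> (\<forall>x\<in>{0..1}. \<forall>y\<in>{0..1}. W x y = W y x)"

definition Lp_sym :: "real \<Rightarrow> (real \<Rightarrow> real \<Rightarrow> real) set" where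
  "Lp_sym p = {g. symmetric_kernel g \<and>
     (\<lambda>(x, y). g x y) \<in> borel_measurable unit_square \<and>
     integrable unit_square (\<lambda>(x, y). \<bar>g x y\<bar> powr p)}"

definition L_all :: "(real \<Rightarrow> real \<Rightarrow> real) set" where
  "L_all = (\<Inter>p\<in>{1..}. Lp_sym p)"

definition weak_star_measurable ::
    "(real \<Rightarrow> real \<Rightarrow> 'b::real_normed_vector \<Rightarrow>\<^sub>L real) \<Rightarrow> bool" where
  "weak_star_measurable W \<longleftrightarrow>
     (\<forall>b. (\<lambda>(x, y). blinfun_apply (W x y) b) \<in> borel_measurable unit_square)"

definition dual_graphon :: "(real \<Rightarrow> real \<Rightarrow> 'b::real_normed_vector \<Rightarrow>\<^sub>L real) \<Rightarrow> bool" where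
  "dual_graphon W \<longleftrightarrow> symmetric_kernel W \<and> weak_star_measurable W \<and>
     (\<lambda>x y. norm (W x y)) \<in> L_all"

definition graphon_norm ::
    "real \<Rightarrow> (real \<Rightarrow> real \<Rightarrow> 'b::real_normed_vector \<Rightarrow>\<^sub>L real) \<Rightarrow> real" where
  "graphon_norm p W = (\<integral>(x, y). norm (W x y) powr p \<partial>unit_square) powr (1 / p)"

definition generating :: "'b::real_normed_vector set \<Rightarrow> bool" where
  "generating \<F> \<longleftrightarrow> closure (span \<F>) = UNIV"

text \<open>
  A simple graph on \<open>{1..k}\<close> is given by its set \<open>E\<close> of two-element edges. The decoration \<open>f\<close> is a
  total function of which only the values on \<open>E\<close> matter.
\<close>

definition simple_graph :: "nat \<Rightarrow> nat set set \<Rightarrow> bool" where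
  "simple_graph k E \<longleftrightarrow> (\<forall>e\<in>E. e \<subseteq> {1..k} \<and> card e = 2)"

definition decorated_graph ::
    "'b set \<Rightarrow> nat \<Rightarrow> nat set set \<Rightarrow> (nat set \<Rightarrow> 'b) \<Rightarrow> bool" where
  "decorated_graph \<F> k E f \<longleftrightarrow> simple_graph k E \<and> f ` E \<subseteq> \<F>"

text \<open>
  The edge \<open>{i, j}\<close> with \<open>i < j\<close> is read as \<open>(i, j)\<close>; for symmetric \<open>W\<close> the order is irrelevant.
\<close>

definition hom_density ::
    "nat \<Rightarrow> nat set set \<Rightarrow> (nat set \<Rightarrow> 'b) \<Rightarrow>
     (real \<Rightarrow> real \<Rightarrow> 'b::real_normed_vector \<Rightarrow>\<^sub>L real) \<Rightarrow> real" where
  "hom_density k E f W =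
     (\<integral>x. (\<Prod>e\<in>E. blinfun_apply (W (x (Min e)) (x (Max e))) (f e)) \<partial>unit_cube k)"

end

theory Submission
  imports Defs "HOL-Probability.Infinite_Product_Measure" "HOL-Complex_Analysis.Great_Picard"
begin

text \<open>
  Call a finite partition of \<open>[0,1]\<close> regular for a kernel \<open>u\<close> if no refinement of each cell into a
  prescribed number of pieces raises the energy \<open>\<parallel>u\<^sub>P\<parallel>\<^sub>2\<^sup>2\<close> of its cell averages \<open>u\<^sub>P\<close> by more than
  \<open>\<epsilon>\<close>. Energies are bounded by a second moment, so every partition has a regular refinement with a
  number of cells that does not depend on \<open>u\<close>. Replacing \<open>u\<close> by \<open>u\<^sub>P\<close> on one edge \<open>{i, j}\<close> of a simple graph
  hardly changes the density: for fixed values of the other variables the remaining factors form a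
  product \<open>a(x\<^sub>i) b(x\<^sub>j)\<close>, and after truncating and discretizing \<open>a\<close> and \<open>b\<close> their level sets refine
  \<open>P\<close> into boundedly many pieces. All moments being bounded, no cut norm and no bound on the kernels is needed.

  For the countably many real kernels \<open>\<parallel>W\<^sub>n\<parallel>\<close> and \<open>\<langle>b, W\<^sub>n\<rangle>\<close> with \<open>b\<close> in the generating set this gives nested
  partitions. Along a subsequence their cell masses and cell averages converge; the limits are step
  kernels on nested interval partitions of \<open>[0,1]\<close>, and these form an \<open>L\<^sup>2\<close>-bounded martingale,
  hence converge. At almost every point the limit over \<open>b\<close> extends to a functional,
  bounded by the limit of the averages of \<open>\<parallel>W\<^sub>n\<parallel>\<close>. Finally densities are multilinear and continuous in the
  decoration, so convergence passes from the generating set to all of the Banach space.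
\<close>

text \<open>Two limits must be interchanged: n to infinity at a fixed partition level, and the level
  to infinity. Hence the number of cells at level m has to be the same for all n, and the counting
  error has to be uniform in n. The density of a step kernel depends only on cell masses and cell
  averages, so intervals of the limiting lengths can stand for arbitrary measurable cells. A second
  obstacle: the pairings with \<open>b\<close> are handled up to null sets that depend on
  \<open>b\<close>. Cell averages forget null sets and are exactly linear in \<open>b\<close>; so
  the limit functional is built pointwise from averages, and one null set, coming from countably
  many convergence statements, serves all \<open>b\<close>. A third one is measurability: the
  argument runs in products of Lebesgue measure on [0,1], whose sigma-algebra is smaller than that
  of Lebesgue measure on the square, so kernels are first replaced by product-measurable versions.
  Convergence of the densities of the \<open>W n\<close> enters only at the end, to identify the
  limit along the subsequence with that of the full sequence.\<close>

declare One_nat_def [simp del]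

section \<open>Densities of real kernels\<close>

text \<open>A crude stand-in for Hoelder's inequality: every factor is at most the largest one,
  whose power is one of the summands. It reduces integrals over the cube to moments on single edges.
  The summand 1 covers the empty product.\<close>

lemma prod_le_one_plus_sum_power:
  fixes g :: "'e \<Rightarrow> real"
  assumes "finite E" "\<And>e. e \<in> E \<Longrightarrow> 0 \<le> g e"
  shows "(\<Prod>e\<in>E. g e) \<le> 1 + (\<Sum>e\<in>E. g e ^ card E)"
proof (cases "E = {}")
  case False
  define m where "m = Max (g ` E)"
  have "m \<in> g ` E"
    unfolding m_def using assms False by (intro Max_in) auto
  then obtain e where e: "e \<in> E" "g e = m"
    by auto
  have "(\<Prod>e\<in>E. g e) \<le> (\<Prod>e\<in>E. m)"
    using assms by (intro prod_mono) (auto simp: m_def)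
  also have "\<dots> = g e ^ card E"
    by (simp add: e)
  also have "\<dots> \<le> (\<Sum>e\<in>E. g e ^ card E)"
    using assms e by (intro member_le_sum) auto
  finally show ?thesis by simp
qed simp

lemma one_plus_power_le:
  fixes t :: real
  assumes "0 \<le> t"
  shows "(1 + t) ^ n \<le> 2 ^ n * (1 + t ^ n)"
proof -
  have "(1 + t) ^ n \<le> (2 * max 1 t) ^ n"
    using assms by (intro power_mono) auto
  also have "\<dots> = 2 ^ n * max 1 t ^ n"
    by (simp add: power_mult_distrib)
  also have "max 1 t ^ n \<le> 1 + t ^ n"
    using assms by (auto simp: max_def)
  finally show ?thesis by simp
qed

text \<open>The majorant 1 + t^2 dominates both |t| and t^2 and is at least 1. So the product of
  these majorants over all edges controls a product of kernels, its square, and all products over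
  fewer edges at once.\<close>

lemma abs_le_one_plus_square: "\<bar>t\<bar> \<le> 1 + t\<^sup>2" for t :: real
  using zero_le_power2[of "\<bar>t\<bar> - 1"] by (simp add: power2_diff)

lemma abs_prod_le_prod_one_plus_square:
  fixes f :: "'e \<Rightarrow> real"
  shows "\<bar>\<Prod>e\<in>E. f e\<bar> \<le> (\<Prod>e\<in>E. 1 + (f e)\<^sup>2)"
  unfolding abs_prod by (intro prod_mono) (auto simp: abs_le_one_plus_square)

lemma square_prod_le_prod_one_plus_square:
  fixes f :: "'e \<Rightarrow> real"
  shows "(\<Prod>e\<in>E. f e)\<^sup>2 \<le> (\<Prod>e\<in>E. 1 + (f e)\<^sup>2)"
  unfolding prod_power_distrib by (intro prod_mono) auto

lemma simple_graph_edgeD: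
  assumes "simple_graph k E" "e \<in> E"
  shows "Min e \<in> {1..k}" "Max e \<in> {1..k}" "Min e < Max e" "e = {Min e, Max e}"
proof -
  have e: "e \<subseteq> {1..k}" "card e = 2"
    using assms by (auto simp: simple_graph_def)
  then have fin: "finite e" "e \<noteq> {}"
    using card.infinite by fastforce+
  show "Min e \<in> {1..k}" "Max e \<in> {1..k}"
    using e fin Min_in[of e] Max_in[of e] by blast+
  obtain a b where ab: "e = {a, b}" "a \<noteq> b"
    using e card_2_iff by metis
  then show "Min e < Max e" "e = {Min e, Max e}"
    by (auto simp: min_def max_def)
qed

lemma simple_graph_finite: "simple_graph k E \<Longrightarrow> finite E"
  by (rule finite_subset[of _ "Pow {1..k}"]) (auto simp: simple_graph_def)

lemma simple_graph_subset: "simple_graph k E \<Longrightarrow> E' \<subseteq> E \<Longrightarrow> simple_graph k E'"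
  by (auto simp: simple_graph_def)

text \<open>Bounds the integral of the product of 1 + v_e^2 over \<open>n\<close> edges, where
  \<open>C n\<close> bounds the moments of order 2n.\<close>

definition product_bound :: "(nat \<Rightarrow> real) \<Rightarrow> nat \<Rightarrow> real" where
  "product_bound C n = 1 + n * (2 ^ n * (1 + C n))"

abbreviation ends :: "nat set \<Rightarrow> (nat \<Rightarrow> 'a) \<Rightarrow> 'a \<times> 'a" where
  "ends e x \<equiv> (x (Min e), x (Max e))"

context prob_space
begin

abbreviation M2 :: "('a \<times> 'a) measure" where "M2 \<equiv> M \<Otimes>\<^sub>M M"

abbreviation cube :: "nat \<Rightarrow> (nat \<Rightarrow> 'a) measure" where "cube k \<equiv> PiM {1..k} (\<lambda>_. M)"

text \<open>Even natural exponents need no absolute values and admit the tangent inequality behind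
  Jensen's inequality, and they control all other exponents. \<open>C N\<close> belongs to the
  exponent 2N.\<close>

definition moment_bounded :: "(nat \<Rightarrow> real) \<Rightarrow> ('a \<times> 'a \<Rightarrow> real) \<Rightarrow> bool" where
  "moment_bounded C v \<longleftrightarrow> v \<in> borel_measurable M2 \<and>
     (\<forall>N. integrable M2 (\<lambda>z. v z ^ (2 * N)) \<and> (\<integral>z. v z ^ (2 * N) \<partial>M2) \<le> C N)"

definition kernel_density :: "nat \<Rightarrow> nat set set \<Rightarrow> (nat set \<Rightarrow> 'a \<times> 'a \<Rightarrow> real) \<Rightarrow> real" where
  "kernel_density k E v = (\<integral>x. (\<Prod>e\<in>E. v e (ends e x)) \<partial>cube k)"

lemma prob_space_M2: "prob_space M2"
proof -
  interpret pair_prob_space M M ..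
  show ?thesis by unfold_locales
qed

lemma sigma_finite_M2: "sigma_finite_measure M2"
  using prob_space_M2 by (simp add: prob_space_imp_sigma_finite)

lemma prob_space_cube: "prob_space (cube k)"
  by (rule prob_space_PiM) unfold_locales

text \<open>Two distinct coordinates are independent, which is checked on rectangles. With it, every
  statement about a single edge becomes one about \<open>M2\<close>.\<close>

lemma distr_PiM_pair:
  assumes "finite I" "i \<in> I" "j \<in> I" "i \<noteq> j"
  shows "distr (PiM I (\<lambda>_. M)) M2 (\<lambda>x. (x i, x j)) = M2"
proof -
  interpret P: product_prob_space "\<lambda>_. M" I ..
  have meas: "(\<lambda>x. (x i, x j)) \<in> measurable (PiM I (\<lambda>_. M)) M2"
    using assms by measurable
  show ?thesis
  proof (rule pair_measure_eqI[symmetric])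
    fix A B assume AB: "A \<in> sets M" "B \<in> sets M"
    have "emeasure (distr (PiM I (\<lambda>_. M)) M2 (\<lambda>x. (x i, x j))) (A \<times> B) =
      emeasure (PiM I (\<lambda>_. M)) ((\<lambda>x. (x i, x j)) -` (A \<times> B) \<inter> space (PiM I (\<lambda>_. M)))"
      using AB by (intro emeasure_distr[OF meas]) auto
    also have "(\<lambda>x. (x i, x j)) -` (A \<times> B) \<inter> space (PiM I (\<lambda>_. M)) =
      {x \<in> space (PiM I (\<lambda>_. M)). \<forall>l\<in>{i, j}. x l \<in> (if l = i then A else B)}"
      using assms by auto
    also have "emeasure (PiM I (\<lambda>_. M)) \<dots> = (\<Prod>l\<in>{i, j}. emeasure M (if l = i then A else B))"
      using assms AB by (intro P.emeasure_PiM_Collect) auto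
    also have "\<dots> = emeasure M A * emeasure M B"
      using assms by auto
    finally show "emeasure M A * emeasure M B =
      emeasure (distr (PiM I (\<lambda>_. M)) M2 (\<lambda>x. (x i, x j))) (A \<times> B)" ..
  qed (simp_all add: sigma_finite_measure_axioms)
qed

lemma
  fixes g :: "'a \<times> 'a \<Rightarrow> real"
  assumes "simple_graph k E" "e \<in> E" "g \<in> borel_measurable M2"
  shows edge_measurable: "(\<lambda>x. g (ends e x)) \<in> borel_measurable (cube k)"
    and integrable_edge: "integrable (cube k) (\<lambda>x. g (ends e x)) \<longleftrightarrow> integrable M2 g"
    and integral_edge: "(\<integral>x. g (ends e x) \<partial>cube k) = integral\<^sup>L M2 g"
proof -
  note e = simple_graph_edgeD[OF assms(1,2)]
  have m: "(\<lambda>x. (ends e x)) \<in> measurable (cube k) M2"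
    using e by measurable
  have d: "distr (cube k) M2 (\<lambda>x. (ends e x)) = M2"
    using e by (intro distr_PiM_pair) auto
  show "(\<lambda>x. g (ends e x)) \<in> borel_measurable (cube k)"
    using measurable_compose[OF m assms(3)] .
  show "integrable (cube k) (\<lambda>x. g (ends e x)) \<longleftrightarrow> integrable M2 g"
    using integrable_distr_eq[OF m assms(3)] d by simp
  show "(\<integral>x. g (ends e x) \<partial>cube k) = integral\<^sup>L M2 g"
    using integral_distr[OF m assms(3)] d by simp
qed

lemma AE_edge:
  assumes "simple_graph k E" "e \<in> E" "AE z in M2. P z"
  shows "AE x in cube k. P (ends e x)"
proof -
  note e = simple_graph_edgeD[OF assms(1,2)]
  have m: "(\<lambda>x. (ends e x)) \<in> measurable (cube k) M2"
    using e by measurable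
  have d: "distr (cube k) M2 (\<lambda>x. (ends e x)) = M2"
    using e by (intro distr_PiM_pair) auto
  show ?thesis
    using assms(3) by (subst (asm) d[symmetric]) (rule AE_distrD[OF m])
qed

lemma moment_bounded_measurable: "moment_bounded C v \<Longrightarrow> v \<in> borel_measurable M2"
  by (simp add: moment_bounded_def)

lemma moment_bounded_integrable_power:
  assumes "moment_bounded C v"
  shows "integrable M2 (\<lambda>z. v z ^ n)"
proof (rule Bochner_Integration.integrable_bound)
  interpret MM: prob_space M2 by (rule prob_space_M2)
  show "integrable M2 (\<lambda>z. 1 + v z ^ (2 * n))"
    using assms by (auto simp: moment_bounded_def)
  show "(\<lambda>z. v z ^ n) \<in> borel_measurable M2"
    using assms by (auto simp: moment_bounded_def)
  from abs_le_one_plus_square[of "v z ^ n" for z] show "AE z in M2. norm (v z ^ n) \<le> norm (1 + v z ^ (2 * n))"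
    by (simp add: power_mult mult.commute)
qed

lemma moment_bounded_integrable:
  assumes "moment_bounded C v"
  shows "integrable M2 v"
  using moment_bounded_integrable_power[OF assms, of 1] by simp

lemma moment_bounded_mono:
  assumes "moment_bounded C v" "\<And>N. C N \<le> D N"
  shows "moment_bounded D v"
  using assms by (meson moment_bounded_def order_trans)

lemma moment_bounded_nonneg:
  assumes "moment_bounded C v"
  shows "0 \<le> C N"
proof -
  have "0 \<le> (\<integral>z. v z ^ (2 * N) \<partial>M2)"
    by (intro Bochner_Integration.integral_nonneg zero_le_even_power) simp
  then show ?thesis
    using assms unfolding moment_bounded_def by (meson order_trans)
qed

text \<open>The n-th power of 1 + v^2, with n the number of edges, is at most 2^n (1 + v^(2n)); each
  such summand sees a single edge, so its integral is a moment over \<open>M2\<close>.\<close>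

lemma
  assumes E: "simple_graph k E" and mb: "\<And>e. e \<in> E \<Longrightarrow> moment_bounded C (v e)"
  shows integrable_prod_one_plus_square:
      "integrable (cube k) (\<lambda>x. \<Prod>e\<in>E. 1 + (v e (ends e x))\<^sup>2)" (is "integrable _ ?f")
    and integral_prod_one_plus_square:
      "(\<integral>x. (\<Prod>e\<in>E. 1 + (v e (ends e x))\<^sup>2) \<partial>cube k) \<le> product_bound C (card E)"
proof -
  interpret MM: prob_space M2 by (rule prob_space_M2)
  interpret cube: prob_space "cube k" by (rule prob_space_cube)
  let ?n = "card E"
  define g where "g = (\<lambda>e z. (2::real) ^ ?n * (1 + v e z ^ (2 * ?n)))"
  have g: "integrable M2 (g e)" "integral\<^sup>L M2 (g e) \<le> 2 ^ ?n * (1 + C ?n)" if "e \<in> E" for e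
  proof -
    have i: "integrable M2 (\<lambda>z. v e z ^ (2 * ?n))" "(\<integral>z. v e z ^ (2 * ?n) \<partial>M2) \<le> C ?n"
      using mb[OF that] by (auto simp: moment_bounded_def)
    then show "integrable M2 (g e)"
      by (simp add: g_def)
    have "integral\<^sup>L M2 (g e) = 2 ^ ?n * (1 + (\<integral>z. v e z ^ (2 * ?n) \<partial>M2))"
      using i(1) by (simp add: g_def MM.prob_space)
    then show "integral\<^sup>L M2 (g e) \<le> 2 ^ ?n * (1 + C ?n)"
      using i(2) by simp
  qed
  have gm: "g e \<in> borel_measurable M2" if "e \<in> E" for e
    using g[OF that] by auto
  let ?g = "\<lambda>x. 1 + (\<Sum>e\<in>E. g e (ends e x))"
  have int: "integrable (cube k) ?g"
    using E g gm by (auto simp: integrable_edge)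
  have "?f x \<le> 1 + (\<Sum>e\<in>E. (1 + (v e (ends e x))\<^sup>2) ^ ?n)" for x
    by (intro prod_le_one_plus_sum_power simple_graph_finite[OF E]) (auto intro: add_nonneg_nonneg)
  also have "\<dots> x \<le> ?g x" for x
    unfolding g_def
    by (intro add_left_mono sum_mono order_trans[OF one_plus_power_le]) (auto simp: power_mult)
  finally have le: "?f x \<le> ?g x" for x .
  have pos: "0 \<le> ?f x" for x
    by (intro prod_nonneg) (auto intro: add_nonneg_nonneg)
  have meas: "?f \<in> borel_measurable (cube k)"
    using edge_measurable[OF E _ moment_bounded_measurable[OF mb]] by (auto intro!: borel_measurable_prod)
  show "integrable (cube k) ?f"
    using le pos by (intro Bochner_Integration.integrable_bound[OF int meas]) (auto intro!: AE_I2 order_trans[OF le])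
  then have "integral\<^sup>L (cube k) ?f \<le> integral\<^sup>L (cube k) ?g"
    using int le by (intro integral_mono) auto
  also have "\<dots> = 1 + (\<Sum>e\<in>E. integral\<^sup>L M2 (g e))"
    using E g gm by (simp add: integrable_edge integral_edge cube.prob_space)
  also have "\<dots> \<le> 1 + (\<Sum>e\<in>E. 2 ^ ?n * (1 + C ?n))"
    using g by (intro add_left_mono sum_mono) auto
  finally show "integral\<^sup>L (cube k) ?f \<le> product_bound C ?n"
    by (simp add: product_bound_def)
qed

lemma
  assumes E: "simple_graph k E" and mb: "\<And>e. e \<in> E \<Longrightarrow> moment_bounded C (v e)"
  shows kernel_prod_measurable:
      "(\<lambda>x. \<Prod>e\<in>E. v e (ends e x)) \<in> borel_measurable (cube k)"
    and integrable_kernel_prod: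
      "integrable (cube k) (\<lambda>x. \<Prod>e\<in>E. v e (ends e x))"
    and abs_kernel_density_le: "\<bar>kernel_density k E v\<bar> \<le> product_bound C (card E)"
proof -
  show meas: "(\<lambda>x. \<Prod>e\<in>E. v e (ends e x)) \<in> borel_measurable (cube k)"
    using edge_measurable[OF E _ moment_bounded_measurable[OF mb]] by (auto intro!: borel_measurable_prod)
  have i: "integrable (cube k) (\<lambda>x. \<Prod>e\<in>E. 1 + (v e (ends e x))\<^sup>2)"
    using assms by (rule integrable_prod_one_plus_square)
  show int: "integrable (cube k) (\<lambda>x. \<Prod>e\<in>E. v e (ends e x))"
    by (rule Bochner_Integration.integrable_bound[OF i meas])
      (auto intro!: AE_I2 order_trans[OF abs_prod_le_prod_one_plus_square])
  show "\<bar>kernel_density k E v\<bar> \<le> product_bound C (card E)"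
  proof -
    let ?p = "\<lambda>x. \<Prod>e\<in>E. v e (ends e x)"
    have "\<bar>kernel_density k E v\<bar> \<le> (\<integral>x. \<bar>?p x\<bar> \<partial>cube k)"
      unfolding kernel_density_def by (rule integral_abs_bound)
    also have "\<dots> \<le> (\<integral>x. (\<Prod>e\<in>E. 1 + (v e (ends e x))\<^sup>2) \<partial>cube k)"
      by (rule integral_mono[OF integrable_abs[OF int] i abs_prod_le_prod_one_plus_square])
    also have "\<dots> \<le> product_bound C (card E)"
      by (rule integral_prod_one_plus_square[OF assms])
    finally show ?thesis .
  qed
qed

lemma kernel_density_cong_AE:
  assumes E: "simple_graph k E"
    and v: "\<And>e. e \<in> E \<Longrightarrow> v e \<in> borel_measurable M2" "\<And>e. e \<in> E \<Longrightarrow> v' e \<in> borel_measurable M2"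
    and AE: "\<And>e. e \<in> E \<Longrightarrow> AE z in M2. v e z = v' e z"
  shows "kernel_density k E v = kernel_density k E v'"
  unfolding kernel_density_def
proof (rule integral_cong_AE)
  show "(\<lambda>x. \<Prod>e\<in>E. v e (ends e x)) \<in> borel_measurable (cube k)"
    "(\<lambda>x. \<Prod>e\<in>E. v' e (ends e x)) \<in> borel_measurable (cube k)"
    using edge_measurable[OF E] v by (auto intro!: borel_measurable_prod)
  have "AE x in cube k. \<forall>e\<in>E. v e (ends e x) = v' e (ends e x)"
    using simple_graph_finite[OF E] AE_edge[OF E _ AE] by (simp add: AE_finite_all)
  then show "AE x in cube k. (\<Prod>e\<in>E. v e (ends e x)) = (\<Prod>e\<in>E. v' e (ends e x))"
    by eventually_elim (auto intro: prod.cong)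
qed

end

section \<open>Step kernels and energy regularity\<close>

text \<open>Convexity of the even power in tangent form: for a nonzero base this is Bernoulli's
  inequality for \<open>t / a\<close>, multiplied by the nonnegative \<open>a ^ n\<close>.\<close>

lemma even_power_tangent:
  fixes a t :: real
  assumes "even n"
  shows "a ^ n + real n * a ^ (n - 1) * (t - a) \<le> t ^ n"
proof (cases "n = 0 \<or> a = 0")
  case True
  with assms show ?thesis
    by (auto simp: power_0_left zero_le_even_power elim!: evenE)
next
  case False
  then have "a ^ n = a * a ^ (n - 1)"
    by (simp add: power_eq_if)
  then have "a ^ n + real n * a ^ (n - 1) * (t - a) = a ^ n * (1 + real n * (t / a - 1))"
    using False by (simp add: field_simps)
  also have "\<dots> \<le> a ^ n * (1 + (t / a - 1)) ^ n"
    using assms by (intro mult_left_mono Bernoulli_inequality_even) (auto simp: zero_le_even_power)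
  also have "\<dots> = t ^ n"
    using False by (simp add: power_divide)
  finally show ?thesis .
qed

lemma measurable_count_space_binop:
  fixes f :: "'a \<Rightarrow> 'c::countable" and g :: "'a \<Rightarrow> 'd::countable"
  assumes "f \<in> measurable M (count_space UNIV)" "g \<in> measurable M (count_space UNIV)"
  shows "(\<lambda>x. h (f x) (g x)) \<in> measurable M (count_space UNIV)"
proof (rule measurable_compose_countable[OF _ assms(1)])
  fix i
  show "(\<lambda>x. h i (g x)) \<in> measurable M (count_space UNIV)"
    using measurable_compose[OF assms(2), of "h i" "count_space UNIV"] by simp
qed

context prob_space
begin

text \<open>A partition is given by labels below \<open>K\<close>; cells may be empty or null. This
  lets partitions for different kernels have the same formal number of cells and makes coarsening an
  operation on labels.\<close>

definition label_map :: "nat \<Rightarrow> ('a \<Rightarrow> nat) \<Rightarrow> bool" where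
  "label_map K p \<longleftrightarrow> p \<in> measurable M (count_space UNIV) \<and> (\<forall>x. p x < K)"

definition cell_mass :: "('a \<Rightarrow> nat) \<Rightarrow> nat \<Rightarrow> real" where
  "cell_mass p i = measure M {x \<in> space M. p x = i}"

definition block_integral :: "('a \<times> 'a \<Rightarrow> real) \<Rightarrow> ('a \<Rightarrow> nat) \<Rightarrow> nat \<Rightarrow> nat \<Rightarrow> real" where
  "block_integral u p i j = (\<integral>z. of_bool (p (fst z) = i \<and> p (snd z) = j) * u z \<partial>M2)"

text \<open>Over a null cell this is 0, since division by zero gives 0;
  \<open>block_integral_eq\<close> shows that this value is consistent.\<close>

definition block_avg :: "('a \<times> 'a \<Rightarrow> real) \<Rightarrow> ('a \<Rightarrow> nat) \<Rightarrow> nat \<Rightarrow> nat \<Rightarrow> real" where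
  "block_avg u p i j = block_integral u p i j / (cell_mass p i * cell_mass p j)"

text \<open>For integrable \<open>u\<close>, a version of the conditional expectation given the
  products of cells.\<close>

definition step_kernel :: "('a \<times> 'a \<Rightarrow> real) \<Rightarrow> ('a \<Rightarrow> nat) \<Rightarrow> 'a \<times> 'a \<Rightarrow> real" where
  "step_kernel u p z = block_avg u p (p (fst z)) (p (snd z))"

definition energy :: "('a \<times> 'a \<Rightarrow> real) \<Rightarrow> ('a \<Rightarrow> nat) \<Rightarrow> real" where
  "energy u p = (\<integral>z. (step_kernel u p z)\<^sup>2 \<partial>M2)"

lemma label_mapD:
  assumes "label_map K p"
  shows "p \<in> measurable M (count_space UNIV)" "p x < K"
  using assms by (auto simp: label_map_def)

lemma label_cell_sets: "label_map K p \<Longrightarrow> {x \<in> space M. p x = i} \<in> sets M"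
  using label_mapD(1)[of K p] by measurable

lemma label_measurable_M2:
  fixes h :: "nat \<Rightarrow> nat \<Rightarrow> 'c"
  assumes "label_map K p"
  shows "(\<lambda>z. h (p (fst z)) (p (snd z))) \<in> measurable M2 (count_space UNIV)"
  using measurable_count_space_binop[of "\<lambda>z. p (fst z)" M2 "\<lambda>z. p (snd z)" Pair]
    label_mapD(1)[OF assms] measurable_compose[of _ M2 "count_space UNIV" "\<lambda>(i, j). h i j" "count_space UNIV"]
  by (auto simp: comp_def)

lemma label_borel_measurable:
  fixes h :: "nat \<Rightarrow> nat \<Rightarrow> real"
  assumes "label_map K p"
  shows "(\<lambda>z. h (p (fst z)) (p (snd z))) \<in> borel_measurable M2"
  using measurable_compose[OF label_measurable_M2[OF assms, of Pair], of "\<lambda>(i, j). h i j" borel] by simp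

lemma label_bounded:
  fixes h :: "nat \<Rightarrow> nat \<Rightarrow> real"
  assumes "label_map K p"
  obtains B where "\<And>z. \<bar>h (p (fst z)) (p (snd z))\<bar> \<le> B"
proof
  fix z :: "'a \<times> 'a"
  have "\<bar>h (p (fst z)) (p (snd z))\<bar> \<le> (\<Sum>j<K. \<bar>h (p (fst z)) j\<bar>)"
    using label_mapD(2)[OF assms] by (intro member_le_sum[where f = "\<lambda>j. \<bar>h (p (fst z)) j\<bar>"]) auto
  also have "\<dots> \<le> (\<Sum>i<K. \<Sum>j<K. \<bar>h i j\<bar>)"
    using label_mapD(2)[OF assms] by (intro member_le_sum[where f = "\<lambda>i. \<Sum>j<K. \<bar>h i j\<bar>"]) (auto intro: sum_nonneg)
  finally show "\<bar>h (p (fst z)) (p (snd z))\<bar> \<le> (\<Sum>i<K. \<Sum>j<K. \<bar>h i j\<bar>)" .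
qed

lemma integrable_label_mult:
  fixes h :: "nat \<Rightarrow> nat \<Rightarrow> real"
  assumes p: "label_map K p" and u: "integrable M2 u"
  shows "integrable M2 (\<lambda>z. h (p (fst z)) (p (snd z)) * u z)"
proof -
  obtain B where B: "\<And>z. \<bar>h (p (fst z)) (p (snd z))\<bar> \<le> B"
    using label_bounded[OF p, of h] by blast
  then have "0 \<le> B" by (meson abs_ge_zero order_trans)
  show ?thesis
  proof (rule Bochner_Integration.integrable_bound[where f = "\<lambda>z. B * u z"])
    show "(\<lambda>z. h (p (fst z)) (p (snd z)) * u z) \<in> borel_measurable M2"
      using label_borel_measurable[OF p] u by (intro borel_measurable_times) auto
    show "AE z in M2. norm (h (p (fst z)) (p (snd z)) * u z) \<le> norm (B * u z)"
      using B \<open>0 \<le> B\<close> by (auto simp: abs_mult intro!: mult_right_mono)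
  qed (use u in auto)
qed

lemma integral_label_mult:
  fixes h :: "nat \<Rightarrow> nat \<Rightarrow> real"
  assumes p: "label_map K p" and u: "integrable M2 u"
  shows "(\<integral>z. h (p (fst z)) (p (snd z)) * u z \<partial>M2) = (\<Sum>i<K. \<Sum>j<K. h i j * block_integral u p i j)"
proof -
  have i: "integrable M2 (\<lambda>z. of_bool (p (fst z) = i \<and> p (snd z) = j) * u z)" for i j
    using integrable_label_mult[OF p u, of "\<lambda>i' j'. of_bool (i' = i \<and> j' = j)"] by simp
  have "h (p (fst z)) (p (snd z)) * u z =
      (\<Sum>i<K. \<Sum>j<K. h i j * (of_bool (p (fst z) = i \<and> p (snd z) = j) * u z))" for z
  proof -
    have "h i j * (of_bool (p (fst z) = i \<and> p (snd z) = j) * u z) =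
        (if p (snd z) = j then if p (fst z) = i then h i j * u z else 0 else 0)" for i j
      by auto
    then have "(\<Sum>i<K. \<Sum>j<K. h i j * (of_bool (p (fst z) = i \<and> p (snd z) = j) * u z)) =
        h (p (fst z)) (p (snd z)) * u z"
      using label_mapD(2)[OF p] by (simp add: sum.delta')
    then show ?thesis ..
  qed
  then have "(\<integral>z. h (p (fst z)) (p (snd z)) * u z \<partial>M2) =
      (\<integral>z. (\<Sum>i<K. \<Sum>j<K. h i j * (of_bool (p (fst z) = i \<and> p (snd z) = j) * u z)) \<partial>M2)"
    by simp
  also have "\<dots> = (\<Sum>i<K. \<Sum>j<K. h i j * block_integral u p i j)"
    using i by (simp add: Bochner_Integration.integral_sum Bochner_Integration.integrable_sum block_integral_def)
  finally show ?thesis .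
qed

lemma block_integral_one:
  assumes p: "label_map K p"
  shows "block_integral (\<lambda>_. 1) p i j = cell_mass p i * cell_mass p j"
proof -
  let ?A = "{x \<in> space M. p x = i}" and ?B = "{x \<in> space M. p x = j}"
  have "block_integral (\<lambda>_. 1) p i j = (\<integral>z. indicator (?A \<times> ?B) z \<partial>M2)"
    unfolding block_integral_def by (intro Bochner_Integration.integral_cong) (auto simp: space_pair_measure indicator_def)
  also have "\<dots> = measure M2 (?A \<times> ?B)"
  proof -
    have "?A \<times> ?B \<in> sets M2"
      using label_cell_sets[OF p] by auto
    then show ?thesis
      by (simp add: Int_absorb2 sets.sets_into_space)
  qed
  also have "\<dots> = cell_mass p i * cell_mass p j"
    using label_cell_sets[OF p]
    by (simp add: measure_def emeasure_pair_measure_Times cell_mass_def enn2real_mult)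
  finally show ?thesis .
qed

lemma integral_label:
  fixes h :: "nat \<Rightarrow> nat \<Rightarrow> real"
  assumes p: "label_map K p"
  shows "(\<integral>z. h (p (fst z)) (p (snd z)) \<partial>M2) = (\<Sum>i<K. \<Sum>j<K. h i j * (cell_mass p i * cell_mass p j))"
proof -
  interpret MM: prob_space M2 by (rule prob_space_M2)
  show ?thesis
    using integral_label_mult[OF p, of "\<lambda>_. 1" h] by (simp add: block_integral_one[OF p])
qed

lemma block_integral_eq:
  assumes p: "label_map K p"
  shows "block_integral u p i j = block_avg u p i j * (cell_mass p i * cell_mass p j)"
proof (cases "cell_mass p i * cell_mass p j = 0")
  case True
  interpret MM: prob_space M2 by (rule prob_space_M2)
  let ?A = "{x \<in> space M. p x = i}" and ?B = "{x \<in> space M. p x = j}"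
  have "emeasure M2 (?A \<times> ?B) = 0"
    using True label_cell_sets[OF p]
    by (auto simp add: emeasure_pair_measure_Times cell_mass_def emeasure_eq_measure)
  then have "?A \<times> ?B \<in> null_sets M2"
    using label_cell_sets[OF p] by auto
  then have "AE z in M2. z \<notin> ?A \<times> ?B"
    by (rule AE_not_in)
  then have "AE z in M2. of_bool (p (fst z) = i \<and> p (snd z) = j) * u z = 0"
    using AE_space by eventually_elim (auto simp: space_pair_measure)
  then have "block_integral u p i j = 0"
    unfolding block_integral_def by (rule integral_eq_zero_AE)
  with True show ?thesis by simp
qed (simp add: block_avg_def)

lemma step_kernel_measurable: "label_map K p \<Longrightarrow> step_kernel u p \<in> borel_measurable M2"
  using label_borel_measurable[of K p "block_avg u p"] by (simp add: step_kernel_def[abs_def])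

lemma integrable_step_kernel_power:
  assumes p: "label_map K p"
  shows "integrable M2 (\<lambda>z. step_kernel u p z ^ n)"
proof -
  interpret MM: prob_space M2 by (rule prob_space_M2)
  show ?thesis
    using integrable_label_mult[OF p, of "\<lambda>_. 1" "\<lambda>i j. block_avg u p i j ^ n"] by (simp add: step_kernel_def)
qed

lemma integrable_step_kernel: "label_map K p \<Longrightarrow> integrable M2 (step_kernel u p)"
  using integrable_step_kernel_power[of K p u 1] by simp

text \<open>The defining property of conditional expectation: \<open>u\<close> and its step kernel
  cannot be told apart by functions that are constant on the blocks.\<close>

lemma integral_label_step_kernel:
  fixes h :: "nat \<Rightarrow> nat \<Rightarrow> real"
  assumes p: "label_map K p" and u: "integrable M2 u"
  shows "(\<integral>z. h (p (fst z)) (p (snd z)) * step_kernel u p z \<partial>M2) = (\<integral>z. h (p (fst z)) (p (snd z)) * u z \<partial>M2)"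
proof -
  have "(\<integral>z. h (p (fst z)) (p (snd z)) * step_kernel u p z \<partial>M2) =
    (\<Sum>i<K. \<Sum>j<K. h i j * block_avg u p i j * (cell_mass p i * cell_mass p j))"
    using integral_label[OF p, of "\<lambda>i j. h i j * block_avg u p i j"] by (simp add: step_kernel_def)
  also have "\<dots> = (\<Sum>i<K. \<Sum>j<K. h i j * block_integral u p i j)"
    by (simp add: block_integral_eq[OF p] mult.assoc)
  finally show ?thesis
    by (simp add: integral_label_mult[OF p u])
qed

text \<open>Jensen's inequality. Take the tangent of the even power at the step kernel and evaluate
  it at \<open>u\<close>: the linear term integrates to 0, because its coefficient is constant on
  the blocks.\<close>

lemma moment_bounded_step_kernel:
  assumes p: "label_map K p" and u: "moment_bounded C u"
  shows "moment_bounded C (step_kernel u p)"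
  unfolding moment_bounded_def
proof (intro conjI allI)
  fix N :: nat
  let ?n = "2 * N" and ?a = "step_kernel u p"
  note ui = moment_bounded_integrable[OF u]
  show "integrable M2 (\<lambda>z. ?a z ^ ?n)"
    by (rule integrable_step_kernel_power[OF p])
  have i1: "integrable M2 (\<lambda>z. ?a z ^ (?n - 1) * u z)" "integrable M2 (\<lambda>z. ?a z ^ (?n - 1) * ?a z)"
    using integrable_label_mult[OF p ui, of "\<lambda>i j. block_avg u p i j ^ (?n - 1)"]
      integrable_label_mult[OF p integrable_step_kernel[OF p], of "\<lambda>i j. block_avg u p i j ^ (?n - 1)" u]
    by (simp_all add: step_kernel_def)
  have "(\<integral>z. ?a z ^ (?n - 1) * u z \<partial>M2) = (\<integral>z. ?a z ^ (?n - 1) * ?a z \<partial>M2)"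
    using integral_label_step_kernel[OF p ui, of "\<lambda>i j. block_avg u p i j ^ (?n - 1)"] by (simp add: step_kernel_def)
  then have "(\<integral>z. ?a z ^ ?n \<partial>M2) = (\<integral>z. ?a z ^ ?n + real ?n * (?a z ^ (?n - 1) * u z - ?a z ^ (?n - 1) * ?a z) \<partial>M2)"
    using i1 integrable_step_kernel_power[OF p, of u ?n] by simp
  also have "\<dots> \<le> (\<integral>z. u z ^ ?n \<partial>M2)"
  proof (rule integral_mono)
    show "integrable M2 (\<lambda>z. ?a z ^ ?n + real ?n * (?a z ^ (?n - 1) * u z - ?a z ^ (?n - 1) * ?a z))"
      using i1 integrable_step_kernel_power[OF p, of u ?n]
      by (intro Bochner_Integration.integrable_add integrable_mult_right Bochner_Integration.integrable_diff)
    show "?a z ^ ?n + real ?n * (?a z ^ (?n - 1) * u z - ?a z ^ (?n - 1) * ?a z) \<le> u z ^ ?n" for z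
      using even_power_tangent[of ?n "?a z" "u z"] by (simp add: algebra_simps)
  qed (rule moment_bounded_integrable_power[OF u])
  also have "\<dots> \<le> C N"
    using u by (auto simp: moment_bounded_def)
  finally show "(\<integral>z. ?a z ^ ?n \<partial>M2) \<le> C N" .
qed (rule step_kernel_measurable[OF p])

lemma energy_le: "label_map K p \<Longrightarrow> moment_bounded C u \<Longrightarrow> energy u p \<le> C 1"
  using moment_bounded_step_kernel[of K p C u] unfolding energy_def moment_bounded_def
  by (metis mult_1_right)

lemma energy_nonneg: "0 \<le> energy u p"
  by (simp add: energy_def)

text \<open>Pythagoras for nested conditional expectations: the coarse step kernel is constant on
  the fine blocks, so its inner products with the fine step kernel, with \<open>u\<close> and with
  itself coincide.\<close>

lemma integral_step_kernel_diff_square: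
  assumes p: "label_map K p" and p': "label_map K' p'" and \<pi>: "\<And>x. p x = \<pi> (p' x)" and u: "integrable M2 u"
  shows "integrable M2 (\<lambda>z. (step_kernel u p' z - step_kernel u p z)\<^sup>2)"
    and "(\<integral>z. (step_kernel u p' z - step_kernel u p z)\<^sup>2 \<partial>M2) = energy u p' - energy u p"
proof -
  let ?a = "step_kernel u p" and ?a' = "step_kernel u p'"
  have a: "?a z = block_avg u p (\<pi> (p' (fst z))) (\<pi> (p' (snd z)))" for z
    by (simp add: step_kernel_def \<pi>)
  have i: "integrable M2 (\<lambda>z. ?a z * ?a' z)"
    unfolding a by (rule integrable_label_mult[OF p' integrable_step_kernel[OF p'], of "\<lambda>i j. block_avg u p (\<pi> i) (\<pi> j)"])
  have "(\<integral>z. ?a z * ?a' z \<partial>M2) = (\<integral>z. ?a z * u z \<partial>M2)"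
    unfolding a by (rule integral_label_step_kernel[OF p' u, of "\<lambda>i j. block_avg u p (\<pi> i) (\<pi> j)"])
  also have "\<dots> = (\<integral>z. ?a z * ?a z \<partial>M2)"
    using integral_label_step_kernel[OF p u, of "block_avg u p"] by (simp add: step_kernel_def)
  finally have eq: "(\<integral>z. ?a z * ?a' z \<partial>M2) = energy u p"
    by (simp add: energy_def power2_eq_square)
  note i2 = integrable_step_kernel_power[OF p, of u 2] integrable_step_kernel_power[OF p', of u 2]
  have d: "(?a' z - ?a z)\<^sup>2 = ?a' z ^ 2 + ?a z ^ 2 - 2 * (?a z * ?a' z)" for z
    by (simp add: power2_diff mult_ac)
  show "integrable M2 (\<lambda>z. (?a' z - ?a z)\<^sup>2)"
    unfolding d using i i2 by auto
  show "(\<integral>z. (?a' z - ?a z)\<^sup>2 \<partial>M2) = energy u p' - energy u p"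
    unfolding d using i i2 eq by (simp add: energy_def)
qed

text \<open>Only the partition matters, not the names of its cells. This permits padding the labels
  without changing any energy.\<close>

lemma step_kernel_cong:
  assumes "\<And>x y. x \<in> space M \<Longrightarrow> y \<in> space M \<Longrightarrow> p x = p y \<longleftrightarrow> q x = q y" "z \<in> space M2"
  shows "step_kernel u p z = step_kernel u q z"
proof -
  have z: "fst z \<in> space M" "snd z \<in> space M"
    using assms(2) by (auto simp: space_pair_measure)
  have "{x \<in> space M. p x = p y} = {x \<in> space M. q x = q y}" if "y \<in> space M" for y
    using assms(1)[OF _ that] by auto
  moreover have "block_integral u p (p (fst z)) (p (snd z)) = block_integral u q (q (fst z)) (q (snd z))"
    unfolding block_integral_def using assms(1)[OF _ z(1)] assms(1)[OF _ z(2)]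
    by (intro Bochner_Integration.integral_cong) (auto simp: space_pair_measure)
  ultimately show ?thesis
    using z by (simp add: step_kernel_def block_avg_def cell_mass_def)
qed

lemma energy_cong:
  assumes "\<And>x y. x \<in> space M \<Longrightarrow> y \<in> space M \<Longrightarrow> p x = p y \<longleftrightarrow> q x = q y"
  shows "energy u p = energy u q"
  unfolding energy_def by (intro Bochner_Integration.integral_cong) (simp_all add: step_kernel_cong[OF assms])

text \<open>Appends a digit in base \<open>r\<close>: for \<open>c\<close> with values below
  \<open>r\<close>, the old label is the quotient by \<open>r\<close> and the new digit the
  remainder.\<close>

definition refine :: "nat \<Rightarrow> ('a \<Rightarrow> nat) \<Rightarrow> ('a \<Rightarrow> nat) \<Rightarrow> 'a \<Rightarrow> nat" where
  "refine r p c x = p x * r + c x"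

definition regular :: "nat \<Rightarrow> real \<Rightarrow> ('a \<times> 'a \<Rightarrow> real) \<Rightarrow> ('a \<Rightarrow> nat) \<Rightarrow> bool" where
  "regular r \<epsilon> u p \<longleftrightarrow> (\<forall>c. label_map r c \<longrightarrow> energy u (refine r p c) \<le> energy u p + \<epsilon>)"

lemma label_map_refine:
  assumes "label_map K p" "label_map r c"
  shows "label_map (K * r) (refine r p c)"
proof -
  have "p x * r + c x < K * r" for x
  proof -
    have "p x * r + c x < Suc (p x) * r"
      using label_mapD(2)[OF assms(2)] by simp
    also have "\<dots> \<le> K * r"
      using label_mapD(2)[OF assms(1), of x] by (intro mult_right_mono) auto
    finally show ?thesis .
  qed
  then show ?thesis
    using measurable_count_space_binop[OF label_mapD(1)[OF assms(1)] label_mapD(1)[OF assms(2)], of "\<lambda>i j. i * r + j"]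
    by (simp add: label_map_def refine_def[abs_def])
qed

lemma refine_div: "label_map r c \<Longrightarrow> refine r p c x div r = p x"
  and refine_mod: "label_map r c \<Longrightarrow> refine r p c x mod r = c x"
  using label_mapD(2)[of r c x] by (auto simp: refine_def)

lemma refine_eq_iff:
  "label_map r c \<Longrightarrow> refine r p c x = refine r p c y \<longleftrightarrow> p x = p y \<and> c x = c y"
  by (metis refine_div refine_mod refine_def)

lemma energy_refine_mono:
  assumes "label_map K p" "label_map r c" "integrable M2 u"
  shows "energy u p \<le> energy u (refine r p c)"
proof -
  have "0 \<le> (\<integral>z. (step_kernel u (refine r p c) z - step_kernel u p z)\<^sup>2 \<partial>M2)"
    by simp
  also have "\<dots> = energy u (refine r p c) - energy u p"
    using refine_div[OF assms(2)]
    by (intro integral_step_kernel_diff_square(2)[OF assms(1) label_map_refine[OF assms(1,2)] _ assms(3), of "\<lambda>i. i div r"]) simp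
  finally show ?thesis by simp
qed

lemma label_map_zero: "0 < r \<Longrightarrow> label_map r (\<lambda>_. 0)"
  by (simp add: label_map_def)

text \<open>Energy increment: as long as some refinement raises the total energy by more than
  \<epsilon>, pass to it. \<open>T\<close> counts the increments still possible; for
  \<open>T = 0\<close> the assumption contradicts the bound \<open>D\<close>. The number of pieces
  is \<open>r ^ T\<close> however early the process stops.\<close>

lemma regular_refinement:
  assumes L: "finite L" and u: "\<And>l. l \<in> L \<Longrightarrow> integrable M2 (u l)"
    and D: "\<And>K q. label_map K q \<Longrightarrow> (\<Sum>l\<in>L. energy (u l) q) \<le> D"
    and r: "0 < r" and \<epsilon>: "0 < \<epsilon>"
    and p: "label_map K p" "D - real T * \<epsilon> < (\<Sum>l\<in>L. energy (u l) p)"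
  shows "\<exists>c. label_map (r ^ T) c \<and> (\<forall>l\<in>L. regular r \<epsilon> (u l) (refine (r ^ T) p c))"
  using p
proof (induction T arbitrary: p K)
  case 0
  then show ?case using D[of K p] by simp
next
  case (Suc T)
  show ?case
  proof (cases "\<forall>d. label_map r d \<longrightarrow> (\<Sum>l\<in>L. energy (u l) (refine r p d)) \<le> (\<Sum>l\<in>L. energy (u l) p) + \<epsilon>")
    case True
    \<comment> \<open>The process stops here. Appending the constant digit 0 keeps the partition and
      brings the number of labels to the prescribed value.\<close>
    define R where "R = r ^ Suc T"
    have R: "0 < R" using r by (simp add: R_def)
    define q where "q = refine R p (\<lambda>_. 0)"
    have q: "label_map (K * R) q"
      unfolding q_def by (rule label_map_refine[OF Suc.prems(1) label_map_zero[OF R]])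
    have qe: "energy v q = energy v p" for v
      unfolding q_def by (rule energy_cong) (simp add: refine_eq_iff[OF label_map_zero[OF R]])
    have qe': "energy v (refine r q d) = energy v (refine r p d)" if "label_map r d" for v d
      unfolding q_def
      by (rule energy_cong) (simp add: refine_eq_iff[OF label_map_zero[OF R]] refine_eq_iff[OF that])
    have "regular r \<epsilon> (u l) q" if "l \<in> L" for l
      unfolding regular_def
    proof (intro allI impI)
      fix d assume d: "label_map r d"
      \<comment> \<open>Refinement lowers no energy, so a single gain is at most the sum of all
        gains.\<close>
      have "energy (u l) (refine r p d) - energy (u l) p \<le> (\<Sum>l\<in>L. energy (u l) (refine r p d) - energy (u l) p)"
        using energy_refine_mono[OF Suc.prems(1) d u] that
        by (intro member_le_sum[OF that _ L]) auto
      also have "\<dots> \<le> \<epsilon>"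
        using True d by (simp add: sum_subtractf algebra_simps)
      finally show "energy (u l) (refine r q d) \<le> energy (u l) q + \<epsilon>"
        by (simp add: qe qe'[OF d])
    qed
    then show ?thesis
      using label_map_zero[OF R] unfolding q_def R_def by blast
  next
    case False
    then obtain d where d: "label_map r d"
      "(\<Sum>l\<in>L. energy (u l) p) + \<epsilon> < (\<Sum>l\<in>L. energy (u l) (refine r p d))"
      by (auto simp: not_le)
    have "D - real T * \<epsilon> < (\<Sum>l\<in>L. energy (u l) (refine r p d))"
      using d(2) Suc.prems(2) by (simp add: algebra_simps)
    from Suc.IH[OF label_map_refine[OF Suc.prems(1) d(1)] this] obtain c where
      c: "label_map (r ^ T) c" "\<forall>l\<in>L. regular r \<epsilon> (u l) (refine (r ^ T) (refine r p d) c)"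
      by blast
    have "label_map (r ^ Suc T) (refine (r ^ T) d c)"
      using label_map_refine[OF d(1) c(1)] by simp
    \<comment> \<open>Two successive refinements are one refinement by the two-digit label.\<close>
    moreover have "refine (r ^ Suc T) p (refine (r ^ T) d c) = refine (r ^ T) (refine r p d) c"
      by (auto simp: refine_def algebra_simps)
    ultimately show ?thesis
      using c(2) by (intro exI[of _ "refine (r ^ T) d c"]) simp
  qed
qed

end

section \<open>Truncation and rounding of real functions\<close>

text \<open>Truncate to [-m, m], round down to a multiple of 1/m, and shift the numerator by
  \<open>m * m\<close> to make it a natural number. This leaves 2 m^2 + 1 levels;
  \<open>level_value\<close> undoes shift and scaling.\<close>

definition level :: "nat \<Rightarrow> real \<Rightarrow> nat" where
  "level m t = nat (\<lfloor>real m * max (- real m) (min (real m) t)\<rfloor> + int (m * m))"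

definition level_value :: "nat \<Rightarrow> nat \<Rightarrow> real" where
  "level_value m i = (real i - real m * real m) / real m"

definition discretize :: "nat \<Rightarrow> real \<Rightarrow> real" where
  "discretize m t = level_value m (level m t)"

lemma
  assumes m: "0 < m"
  shows level_less: "level m t < 2 * m * m + 1"
    and abs_discretize_le: "\<bar>discretize m t\<bar> \<le> real m"
    and discretize_error: "\<bar>t - discretize m t\<bar> \<le> (1 + t\<^sup>2) / real m"
proof -
  define s where "s = max (- real m) (min (real m) t)"
  define f where "f = \<lfloor>real m * s\<rfloor>"
  have s: "- real m \<le> s" "s \<le> real m"
    using m by (auto simp: s_def)
  have ms: "- (real m * real m) \<le> real m * s" "real m * s \<le> real m * real m"
    using s mult_left_mono[of "- real m" s "real m"] mult_left_mono[of s "real m" "real m"] by auto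
  have f: "- int (m * m) \<le> f" "f \<le> int (m * m)"
  proof -
    show "- int (m * m) \<le> f"
      unfolding f_def using ms(1) by (simp add: le_floor_iff)
    have "real_of_int f \<le> real m * s"
      by (simp add: f_def)
    then have "real_of_int f \<le> real_of_int (int (m * m))"
      using ms(2) by simp
    then show "f \<le> int (m * m)"
      by linarith
  qed
  have l: "level m t = nat (f + int (m * m))"
    by (simp add: level_def f_def s_def)
  show "level m t < 2 * m * m + 1"
  proof -
    have "f + int (m * m) < int (2 * m * m + 1)"
      using f(2) by simp
    then show ?thesis
      unfolding l by linarith
  qed
  have d: "discretize m t = real_of_int f / real m"
    using f by (simp add: discretize_def level_value_def l)
  have d1: "discretize m t \<le> s"
    using m by (simp add: d f_def divide_simps mult.commute)
  have "real m * s < real_of_int f + 1"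
    by (simp add: f_def)
  then have d2: "s - 1 / real m \<le> discretize m t"
    using m divide_right_mono[of "real m * s - 1" "real_of_int f" "real m"] by (simp add: d diff_divide_distrib)
  have "real_of_int f \<le> real_of_int (int (m * m))" "real_of_int (- int (m * m)) \<le> real_of_int f"
    using f by linarith+
  then have "\<bar>real_of_int f\<bar> \<le> real m * real m"
    by simp
  then show "\<bar>discretize m t\<bar> \<le> real m"
    using m by (simp add: d divide_simps)
  \<comment> \<open>Truncation changes only values with |t| > m, where the error is at most |t| and
    hence at most t^2 / m. Rounding adds at most 1 / m.\<close>
  have "\<bar>t - s\<bar> \<le> t\<^sup>2 / real m"
  proof (cases "\<bar>t\<bar> \<le> real m")
    case True
    then show ?thesis by (simp add: s_def)
  next
    case False
    then have "\<bar>t - s\<bar> \<le> \<bar>t\<bar>"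
      by (auto simp: s_def)
    also have "\<bar>t\<bar> * real m \<le> \<bar>t\<bar> * \<bar>t\<bar>"
      using False by (intro mult_left_mono) auto
    then have "\<bar>t\<bar> \<le> t\<^sup>2 / real m"
      using m by (simp add: field_simps power2_eq_square)
    finally show ?thesis .
  qed
  then show "\<bar>t - discretize m t\<bar> \<le> (1 + t\<^sup>2) / real m"
    using d1 d2 by (simp add: add_divide_distrib)
qed

lemma level_measurable: "level m \<in> measurable borel (count_space UNIV)"
  unfolding level_def[abs_def] by measurable

lemma discretize_measurable: "discretize m \<in> borel_measurable borel"
  unfolding discretize_def[abs_def] using measurable_compose[OF level_measurable, of "level_value m" borel m] by simp

text \<open>The error is small relative to (1 + a^2) (1 + b^2), so it can be integrated by moment
  bounds although \<open>a\<close> and \<open>b\<close> are unbounded.\<close>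

lemma discretize_prod_error:
  assumes m: "0 < m"
  shows "\<bar>a * b - discretize m a * discretize m b\<bar> \<le> 3 * ((1 + a\<^sup>2) * (1 + b\<^sup>2)) / real m"
proof -
  let ?A = "1 + a\<^sup>2" and ?B = "1 + b\<^sup>2"
  have ab: "1 \<le> ?A" "1 \<le> ?B" "\<bar>b\<bar> \<le> ?B" "\<bar>a\<bar> \<le> ?A"
    by (simp_all add: abs_le_one_plus_square)
  have "(1 + a\<^sup>2) / real m \<le> ?A"
    using m divide_left_mono[of 1 "real m" ?A] by simp
  then have da: "\<bar>discretize m a\<bar> \<le> 2 * ?A"
  proof -
    have "\<bar>discretize m a\<bar> \<le> \<bar>a\<bar> + \<bar>a - discretize m a\<bar>"
      by arith
    also have "\<dots> \<le> ?A + ?A"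
      using discretize_error[OF m, of a] \<open>(1 + a\<^sup>2) / real m \<le> ?A\<close> ab(4) by (intro add_mono) auto
    finally show ?thesis by simp
  qed
  have "a * b - discretize m a * discretize m b = (a - discretize m a) * b + discretize m a * (b - discretize m b)"
    by (simp add: algebra_simps)
  then have "\<bar>a * b - discretize m a * discretize m b\<bar> \<le>
      \<bar>a - discretize m a\<bar> * \<bar>b\<bar> + \<bar>discretize m a\<bar> * \<bar>b - discretize m b\<bar>"
    by (simp add: abs_mult[symmetric])
  also have "\<dots> \<le> ?A / real m * ?B + 2 * ?A * (?B / real m)"
    using discretize_error[OF m] da ab by (intro add_mono mult_mono) (auto intro: divide_nonneg_nonneg)
  also have "\<dots> = 3 * (?A * ?B) / real m"
  proof -
    have "x / real m * y + 2 * x * (y / real m) = 3 * (x * y) / real m" for x y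
      using m by (simp add: field_simps)
    then show ?thesis .
  qed
  finally show ?thesis .
qed

text \<open>The replacement is made one index at a time. Congruence on \<open>E\<close> is asked
  because the hybrid for the full set agrees with \<open>v\<close> only on \<open>E\<close>.\<close>

lemma telescoping_bound:
  fixes T :: "('e \<Rightarrow> 'f) \<Rightarrow> real"
  assumes "finite E"
    and cong: "\<And>f g. (\<And>e. e \<in> E \<Longrightarrow> f e = g e) \<Longrightarrow> T f = T g"
    and step: "\<And>S e. S \<subseteq> E \<Longrightarrow> e \<in> E - S \<Longrightarrow>
      \<bar>T (\<lambda>e'. if e' \<in> insert e S then v e' else u e') - T (\<lambda>e'. if e' \<in> S then v e' else u e')\<bar> \<le> B"
  shows "\<bar>T v - T u\<bar> \<le> real (card E) * B"
proof -
  have "\<bar>T (\<lambda>e. if e \<in> S then v e else u e) - T u\<bar> \<le> real (card S) * B" if "S \<subseteq> E" for S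
    using finite_subset[OF that assms(1)] that
  proof (induction S rule: finite_induct)
    case (insert e S)
    then show ?case
      using step[of S e] by (auto simp: algebra_simps)
  qed simp
  from this[of E] cong[of "\<lambda>e. if e \<in> E then v e else u e" v] show ?thesis
    by simp
qed

section \<open>Regular kernels tested against discretized products\<close>

context prob_space
begin

text \<open>The second bound says that the variance of |f| is nonnegative.\<close>

lemma abs_expectation_le_sqrt:
  fixes f :: "'a \<Rightarrow> real"
  assumes f: "f \<in> borel_measurable M" "integrable M (\<lambda>x. (f x)\<^sup>2)"
  shows "integrable M f" "(\<integral>x. \<bar>f x\<bar> \<partial>M) \<le> sqrt (\<integral>x. (f x)\<^sup>2 \<partial>M)"
proof -
  show i: "integrable M f"
    by (rule square_integrable_imp_integrable[OF f])
  let ?c = "\<integral>x. \<bar>f x\<bar> \<partial>M"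
  have "0 \<le> (\<integral>x. (\<bar>f x\<bar> - ?c)\<^sup>2 \<partial>M)"
    by simp
  also have "\<dots> = (\<integral>x. (f x)\<^sup>2 \<partial>M) - ?c\<^sup>2"
    using f i by (simp add: power2_diff power2_eq_square prob_space algebra_simps)
  finally have "?c\<^sup>2 \<le> (\<integral>x. (f x)\<^sup>2 \<partial>M)"
    by simp
  then show "?c \<le> sqrt (\<integral>x. (f x)\<^sup>2 \<partial>M)"
    by (rule real_le_rsqrt)
qed

lemma moment_bounded_diff:
  assumes "moment_bounded C u" "moment_bounded C v"
  shows "moment_bounded (\<lambda>N. 2 * 4 ^ N * C N) (\<lambda>z. u z - v z)"
  unfolding moment_bounded_def
proof (intro conjI allI)
  show meas: "(\<lambda>z. u z - v z) \<in> borel_measurable M2"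
    using assms by (auto simp: moment_bounded_def)
  fix N
  have le: "(u z - v z) ^ (2 * N) \<le> 4 ^ N * (u z ^ (2 * N) + v z ^ (2 * N))" for z
  proof -
    have "(u z - v z) ^ (2 * N) = \<bar>u z - v z\<bar> ^ (2 * N)"
      by (simp add: power_mult)
    also have "\<dots> \<le> (2 * max \<bar>u z\<bar> \<bar>v z\<bar>) ^ (2 * N)"
      by (intro power_mono) auto
    also have "\<dots> = 4 ^ N * max \<bar>u z\<bar> \<bar>v z\<bar> ^ (2 * N)"
      by (simp add: power_mult_distrib power_mult)
    also have "\<dots> \<le> 4 ^ N * (u z ^ (2 * N) + v z ^ (2 * N))"
      by (intro mult_left_mono) (auto simp: max_def power_mult)
    finally show ?thesis .
  qed
  have i: "integrable M2 (\<lambda>z. 4 ^ N * (u z ^ (2 * N) + v z ^ (2 * N)))"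
    using assms by (auto intro: moment_bounded_integrable_power)
  show i2: "integrable M2 (\<lambda>z. (u z - v z) ^ (2 * N))"
    using meas le by (intro Bochner_Integration.integrable_bound[OF i]) (auto simp: zero_le_even_power intro!: order_trans[OF le])
  have "(\<integral>z. (u z - v z) ^ (2 * N) \<partial>M2) \<le> (\<integral>z. 4 ^ N * (u z ^ (2 * N) + v z ^ (2 * N)) \<partial>M2)"
    using i i2 le by (intro integral_mono) auto
  also have "\<dots> = 4 ^ N * ((\<integral>z. u z ^ (2 * N) \<partial>M2) + (\<integral>z. v z ^ (2 * N) \<partial>M2))"
    using assms by (simp add: moment_bounded_integrable_power)
  also have "\<dots> \<le> 4 ^ N * (C N + C N)"
    using assms by (intro mult_left_mono add_mono) (auto simp: moment_bounded_def)
  finally show "(\<integral>z. (u z - v z) ^ (2 * N) \<partial>M2) \<le> 2 * 4 ^ N * C N"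
    by simp
qed

text \<open>The discretized product is constant on the blocks of the refinement \<open>q\<close> of
  \<open>p\<close> by the levels of \<open>a\<close> and \<open>b\<close>. Hence \<open>u\<close>
  may be replaced by its step kernel on \<open>q\<close>, which regularity and Pythagoras place
  within \<open>sqrt \<epsilon>\<close> in L^2 of the one on \<open>p\<close>. The factor m^2 bounds
  the test function.\<close>

lemma regular_discretized:
  assumes p: "label_map K p" and m: "0 < m" and u: "integrable M2 u"
    and reg: "regular ((2 * m * m + 1)\<^sup>2) \<epsilon> u p"
    and a: "a \<in> borel_measurable M" and b: "b \<in> borel_measurable M"
  shows "\<bar>\<integral>z. (u z - step_kernel u p z) * (discretize m (a (fst z)) * discretize m (b (snd z))) \<partial>M2\<bar> \<le> real m * real m * sqrt \<epsilon>"
proof -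
  interpret MM: prob_space M2 by (rule prob_space_M2)
  define n where "n = 2 * m * m + 1"
  define ca where "ca = (\<lambda>x. level m (a x))"
  define cb where "cb = (\<lambda>x. level m (b x))"
  have ca: "label_map n ca" and cb: "label_map n cb"
    using measurable_compose[OF a level_measurable] measurable_compose[OF b level_measurable]
    by (auto simp: label_map_def ca_def cb_def n_def level_less[OF m])
  define c where "c = refine n ca cb"
  have c: "label_map (n\<^sup>2) c"
    using label_map_refine[OF ca cb] by (simp add: c_def power2_eq_square)
  define q where "q = refine (n\<^sup>2) p c"
  have q: "label_map (K * n\<^sup>2) q"
    unfolding q_def by (rule label_map_refine[OF p c])
  \<comment> \<open>Decodes labels of \<open>q\<close>: the remainder modulo n^2 has the level of
    \<open>a\<close> as its upper and the level of \<open>b\<close> as its lower base-n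
    digit.\<close>
  define h where "h i j = level_value m (i mod n\<^sup>2 div n) * level_value m (j mod n\<^sup>2 mod n)" for i j
  have h: "h (q x) (q y) = discretize m (a x) * discretize m (b y)" for x y
  proof -
    have "q x mod n\<^sup>2 div n = ca x" "q y mod n\<^sup>2 mod n = cb y"
      unfolding q_def refine_mod[OF c] by (simp_all add: c_def refine_div[OF cb] refine_mod[OF cb])
    then show ?thesis
      by (simp add: h_def discretize_def ca_def cb_def)
  qed
  have hb: "\<bar>h (q x) (q y)\<bar> \<le> real m * real m" for x y
    unfolding h abs_mult by (intro mult_mono abs_discretize_le m) auto
  let ?s = "step_kernel u q" and ?t = "step_kernel u p"
  have d: "integrable M2 (\<lambda>z. (?s z - ?t z)\<^sup>2)" "(\<integral>z. (?s z - ?t z)\<^sup>2 \<partial>M2) \<le> \<epsilon>"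
    using integral_step_kernel_diff_square[OF p q _ u, of "\<lambda>i. i div n\<^sup>2"] refine_div[OF c] reg c
    by (auto simp: q_def regular_def n_def)
  have meas: "(\<lambda>z. ?s z - ?t z) \<in> borel_measurable M2"
    using step_kernel_measurable[OF p] step_kernel_measurable[OF q] by auto
  note i = integrable_label_mult[OF q u, of h] integrable_label_mult[OF q integrable_step_kernel[OF q], of h u]
    integrable_label_mult[OF q integrable_step_kernel[OF p], of h u]
  have "(\<integral>z. (u z - ?t z) * (discretize m (a (fst z)) * discretize m (b (snd z))) \<partial>M2) =
      (\<integral>z. h (q (fst z)) (q (snd z)) * u z - h (q (fst z)) (q (snd z)) * ?t z \<partial>M2)"
    by (simp add: h algebra_simps)
  also have "\<dots> = (\<integral>z. h (q (fst z)) (q (snd z)) * ?s z - h (q (fst z)) (q (snd z)) * ?t z \<partial>M2)"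
    using i integral_label_step_kernel[OF q u, of h] by simp
  finally have "\<bar>\<integral>z. (u z - ?t z) * (discretize m (a (fst z)) * discretize m (b (snd z))) \<partial>M2\<bar> \<le>
      (\<integral>z. \<bar>h (q (fst z)) (q (snd z)) * ?s z - h (q (fst z)) (q (snd z)) * ?t z\<bar> \<partial>M2)"
    by simp
  also have "\<dots> \<le> (\<integral>z. real m * real m * \<bar>?s z - ?t z\<bar> \<partial>M2)"
  proof (rule integral_mono)
    show "integrable M2 (\<lambda>z. \<bar>h (q (fst z)) (q (snd z)) * ?s z - h (q (fst z)) (q (snd z)) * ?t z\<bar>)"
      using i by auto
    show "integrable M2 (\<lambda>z. real m * real m * \<bar>?s z - ?t z\<bar>)"
      using integrable_step_kernel[OF p] integrable_step_kernel[OF q] by auto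
    show "\<bar>h (q (fst z)) (q (snd z)) * ?s z - h (q (fst z)) (q (snd z)) * ?t z\<bar> \<le> real m * real m * \<bar>?s z - ?t z\<bar>" for z
      unfolding right_diff_distrib[symmetric] abs_mult by (intro mult_right_mono hb) auto
  qed
  also have "\<dots> = real m * real m * (\<integral>z. \<bar>?s z - ?t z\<bar> \<partial>M2)"
    by simp
  also have "\<dots> \<le> real m * real m * sqrt \<epsilon>"
    using MM.abs_expectation_le_sqrt(2)[OF meas d(1)] d(2)
    by (intro mult_left_mono) (auto intro: order_trans)
  finally show ?thesis .
qed

section \<open>Integration over the two ends of one edge\<close>

lemma distr_split_pair:
  assumes "finite I" "i \<notin> I" "j \<notin> I" "i \<noteq> j"
  shows "(\<lambda>(y, s, t). y(j := t, i := s)) \<in> measurable (PiM I (\<lambda>_. M) \<Otimes>\<^sub>M M2) (PiM (insert i (insert j I)) (\<lambda>_. M))"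
    and "distr (PiM I (\<lambda>_. M) \<Otimes>\<^sub>M M2) (PiM (insert i (insert j I)) (\<lambda>_. M)) (\<lambda>(y, s, t). y(j := t, i := s)) = PiM (insert i (insert j I)) (\<lambda>_. M)"
proof -
  interpret PI: product_prob_space "\<lambda>_. M" I ..
  interpret fPI: finite_product_prob_space "\<lambda>_. M" I by standard fact
  let ?J = "insert i (insert j I)" and ?f = "\<lambda>(y, s, t). y(j := t, i := s)"
  let ?P = "PiM I (\<lambda>_. M)"
  show meas: "?f \<in> measurable (?P \<Otimes>\<^sub>M M2) (PiM ?J (\<lambda>_. M))"
    unfolding split_beta' by (intro measurable_fun_upd[where J = "insert j I"] measurable_fun_upd[where J = I]) auto
  show "distr (?P \<Otimes>\<^sub>M M2) (PiM ?J (\<lambda>_. M)) ?f = PiM ?J (\<lambda>_. M)"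
  proof (rule PI.PiM_eqI)
    fix A assume A: "\<And>l. l \<in> ?J \<Longrightarrow> A l \<in> sets M"
    have sub: "A l \<subseteq> space M" if "l \<in> ?J" for l
      using A[OF that] sets.sets_into_space by blast
    have "?f -` (Pi\<^sub>E ?J A) \<inter> space (?P \<Otimes>\<^sub>M M2) = Pi\<^sub>E I A \<times> (A i \<times> A j)"
      using sub assms by (force simp: space_pair_measure space_PiM PiE_iff extensional_def split: if_splits)
    then have "emeasure (distr (?P \<Otimes>\<^sub>M M2) (PiM ?J (\<lambda>_. M)) ?f) (Pi\<^sub>E ?J A) = emeasure (?P \<Otimes>\<^sub>M M2) (Pi\<^sub>E I A \<times> (A i \<times> A j))"
      using A assms by (subst emeasure_distr[OF meas]) (auto intro!: sets_PiM_I_finite)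
    also have "\<dots> = emeasure ?P (Pi\<^sub>E I A) * (emeasure M (A i) * emeasure M (A j))"
      using A assms
      by (subst sigma_finite_measure.emeasure_pair_measure_Times[OF sigma_finite_M2])
        (auto simp: emeasure_pair_measure_Times intro!: sets_PiM_I_finite)
    also have "emeasure ?P (Pi\<^sub>E I A) = (\<Prod>l\<in>I. emeasure M (A l))"
      using A by (intro fPI.measure_times) auto
    also have "(\<Prod>l\<in>I. emeasure M (A l)) * (emeasure M (A i) * emeasure M (A j)) = (\<Prod>l\<in>?J. emeasure M (A l))"
      using assms by (simp add: mult_ac)
    finally show "emeasure (distr (?P \<Otimes>\<^sub>M M2) (PiM ?J (\<lambda>_. M)) ?f) (Pi\<^sub>E ?J A) = (\<Prod>l\<in>?J. emeasure M (A l))" .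
  qed (use assms in auto)
qed

text \<open>Fubini: integrate over the coordinates \<open>i\<close> and \<open>j\<close> with all
  others frozen. A bound valid for every frozen point survives averaging over a probability
  space.\<close>

lemma abs_integral_cube_le:
  fixes f :: "(nat \<Rightarrow> 'a) \<Rightarrow> real"
  assumes f: "integrable (cube k) f" and ij: "i \<in> {1..k}" "j \<in> {1..k}" "i \<noteq> j"
    and le: "\<And>y. y \<in> space (PiM ({1..k} - {i, j}) (\<lambda>_. M)) \<Longrightarrow> \<bar>\<integral>z. f (y(j := snd z, i := fst z)) \<partial>M2\<bar> \<le> B"
  shows "\<bar>integral\<^sup>L (cube k) f\<bar> \<le> B"
proof -
  let ?I = "{1..k} - {i, j}" and ?f = "\<lambda>(y, s, t). y(j := t, i := s)"
  let ?P = "PiM ?I (\<lambda>_. M)"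
  have J: "insert i (insert j ?I) = {1..k}"
    using ij by auto
  interpret MM: prob_space M2 by (rule prob_space_M2)
  interpret P: prob_space ?P by (rule prob_space_PiM) unfold_locales
  interpret PM: pair_sigma_finite ?P M2 ..
  note d = distr_split_pair[of ?I i j, unfolded J]
  have m: "?f \<in> measurable (?P \<Otimes>\<^sub>M M2) (cube k)"
    and eq: "distr (?P \<Otimes>\<^sub>M M2) (cube k) ?f = cube k"
    using d ij by auto
  have fm: "f \<in> borel_measurable (cube k)"
    using f by auto
  have int: "integrable (?P \<Otimes>\<^sub>M M2) (\<lambda>w. f (?f w))"
    using f integrable_distr_eq[OF m fm] eq by simp
  have "integral\<^sup>L (cube k) f = integral\<^sup>L (distr (?P \<Otimes>\<^sub>M M2) (cube k) ?f) f"
    by (simp only: eq)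
  also have "\<dots> = (\<integral>w. f (?f w) \<partial>(?P \<Otimes>\<^sub>M M2))"
    by (rule integral_distr[OF m fm])
  also have "\<dots> = (\<integral>y. \<integral>z. f (?f (y, z)) \<partial>M2 \<partial>?P)"
    by (rule PM.integral_fst'[OF int, symmetric])
  finally have e: "integral\<^sup>L (cube k) f = (\<integral>y. \<integral>z. f (?f (y, z)) \<partial>M2 \<partial>?P)" .
  note i = PM.integrable_fst'[OF int]
  have "\<bar>integral\<^sup>L (cube k) f\<bar> \<le> (\<integral>y. \<bar>\<integral>z. f (?f (y, z)) \<partial>M2\<bar> \<partial>?P)"
    unfolding e by (rule integral_abs_bound)
  also have "\<dots> \<le> (\<integral>y. B \<partial>?P)"
    using i le by (intro integral_mono_AE AE_I2) (auto simp: split_beta')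
  finally show ?thesis
    by (simp add: P.prob_space)
qed

end

section \<open>The counting lemma\<close>

lemma prod_fun_upd_remove:
  fixes h :: "'e \<Rightarrow> 'f \<Rightarrow> real"
  assumes "finite E" "e \<in> E"
  shows "(\<Prod>e'\<in>E. h e' ((v(e := u)) e')) = h e u * (\<Prod>e'\<in>E - {e}. h e' (v e'))"
proof -
  have "(\<Prod>e'\<in>E - {e}. h e' ((v(e := u)) e')) = (\<Prod>e'\<in>E - {e}. h e' (v e'))"
    by (rule prod.cong) auto
  then show ?thesis
    using prod.remove[OF assms, of "\<lambda>e'. h e' ((v(e := u)) e')"] by simp
qed

context prob_space
begin

lemma kernel_density_cong:
  assumes "\<And>e. e \<in> E \<Longrightarrow> v e = v' e"
  shows "kernel_density k E v = kernel_density k E v'"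
  unfolding kernel_density_def using assms by (intro Bochner_Integration.integral_cong prod.cong) auto

lemma kernel_density_remove:
  assumes "simple_graph k E" "e \<in> E"
  shows "kernel_density k E v =
    (\<integral>x. v e (ends e x) * (\<Prod>e'\<in>E - {e}. v e' (ends e' x)) \<partial>cube k)"
  unfolding kernel_density_def
  by (intro Bochner_Integration.integral_cong prod.remove[OF simple_graph_finite[OF assms(1)] assms(2)]) simp

lemma kernel_density_linear_edge:
  assumes E: "simple_graph k E" "e \<in> E"
    and v: "\<And>e'. e' \<in> E - {e} \<Longrightarrow> moment_bounded C (v e')"
    and w: "moment_bounded C w" "moment_bounded C w'"
  shows "kernel_density k E (v(e := (\<lambda>z. a * w z + w' z))) =
      a * kernel_density k E (v(e := w)) + kernel_density k E (v(e := w'))"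
proof -
  let ?r = "\<lambda>x. \<Prod>e'\<in>E - {e}. v e' (ends e' x)"
  have pr: "(\<Prod>e'\<in>E. (v(e := u)) e' (ends e' x)) = u (ends e x) * ?r x" for u x
    by (rule prod_fun_upd_remove[OF simple_graph_finite[OF E(1)] E(2), of "\<lambda>e' f. f (ends e' x)"])
  have i: "integrable (cube k) (\<lambda>x. u (ends e x) * ?r x)" if "moment_bounded C u" for u
    unfolding pr[symmetric] using v that by (intro integrable_kernel_prod[OF E(1), of C]) auto
  show ?thesis
    unfolding kernel_density_def pr
    using i[OF w(1)] i[OF w(2)] by (simp add: distrib_right mult.assoc)
qed

lemma kernel_density_diff_edge:
  assumes E: "simple_graph k E" "e \<in> E"
    and v: "\<And>e'. e' \<in> E - {e} \<Longrightarrow> moment_bounded C (v e')"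
    and w: "moment_bounded C w" "moment_bounded C w'"
  shows "kernel_density k E (v(e := w)) - kernel_density k E (v(e := w')) =
      kernel_density k E (v(e := (\<lambda>z. w z - w' z)))"
proof -
  have "kernel_density k E (v(e := (\<lambda>z. - 1 * w' z + w z))) =
      - 1 * kernel_density k E (v(e := w')) + kernel_density k E (v(e := w))"
    by (rule kernel_density_linear_edge[OF E v w(2,1)])
  also have "(\<lambda>z. - 1 * w' z + w z) = (\<lambda>z. w z - w' z)"
    by auto
  finally show ?thesis by linarith
qed

text \<open>The core of the counting lemma. The difference is the integral of w = u - step_kernel u
  p against the other edges. These split into those missing the vertex j (\<open>Fa\<close>) and
  those containing it (\<open>Fb\<close>); the latter avoid i because the graph is simple.
  Regularity handles the discretized product, moments handle the discretization error.\<close>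

lemma regular_edge_bound:
  assumes E: "simple_graph k E" "e \<in> E"
    and v: "\<And>e'. e' \<in> E - {e} \<Longrightarrow> moment_bounded C (v e')"
    and u: "moment_bounded C u" and p: "label_map K p" and m: "0 < m"
    and reg: "regular ((2 * m * m + 1)\<^sup>2) \<epsilon> u p"
  shows "\<bar>kernel_density k E (v(e := u)) - kernel_density k E (v(e := step_kernel u p))\<bar> \<le>
     real m * real m * sqrt \<epsilon> + 12 * product_bound (\<lambda>N. 2 * 4 ^ N * C N) (card E) / real m"
proof -
  interpret MM: prob_space M2 by (rule prob_space_M2)
  let ?i = "Min e" and ?j = "Max e" and ?C = "\<lambda>N. 2 * 4 ^ N * C N"
  note ed = simple_graph_edgeD[OF E]
  note fin = simple_graph_finite[OF E(1)]
  define w where "w z = u z - step_kernel u p z" for z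
  have w: "moment_bounded ?C w"
    unfolding w_def by (rule moment_bounded_diff[OF u moment_bounded_step_kernel[OF p u]])
  \<comment> \<open>The enlarged bound, which the difference \<open>w\<close> requires, is imposed
    on all kernels so that one sequence serves the whole product.\<close>
  have v': "moment_bounded ?C (v e')" if "e' \<in> E - {e}" for e'
  proof (rule moment_bounded_mono[OF v[OF that]])
    fix N
    have "1 * C N \<le> (2 * 4 ^ N) * C N"
      using moment_bounded_nonneg[OF u] by (intro mult_right_mono) (auto intro: order_trans[of _ 2])
    then show "C N \<le> ?C N" by simp
  qed
  define Fa where "Fa = {e' \<in> E - {e}. ?j \<notin> e'}"
  define Fb where "Fb = {e' \<in> E - {e}. ?j \<in> e'}"
  have F: "E - {e} = Fa \<union> Fb" "Fa \<inter> Fb = {}" "finite Fa" "finite Fb"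
    using fin by (auto simp: Fa_def Fb_def)
  have G: "simple_graph k Fa" "simple_graph k Fb"
    using E(1) by (auto intro: simple_graph_subset simp: Fa_def Fb_def)
  have Fb: "?i \<notin> e'" if "e' \<in> Fb" for e'
  proof
    assume "?i \<in> e'"
    with that have e': "e' \<in> E" "e' \<noteq> e" "?i \<in> e'" "?j \<in> e'"
      by (auto simp: Fb_def)
    have "card e' = 2"
      using E(1) e'(1) by (simp add: simple_graph_def)
    then have "{?i, ?j} = e'"
      using e' ed(3) by (intro card_subset_eq) (auto intro: card_ge_0_finite)
    with ed(4) e'(2) show False by simp
  qed
  define a where "a x = (\<Prod>e'\<in>Fa. v e' (ends e' x))" for x
  define b where "b x = (\<Prod>e'\<in>Fb. v e' (ends e' x))" for x
  have am: "a \<in> borel_measurable (cube k)"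
    unfolding a_def[abs_def] by (rule kernel_prod_measurable[OF G(1) v]) (auto simp: Fa_def)
  have bm: "b \<in> borel_measurable (cube k)"
    unfolding b_def[abs_def] by (rule kernel_prod_measurable[OF G(2) v]) (auto simp: Fb_def)
  have wm: "(\<lambda>x. w (ends e x)) \<in> borel_measurable (cube k)"
    by (rule edge_measurable[OF E moment_bounded_measurable[OF w]])
  have pr: "(\<Prod>e'\<in>E - {e}. v e' (ends e' x)) = a x * b x" for x
    unfolding a_def b_def F(1) by (rule prod.union_disjoint[OF F(3,4,2)])
  let ?f = "\<lambda>x. w (ends e x) * (a x * b x)"
  let ?g = "\<lambda>x. w (ends e x) * (discretize m (a x) * discretize m (b x))"
  let ?h = "\<lambda>x. \<Prod>e'\<in>E. 1 + ((v(e := w)) e' (ends e' x))\<^sup>2"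
  have vw: "moment_bounded ?C ((v(e := w)) e')" if "e' \<in> E" for e'
    using v' w that by auto
  have f: "integrable (cube k) ?f" "kernel_density k E (v(e := u)) - kernel_density k E (v(e := step_kernel u p)) = integral\<^sup>L (cube k) ?f"
  proof -
    have pe: "(\<Prod>e'\<in>E. (v(e := w)) e' (ends e' x)) = ?f x" for x
      unfolding pr[symmetric] by (rule prod_fun_upd_remove[OF fin E(2), of "\<lambda>e' f. f (ends e' x)"])
    show "integrable (cube k) ?f"
      unfolding pe[symmetric] by (rule integrable_kernel_prod[OF E(1) vw])
    show "kernel_density k E (v(e := u)) - kernel_density k E (v(e := step_kernel u p)) = integral\<^sup>L (cube k) ?f"
    proof -
      have "kernel_density k E (v(e := u)) - kernel_density k E (v(e := step_kernel u p)) =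
          kernel_density k E (v(e := (\<lambda>z. u z - step_kernel u p z)))"
        by (rule kernel_density_diff_edge[OF E v u moment_bounded_step_kernel[OF p u]])
      also have "(\<lambda>z. u z - step_kernel u p z) = w"
        by (simp add: w_def fun_eq_iff)
      finally show ?thesis
        unfolding kernel_density_def pe .
    qed
  qed
  have h: "integrable (cube k) ?h" "integral\<^sup>L (cube k) ?h \<le> product_bound ?C (card E)"
    by (rule integrable_prod_one_plus_square[OF E(1) vw] integral_prod_one_plus_square[OF E(1) vw]; assumption)+
  have gm: "?g \<in> borel_measurable (cube k)"
    using wm measurable_compose[OF am discretize_measurable] measurable_compose[OF bm discretize_measurable] by auto
  \<comment> \<open>The constant is 12 = 3 * 2 * 2: the 3 is from
    \<open>discretize_prod_error\<close>, each 2 from 1 + a^2 \<le> 2 A with A \<ge> 1.\<close>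
  have err: "\<bar>?f x - ?g x\<bar> \<le> 12 / real m * ?h x" for x
  proof -
    let ?A = "\<Prod>e'\<in>Fa. 1 + (v e' (ends e' x))\<^sup>2"
    let ?B = "\<Prod>e'\<in>Fb. 1 + (v e' (ends e' x))\<^sup>2"
    have A1: "1 \<le> ?A" "1 \<le> ?B"
      by (intro prod_ge_1; simp)+
    have AB: "1 + (a x)\<^sup>2 \<le> 2 * ?A" "1 + (b x)\<^sup>2 \<le> 2 * ?B"
      using A1 square_prod_le_prod_one_plus_square[of "\<lambda>e'. v e' (ends e' x)" Fa]
        square_prod_le_prod_one_plus_square[of "\<lambda>e'. v e' (ends e' x)" Fb]
      unfolding a_def b_def by linarith+
    have "?h x = (1 + (w (ends e x))\<^sup>2) * (\<Prod>e'\<in>E - {e}. 1 + (v e' (ends e' x))\<^sup>2)"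
      by (rule prod_fun_upd_remove[OF fin E(2), of "\<lambda>e' f. 1 + (f (ends e' x))\<^sup>2"])
    also have "(\<Prod>e'\<in>E - {e}. 1 + (v e' (ends e' x))\<^sup>2) = ?A * ?B"
      unfolding F(1) by (rule prod.union_disjoint[OF F(3,4,2)])
    finally have hx: "?h x = (1 + (w (ends e x))\<^sup>2) * (?A * ?B)" .
    have "\<bar>?f x - ?g x\<bar> = \<bar>w (ends e x)\<bar> * \<bar>a x * b x - discretize m (a x) * discretize m (b x)\<bar>"
      by (simp add: right_diff_distrib[symmetric] abs_mult)
    also have "\<dots> \<le> (1 + (w (ends e x))\<^sup>2) * (3 * ((1 + (a x)\<^sup>2) * (1 + (b x)\<^sup>2)) / real m)"
      by (intro mult_mono abs_le_one_plus_square discretize_prod_error m) auto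
    also have "\<dots> \<le> (1 + (w (ends e x))\<^sup>2) * (3 * ((2 * ?A) * (2 * ?B)) / real m)"
      using A1 by (intro mult_left_mono divide_right_mono mult_mono AB) auto
    also have "\<dots> = 12 / real m * ?h x"
      unfolding hx by (simp add: field_simps)
    finally show ?thesis .
  qed
  have gi: "integrable (cube k) ?g"
  proof -
    have "integrable (cube k) (\<lambda>x. ?f x - ?g x)"
    proof (rule Bochner_Integration.integrable_bound[OF integrable_mult_right[OF h(1), of "12 / real m"]])
      show "(\<lambda>x. ?f x - ?g x) \<in> borel_measurable (cube k)"
        using f(1) gm by (intro borel_measurable_diff) auto
      show "AE x in cube k. norm (?f x - ?g x) \<le> norm (12 / real m * ?h x)"
        unfolding real_norm_def by (intro AE_I2 order_trans[OF err abs_ge_self])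
    qed
    from Bochner_Integration.integrable_diff[OF f(1) this] show ?thesis by simp
  qed
  have "\<bar>integral\<^sup>L (cube k) ?g\<bar> \<le> real m * real m * sqrt \<epsilon>"
  proof (rule abs_integral_cube_le[OF gi ed(1,2)])
    fix y assume y: "y \<in> space (PiM ({1..k} - {?i, ?j}) (\<lambda>_. M))"
    have J: "{1..k} = insert ?i (insert ?j ({1..k} - {?i, ?j}))"
      using ed by auto
    have ym: "(\<lambda>s. y(?j := s, ?i := s)) \<in> measurable M (cube k)"
      using y by (subst J) (intro measurable_fun_upd[where J = "insert ?j ({1..k} - {?i, ?j})"]
          measurable_fun_upd[where J = "{1..k} - {?i, ?j}"], auto)
    \<comment> \<open>\<open>a\<close> ignores the coordinate j, so that coordinate may be set equal
      to coordinate i. This turns \<open>a\<close> into a function of one variable;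
      \<open>bx\<close> does the same for \<open>b\<close>.\<close>
    have ax: "a (y(?j := t, ?i := s)) = a (y(?j := s, ?i := s))" for s t
    proof -
      have "Min e' \<noteq> ?j \<and> Max e' \<noteq> ?j" if "e' \<in> Fa" for e'
      proof -
        have "Min e' \<in> e'" "Max e' \<in> e'"
          using simple_graph_edgeD(4)[OF G(1) that] by auto
        then show ?thesis
          using that by (auto simp: Fa_def)
      qed
      then show ?thesis
        unfolding a_def by (intro prod.cong) auto
    qed
    have bx: "b (y(?j := t, ?i := s)) = b (y(?j := t, ?i := t))" for s t
    proof -
      have "Min e' \<noteq> ?i \<and> Max e' \<noteq> ?i" if "e' \<in> Fb" for e'
      proof -
        have "Min e' \<in> e'" "Max e' \<in> e'"
          using simple_graph_edgeD(4)[OF G(2) that] by auto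
        then show ?thesis
          using Fb[OF that] by auto
      qed
      then show ?thesis
        unfolding b_def by (intro prod.cong) auto
    qed
    have "(\<integral>z. ?g (y(?j := snd z, ?i := fst z)) \<partial>M2) =
      (\<integral>z. (u z - step_kernel u p z) * (discretize m (a (y(?j := fst z, ?i := fst z))) *
          discretize m (b (y(?j := snd z, ?i := snd z)))) \<partial>M2)"
    proof (rule Bochner_Integration.integral_cong[OF refl])
      fix z
      have "a (y(?j := snd z, ?i := fst z)) = a (y(?j := fst z, ?i := fst z))"
        "b (y(?j := snd z, ?i := fst z)) = b (y(?j := snd z, ?i := snd z))"
        by (rule ax bx)+
      then show "?g (y(?j := snd z, ?i := fst z)) = (u z - step_kernel u p z) * (discretize m (a (y(?j := fst z, ?i := fst z))) *
          discretize m (b (y(?j := snd z, ?i := snd z))))"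
        using ed(3) by (simp only: w_def) simp
    qed
    then show "\<bar>\<integral>z. ?g (y(?j := snd z, ?i := fst z)) \<partial>M2\<bar> \<le> real m * real m * sqrt \<epsilon>"
      using regular_discretized[OF p m moment_bounded_integrable[OF u] reg measurable_compose[OF ym am] measurable_compose[OF ym bm]]
      by simp
  qed (use ed(3) in simp)
  moreover have "\<bar>integral\<^sup>L (cube k) ?f - integral\<^sup>L (cube k) ?g\<bar> \<le> 12 / real m * product_bound ?C (card E)"
  proof -
    have "\<bar>integral\<^sup>L (cube k) ?f - integral\<^sup>L (cube k) ?g\<bar> = \<bar>\<integral>x. ?f x - ?g x \<partial>cube k\<bar>"
      using f(1) gi by simp
    also have "\<dots> \<le> (\<integral>x. \<bar>?f x - ?g x\<bar> \<partial>cube k)"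
      by (rule integral_abs_bound)
    also have "\<dots> \<le> (\<integral>x. 12 / real m * ?h x \<partial>cube k)"
      by (intro integral_mono err integrable_mult_right h(1) integrable_abs Bochner_Integration.integrable_diff f(1) gi)
    also have "\<dots> = 12 / real m * integral\<^sup>L (cube k) ?h"
      by (rule integral_mult_right_zero)
    also have "\<dots> \<le> 12 / real m * product_bound ?C (card E)"
      by (intro mult_left_mono h(2)) simp
    finally show ?thesis .
  qed
  ultimately have "\<bar>integral\<^sup>L (cube k) ?f\<bar> \<le> real m * real m * sqrt \<epsilon> + 12 / real m * product_bound ?C (card E)"
    by linarith
  then show ?thesis
    unfolding f(2) by simp
qed

lemma counting:
  assumes E: "simple_graph k E"
    and u: "\<And>e. e \<in> E \<Longrightarrow> moment_bounded C (u e)" and p: "label_map K p" and m: "0 < m"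
    and reg: "\<And>e. e \<in> E \<Longrightarrow> regular ((2 * m * m + 1)\<^sup>2) \<epsilon> (u e) p"
  shows "\<bar>kernel_density k E u - kernel_density k E (\<lambda>e. step_kernel (u e) p)\<bar> \<le>
     real (card E) * (real m * real m * sqrt \<epsilon> + 12 * product_bound (\<lambda>N. 2 * 4 ^ N * C N) (card E) / real m)"
proof (rule telescoping_bound[where T = "kernel_density k E", OF simple_graph_finite[OF E] kernel_density_cong])
  fix S e assume S: "S \<subseteq> E" "e \<in> E - S"
  let ?v = "\<lambda>e'. if e' \<in> S then u e' else step_kernel (u e') p"
  have e: "e \<in> E"
    and m1: "(\<lambda>e'. if e' \<in> insert e S then u e' else step_kernel (u e') p) = ?v(e := u e)"
    and m2: "?v(e := step_kernel (u e) p) = ?v"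
    using S(2) by auto
  have mb: "moment_bounded C (?v e')" if "e' \<in> E" for e'
    using u[OF that] moment_bounded_step_kernel[OF p] by auto
  have "\<bar>kernel_density k E (?v(e := u e)) - kernel_density k E (?v(e := step_kernel (u e) p))\<bar> \<le>
     real m * real m * sqrt \<epsilon> + 12 * product_bound (\<lambda>N. 2 * 4 ^ N * C N) (card E) / real m"
    by (rule regular_edge_bound[OF E e mb u[OF e] p m reg[OF e]]) auto
  then show "\<bar>kernel_density k E (\<lambda>e'. if e' \<in> insert e S then u e' else step_kernel (u e') p) - kernel_density k E ?v\<bar> \<le>
     real m * real m * sqrt \<epsilon> + 12 * product_bound (\<lambda>N. 2 * 4 ^ N * C N) (card E) / real m"
    by (simp only: m1 m2)
qed

text \<open>Edge by edge, with a weighted square: |d r| \<le> d^2 / \<eta> + \<eta> r^2, where d is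
  the difference on one edge and r the product over the others. The free \<eta> is fixed before
  \<delta> tends to 0.\<close>

lemma kernel_density_L2_bound:
  assumes E: "simple_graph k E"
    and u: "\<And>e. e \<in> E \<Longrightarrow> moment_bounded C (u e)" and v: "\<And>e. e \<in> E \<Longrightarrow> moment_bounded C (v e)"
    and \<delta>: "\<And>e. e \<in> E \<Longrightarrow> (\<integral>z. (u e z - v e z)\<^sup>2 \<partial>M2) \<le> \<delta>" and \<eta>: "0 < \<eta>"
  shows "\<bar>kernel_density k E u - kernel_density k E v\<bar> \<le> real (card E) * (\<delta> / \<eta> + \<eta> * product_bound C (card E))"
proof (rule telescoping_bound[where T = "kernel_density k E", OF simple_graph_finite[OF E] kernel_density_cong])
  fix S e assume S: "S \<subseteq> E" "e \<in> E - S"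
  note fin = simple_graph_finite[OF E]
  let ?m = "\<lambda>e'. if e' \<in> S then u e' else v e'"
  have e: "e \<in> E" and m1: "(\<lambda>e'. if e' \<in> insert e S then u e' else v e') = ?m(e := u e)"
    and m2: "?m = ?m(e := v e)"
    using S(2) by auto
  have mb: "moment_bounded C (?m e')" if "e' \<in> E" for e'
    using u[OF that] v[OF that] by auto
  let ?d = "\<lambda>z. u e z - v e z"
  let ?r = "\<lambda>x. \<Prod>e'\<in>E - {e}. ?m e' (ends e' x)"
  let ?h = "\<lambda>x. \<Prod>e'\<in>E. 1 + (?m e' (ends e' x))\<^sup>2"
  have d2: "integrable M2 (\<lambda>z. (?d z)\<^sup>2)"
    using moment_bounded_integrable_power[OF moment_bounded_diff[OF u[OF e] v[OF e]]] .
  have dm: "(\<lambda>z. (?d z)\<^sup>2) \<in> borel_measurable M2"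
    using d2 by auto
  have h: "integrable (cube k) ?h" "integral\<^sup>L (cube k) ?h \<le> product_bound C (card E)"
    by (rule integrable_prod_one_plus_square[OF E mb] integral_prod_one_plus_square[OF E mb]; assumption)+
  have "kernel_density k E (?m(e := u e)) - kernel_density k E (?m(e := v e)) = kernel_density k E (?m(e := ?d))"
    using mb u v e by (intro kernel_density_diff_edge[OF E]) auto
  also have "\<dots> = (\<integral>x. ?d (ends e x) * ?r x \<partial>cube k)"
    unfolding kernel_density_remove[OF E e]
    by (intro Bochner_Integration.integral_cong) (auto intro!: prod.cong)
  also have "\<bar>\<dots>\<bar> \<le> (\<integral>x. \<bar>?d (ends e x) * ?r x\<bar> \<partial>cube k)"
    by (rule integral_abs_bound)
  also have "\<dots> \<le> (\<integral>x. (?d (ends e x))\<^sup>2 / \<eta> + \<eta> * ?h x \<partial>cube k)"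
  proof (rule integral_mono')
    show "integrable (cube k) (\<lambda>x. (?d (ends e x))\<^sup>2 / \<eta> + \<eta> * ?h x)"
      using h(1) d2 integrable_edge[OF E e dm] by auto
    fix x
    let ?D = "?d (ends e x)"
    have "(?r x)\<^sup>2 \<le> (\<Prod>e'\<in>E - {e}. 1 + (?m e' (ends e' x))\<^sup>2)"
      by (rule square_prod_le_prod_one_plus_square)
    also have "\<dots> \<le> ?h x"
      by (intro prod_mono2 fin) auto
    finally have r: "(?r x)\<^sup>2 \<le> ?h x" .
    have "0 \<le> (\<bar>?D\<bar> - \<eta> * \<bar>?r x\<bar>)\<^sup>2"
      by simp
    also have "\<dots> = ?D\<^sup>2 + \<eta>\<^sup>2 * (?r x)\<^sup>2 - 2 * \<eta> * \<bar>?D * ?r x\<bar>"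
      by (simp add: power2_diff power_mult_distrib abs_mult mult_ac)
    finally have "2 * \<eta> * \<bar>?D * ?r x\<bar> \<le> ?D\<^sup>2 + \<eta>\<^sup>2 * (?r x)\<^sup>2"
      by simp
    moreover have "0 \<le> \<eta> * \<bar>?D * ?r x\<bar>"
      using \<eta> by simp
    ultimately have "\<eta> * \<bar>?D * ?r x\<bar> \<le> ?D\<^sup>2 + \<eta>\<^sup>2 * (?r x)\<^sup>2"
      by linarith
    also have "\<dots> \<le> ?D\<^sup>2 + \<eta>\<^sup>2 * ?h x"
      by (intro add_left_mono mult_left_mono r) simp
    finally show "\<bar>?D * ?r x\<bar> \<le> ?D\<^sup>2 / \<eta> + \<eta> * ?h x"
      using \<eta> by (simp add: field_simps power2_eq_square)
    have "0 \<le> ?h x"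
      by (intro prod_nonneg) auto
    then show "0 \<le> ?D\<^sup>2 / \<eta> + \<eta> * ?h x"
      using \<eta> by simp
  qed
  also have "\<dots> = (\<integral>z. (?d z)\<^sup>2 \<partial>M2) / \<eta> + \<eta> * integral\<^sup>L (cube k) ?h"
    using h(1) d2 integrable_edge[OF E e dm] integral_edge[OF E e dm] by simp
  also have "\<dots> \<le> \<delta> / \<eta> + \<eta> * product_bound C (card E)"
    using \<eta> \<delta>[OF e] h(2) by (intro add_mono mult_left_mono divide_right_mono) auto
  finally show "\<bar>kernel_density k E (\<lambda>e'. if e' \<in> insert e S then u e' else v e') - kernel_density k E ?m\<bar> \<le>
      \<delta> / \<eta> + \<eta> * product_bound C (card E)"
    unfolding m1 using m2 by simp
qed

end

section \<open>Limits of nested step kernels\<close>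

lemma tendsto_zero_squeeze:
  fixes f g :: "nat \<Rightarrow> real"
  assumes "\<And>n. 0 \<le> f n" "\<And>n. f n \<le> g n" "g \<longlonglongrightarrow> 0"
  shows "f \<longlonglongrightarrow> 0"
  by (rule tendsto_sandwich[OF _ _ tendsto_const assms(3)]) (simp_all add: assms)

text \<open>Fatou's lemma. The bound is asked only eventually, because for differences in a
  martingale it holds only for later indices.\<close>

lemma fatou_integral_bound:
  fixes h :: "nat \<Rightarrow> 'a \<Rightarrow> real"
  assumes h: "\<And>i. h i \<in> borel_measurable M" "g \<in> borel_measurable M"
    and pos: "\<And>i x. 0 \<le> h i x" and lim: "AE x in M. (\<lambda>i. h i x) \<longlonglongrightarrow> g x"
    and bound: "eventually (\<lambda>i. integrable M (h i) \<and> integral\<^sup>L M (h i) \<le> c) sequentially"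
    and g: "\<And>x. 0 \<le> g x"
  shows "integrable M g" "integral\<^sup>L M g \<le> c"
proof -
  have "\<exists>i. integrable M (h i) \<and> integral\<^sup>L M (h i) \<le> c"
    using bound eventually_happens by fastforce
  then have c: "0 \<le> c"
    using pos by (meson Bochner_Integration.integral_nonneg order_trans)
  have "(\<integral>\<^sup>+x. ennreal (g x) \<partial>M) = (\<integral>\<^sup>+x. liminf (\<lambda>i. ennreal (h i x)) \<partial>M)"
  proof (rule nn_integral_cong_AE)
    show "AE x in M. ennreal (g x) = liminf (\<lambda>i. ennreal (h i x))"
      using lim
    proof eventually_elim
      case (elim x)
      then have "(\<lambda>i. ennreal (h i x)) \<longlonglongrightarrow> ennreal (g x)"
        by (rule tendsto_ennrealI)
      from lim_imp_Liminf[OF _ this] show ?case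
        by simp
    qed
  qed
  also have "\<dots> \<le> liminf (\<lambda>i. \<integral>\<^sup>+x. ennreal (h i x) \<partial>M)"
    using h by (intro nn_integral_liminf) auto
  also have "\<dots> \<le> liminf (\<lambda>i. ennreal c)"
  proof (rule Liminf_mono)
    show "\<forall>\<^sub>F i in sequentially. (\<integral>\<^sup>+x. ennreal (h i x) \<partial>M) \<le> ennreal c"
      using bound
    proof eventually_elim
      case (elim i)
      then have "(\<integral>\<^sup>+x. ennreal (h i x) \<partial>M) = ennreal (integral\<^sup>L M (h i))"
        using pos by (intro nn_integral_eq_integral) auto
      with elim c show ?case by simp
    qed
  qed
  also have "\<dots> = ennreal c"
    by (simp add: Liminf_const)
  finally have le: "(\<integral>\<^sup>+x. ennreal (g x) \<partial>M) \<le> ennreal c" .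
  then show i: "integrable M g"
    using h g by (intro integrableI_nonneg) (auto simp: less_top[symmetric] top_unique)
  then have "ennreal (integral\<^sup>L M g) \<le> ennreal c"
    using le nn_integral_eq_integral[OF i] g by simp
  then show "integral\<^sup>L M g \<le> c"
    using c by simp
qed

text \<open>Martingale convergence along a subsequence, for countably many sequences at once. The
  energies \<open>e\<close> increase to limits; along \<sigma> the remaining gain drops below
  4^(-j), so consecutive differences have summable L^1 norms and the telescoping series converges
  almost everywhere.\<close>

lemma (in prob_space) L2_countable_limit:
  fixes f :: "nat \<Rightarrow> nat \<Rightarrow> 'a \<Rightarrow> real"
  assumes meas: "\<And>m l. f m l \<in> borel_measurable M"
    and int: "\<And>m m' l. integrable M (\<lambda>x. (f m' l x - f m l x)\<^sup>2)"
    and diff: "\<And>m m' l. m \<le> m' \<Longrightarrow> (\<integral>x. (f m' l x - f m l x)\<^sup>2 \<partial>M) \<le> e m' l - e m l"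
    and bdd: "\<And>m l. e m l \<le> D l"
  obtains \<sigma> g where "strict_mono \<sigma>" "\<And>l. g l \<in> borel_measurable M"
    "AE x in M. \<forall>l. (\<lambda>j. f (\<sigma> j) l x) \<longlonglongrightarrow> g l x"
    "\<And>l. (\<lambda>j. \<integral>x. (f (\<sigma> j) l x - g l x)\<^sup>2 \<partial>M) \<longlonglongrightarrow> 0"
proof -
  have mono: "e m l \<le> e m' l" if "m \<le> m'" for m m' l
  proof -
    have "0 \<le> (\<integral>x. (f m' l x - f m l x)\<^sup>2 \<partial>M)"
      by simp
    also note diff[OF that]
    finally show ?thesis by simp
  qed
  define L where "L l = lim (\<lambda>m. e m l)" for l
  have L: "(\<lambda>m. e m l) \<longlonglongrightarrow> L l" for l
  proof -
    have "incseq (\<lambda>m. e m l)"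
      using mono by (simp add: incseq_def)
    then have "convergent (\<lambda>m. e m l)"
      using incseq_convergent[of "\<lambda>m. e m l" "D l"] bdd by (metis convergentI)
    then show ?thesis
      by (simp add: convergent_LIMSEQ_iff L_def)
  qed
  have le_L: "e m l \<le> L l" for m l
    using mono by (intro incseq_le[OF _ L]) (auto simp: incseq_def)
  \<comment> \<open>A diagonal choice: stage j constrains only the sequences l \<le> j. The base 1/4
    makes the square roots a summable geometric series.\<close>
  have ev: "\<exists>N. \<forall>l\<le>j. L l - e N l < (1/4) ^ j" for j
  proof -
    have "\<forall>\<^sub>F m in sequentially. L l - e m l < (1/4) ^ j" for l
      using order_tendstoD(1)[OF L[of l], of "L l - (1/4) ^ j"] by (auto elim!: eventually_mono)
    then have "\<forall>\<^sub>F m in sequentially. \<forall>l\<in>{..j}. L l - e m l < (1/4) ^ j"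
      by (intro eventually_ball_finite) auto
    then show ?thesis
      by (auto dest!: eventually_happens)
  qed
  have "\<exists>\<sigma>. \<forall>j. (\<forall>l\<le>j. L l - e (\<sigma> j) l < (1/4) ^ j) \<and> \<sigma> j < \<sigma> (Suc j)"
  proof (rule dependent_nat_choice)
    show "\<exists>N. \<forall>l\<le>0. L l - e N l < (1/4) ^ 0"
      by (rule ev)
    fix N j
    obtain N' where N': "\<forall>l\<le>Suc j. L l - e N' l < (1/4) ^ Suc j"
      using ev by blast
    have "L l - e (max N' (Suc N)) l < (1/4) ^ Suc j" if "l \<le> Suc j" for l
      using N' that mono[of N' "max N' (Suc N)" l] by fastforce
    then show "\<exists>N''. (\<forall>l\<le>Suc j. L l - e N'' l < (1/4) ^ Suc j) \<and> N < N''"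
      by (intro exI[of _ "max N' (Suc N)"]) auto
  qed
  then obtain \<sigma> where \<sigma>: "\<And>j l. l \<le> j \<Longrightarrow> L l - e (\<sigma> j) l < (1/4) ^ j" and \<sigma>_less: "\<And>j. \<sigma> j < \<sigma> (Suc j)"
    by blast
  have sm: "strict_mono \<sigma>"
    using \<sigma>_less by (simp add: strict_mono_Suc_iff)
  \<comment> \<open>The shift by l starts the series where the sequence l is already
    controlled.\<close>
  let ?d = "\<lambda>l j x. f (\<sigma> (Suc (j + l))) l x - f (\<sigma> (j + l)) l x"
  define g where "g l x = lim (\<lambda>j. f (\<sigma> j) l x)" for l x
  have AE1: "AE x in M. (\<lambda>j. f (\<sigma> j) l x) \<longlonglongrightarrow> g l x" for l
  proof -
    have d: "(\<integral>\<^sup>+x. ennreal \<bar>?d l j x\<bar> \<partial>M) \<le> ennreal ((1/2) ^ j)" for j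
    proof -
      note a = abs_expectation_le_sqrt[OF borel_measurable_diff[OF meas meas] int, of "\<sigma> (Suc (j + l))" l "\<sigma> (j + l)"]
      have "(\<integral>x. (?d l j x)\<^sup>2 \<partial>M) \<le> e (\<sigma> (Suc (j + l))) l - e (\<sigma> (j + l)) l"
        using sm by (intro diff) (simp add: strict_mono_less_eq)
      also have "\<dots> \<le> L l - e (\<sigma> (j + l)) l"
        by (simp add: le_L)
      also have "\<dots> \<le> (1/4) ^ (j + l)"
        using \<sigma>[of l "j + l"] by simp
      also have "\<dots> \<le> (1/4) ^ j"
        by (intro power_decreasing) auto
      also have "\<dots> = ((1/2) ^ j)\<^sup>2"
        by (simp add: power2_eq_square power_mult_distrib[symmetric])
      finally have "sqrt (\<integral>x. (?d l j x)\<^sup>2 \<partial>M) \<le> (1/2) ^ j"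
        by (intro real_le_lsqrt) auto
      then have "(\<integral>x. \<bar>?d l j x\<bar> \<partial>M) \<le> (1/2) ^ j"
        using a(2) by simp
      moreover have "(\<integral>\<^sup>+x. ennreal \<bar>?d l j x\<bar> \<partial>M) = ennreal (\<integral>x. \<bar>?d l j x\<bar> \<partial>M)"
        using a(1) by (intro nn_integral_eq_integral) auto
      ultimately show ?thesis
        by (simp add: ennreal_leI)
    qed
    have "(\<integral>\<^sup>+x. (\<Sum>j. ennreal \<bar>?d l j x\<bar>) \<partial>M) = (\<Sum>j. \<integral>\<^sup>+x. ennreal \<bar>?d l j x\<bar> \<partial>M)"
      using meas by (intro nn_integral_suminf) auto
    also have "\<dots> \<le> (\<Sum>j. ennreal ((1/2) ^ j))"
      by (intro suminf_le d) auto
    also have "\<dots> = ennreal (\<Sum>j. (1/2) ^ j)"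
      by (intro suminf_ennreal2) (auto intro: summable_geometric)
    finally have fin: "(\<integral>\<^sup>+x. (\<Sum>j. ennreal \<bar>?d l j x\<bar>) \<partial>M) \<noteq> \<infinity>"
      by (auto simp: top_unique)
    have "AE x in M. (\<Sum>j. ennreal \<bar>?d l j x\<bar>) \<noteq> \<infinity>"
      using meas by (intro nn_integral_PInf_AE[OF _ fin]) auto
    then show ?thesis
    proof eventually_elim
      case (elim x)
      then have "summable (\<lambda>j. \<bar>?d l j x\<bar>)"
        by (intro summable_suminf_not_top) auto
      then have "summable (\<lambda>j. ?d l j x)"
        by (rule summable_rabs_cancel)
      then have "convergent (\<lambda>n. \<Sum>j<n. ?d l j x)"
        by (simp add: summable_iff_convergent)
      then have "convergent (\<lambda>n. f (\<sigma> (n + l)) l x - f (\<sigma> l) l x)"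
        using sum_lessThan_telescope[of "\<lambda>j. f (\<sigma> (j + l)) l x"] by simp
      then have "convergent (\<lambda>n. f (\<sigma> (n + l)) l x)"
        using convergent_diff_const_right_iff by blast
      then have "convergent (\<lambda>n. f (\<sigma> n) l x)"
        using convergent_ignore_initial_segment[of "\<lambda>n. f (\<sigma> n) l x" l] by simp
      then show ?case
        by (simp add: convergent_LIMSEQ_iff g_def)
    qed
  qed
  have gm: "g l \<in> borel_measurable M" for l
    unfolding g_def[abs_def] using meas by (intro borel_measurable_lim_metric) auto
  \<comment> \<open>Fatou in the later index i, with j fixed.\<close>
  have L2: "(\<integral>x. (f (\<sigma> j) l x - g l x)\<^sup>2 \<partial>M) \<le> L l - e (\<sigma> j) l" for j l
  proof (rule fatou_integral_bound(2)[where h = "\<lambda>i x. (f (\<sigma> j) l x - f (\<sigma> i) l x)\<^sup>2"])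
    show "AE x in M. (\<lambda>i. (f (\<sigma> j) l x - f (\<sigma> i) l x)\<^sup>2) \<longlonglongrightarrow> (f (\<sigma> j) l x - g l x)\<^sup>2"
      using AE1[of l] by eventually_elim (auto intro!: tendsto_intros)
    show "\<forall>\<^sub>F i in sequentially. integrable M (\<lambda>x. (f (\<sigma> j) l x - f (\<sigma> i) l x)\<^sup>2) \<and>
        (\<integral>x. (f (\<sigma> j) l x - f (\<sigma> i) l x)\<^sup>2 \<partial>M) \<le> L l - e (\<sigma> j) l"
      using eventually_ge_at_top[of j]
    proof eventually_elim
      case (elim i)
      have "(\<integral>x. (f (\<sigma> j) l x - f (\<sigma> i) l x)\<^sup>2 \<partial>M) = (\<integral>x. (f (\<sigma> i) l x - f (\<sigma> j) l x)\<^sup>2 \<partial>M)"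
        by (simp add: power2_commute)
      also have "\<dots> \<le> e (\<sigma> i) l - e (\<sigma> j) l"
        using sm elim by (intro diff) (simp add: strict_mono_less_eq)
      also have "\<dots> \<le> L l - e (\<sigma> j) l"
        by (simp add: le_L)
      finally show ?case
        using int by simp
    qed
  qed (use meas gm in auto)
  have "(\<lambda>j. L l - e (\<sigma> j) l) \<longlonglongrightarrow> L l - L l" for l
    using LIMSEQ_subseq_LIMSEQ[OF L sm, of l] by (intro tendsto_intros) (simp add: comp_def)
  then have Le: "(\<lambda>j. L l - e (\<sigma> j) l) \<longlonglongrightarrow> 0" for l
    by simp
  have L2_lim: "(\<lambda>j. \<integral>x. (f (\<sigma> j) l x - g l x)\<^sup>2 \<partial>M) \<longlonglongrightarrow> 0" for l
  proof (rule tendsto_zero_squeeze)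
    show "0 \<le> (\<integral>x. (f (\<sigma> j) l x - g l x)\<^sup>2 \<partial>M)" for j
      by simp
    show "(\<integral>x. (f (\<sigma> j) l x - g l x)\<^sup>2 \<partial>M) \<le> L l - e (\<sigma> j) l" for j
      by (rule L2)
  qed (rule Le)
  have AE2: "AE x in M. \<forall>l. (\<lambda>j. f (\<sigma> j) l x) \<longlonglongrightarrow> g l x"
    using AE1 by (simp add: AE_all_countable)
  show ?thesis
    by (rule that[OF sm gm AE2 L2_lim])
qed

section \<open>Interval models of nested partitions\<close>

lemma sum_lessThan_nat_blocks:
  fixes f :: "nat \<Rightarrow> real"
  shows "(\<Sum>i<n * r. f i) = (\<Sum>i<n. \<Sum>t<r. f (i * r + t))"
proof -
  have "(\<Sum>i<a + r. f i) = (\<Sum>i<a. f i) + (\<Sum>t<r. f (a + t))" for a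
    by (induction r) (auto simp: add.assoc)
  from this[of "_ * r"] show ?thesis
    by (induction n) (auto simp: add.commute)
qed

text \<open>Lay the cells of level m side by side in the order of their labels; \<open>A m i\<close>
  is the left end of cell i. Children of cell i carry the consecutive labels
  \<open>i * R m + t\<close>, so they fill exactly the interval of their parent. Half-open intervals
  containing a point have positive length, so no null cell meets [0,1).\<close>

lemma interval_labels:
  fixes \<alpha> :: "nat \<Rightarrow> nat \<Rightarrow> real"
  assumes R: "\<And>m. 0 < R m" and K: "\<And>m. K (Suc m) = K m * R m"
    and \<alpha>: "\<And>m i. 0 \<le> \<alpha> m i" "\<And>m. (\<Sum>i<K m. \<alpha> m i) = 1"
    and split: "\<And>m i. i < K m \<Longrightarrow> \<alpha> m i = (\<Sum>t<R m. \<alpha> (Suc m) (i * R m + t))"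
  obtains q :: "nat \<Rightarrow> real \<Rightarrow> nat" where
    "\<And>m x. q m x < K m" "\<And>m. q m \<in> measurable borel (count_space UNIV)"
    "\<And>m i. i < K m \<Longrightarrow> emeasure lborel {x \<in> {0..1}. q m x = i} = ennreal (\<alpha> m i)"
    "\<And>m x. q m x = q (Suc m) x div R m"
    "\<And>m x. 0 \<le> x \<Longrightarrow> x < 1 \<Longrightarrow> 0 < \<alpha> m (q m x)"
proof -
  define A where "A m i = (\<Sum>i'<i. \<alpha> m i')" for m i
  have A0: "A m 0 = 0" and AK: "A m (K m) = 1" and AS: "A m (Suc i) = A m i + \<alpha> m i" for m i
    by (simp_all add: A_def \<alpha>)
  have mono: "A m i \<le> A m j" if "i \<le> j" for m i j
    using that \<alpha>(1) by (auto simp: A_def intro!: sum_mono2)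
  have K0: "0 < K m" for m
    using AK[of m] A0[of m] by (cases "K m") auto
  have Adiv: "A m i = A (Suc m) (i * R m)" if "i \<le> K m" for m i
    using that split by (auto simp: A_def sum_lessThan_nat_blocks intro!: sum.cong)
  \<comment> \<open>The label 0 at 1 and outside the interval is arbitrary, but stays compatible
    with division by \<open>R m\<close>.\<close>
  define q where "q m x = (if 0 \<le> x \<and> x < 1 then LEAST i. x < A m (Suc i) else 0)" for m x
  have q_iff: "q m x = i \<longleftrightarrow> A m i \<le> x \<and> x < A m (Suc i)" if x: "0 \<le> x" "x < 1" for m x i
  proof -
    have ex: "x < A m (Suc (K m - 1))"
      using x K0[of m] AK[of m] by simp
    have q: "q m x = (LEAST i. x < A m (Suc i))"
      using x by (simp add: q_def)
    have upper: "x < A m (Suc (q m x))"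
      unfolding q by (rule LeastI[of "\<lambda>i. x < A m (Suc i)", OF ex])
    have lower: "A m (q m x) \<le> x"
    proof (cases "q m x")
      case (Suc i)
      then have "\<not> x < A m (Suc i)"
        using not_less_Least[of i "\<lambda>i. x < A m (Suc i)"] q by simp
      then show ?thesis using Suc by simp
    qed (use x A0 in simp)
    show ?thesis
    proof
      assume r: "A m i \<le> x \<and> x < A m (Suc i)"
      have "\<not> q m x < i" "\<not> i < q m x"
        using mono[of "Suc (q m x)" i m] mono[of "Suc i" "q m x" m] upper lower r by force+
      then show "q m x = i" by simp
    qed (use upper lower in auto)
  qed
  have q_less: "q m x < K m" for m x
  proof (cases "0 \<le> x \<and> x < 1")
    case True
    then have "A m (q m x) \<le> x"
      using q_iff by blast
    then have "\<not> K m \<le> q m x"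
      using True mono[of "K m" "q m x" m] AK[of m] by auto
    then show ?thesis by simp
  qed (use K0 in \<open>auto simp: q_def\<close>)
  have q_meas: "q m \<in> measurable borel (count_space UNIV)" for m
    unfolding q_def[abs_def] by measurable
  have q_mass: "emeasure lborel {x \<in> {0..1}. q m x = i} = ennreal (\<alpha> m i)" if i: "i < K m" for m i
  proof -
    have b: "0 \<le> A m i" "A m (Suc i) \<le> 1"
      using mono[of 0 i m] mono[of "Suc i" "K m" m] i A0 AK by auto
    have s: "{x \<in> {0..1}. q m x = i} \<in> sets lborel"
      using measurable_sets[OF q_meas, of "{i}" m] by (simp add: vimage_def Collect_conj_eq sets.Int)
    have "emeasure lborel {x \<in> {0..1}. q m x = i} = emeasure lborel {A m i..<A m (Suc i)}"
    proof (rule emeasure_eq_AE)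
      show "AE x in lborel. x \<in> {x \<in> {0..1}. q m x = i} \<longleftrightarrow> x \<in> {A m i..<A m (Suc i)}"
        using AE_lborel_singleton[of 1]
      proof eventually_elim
        case (elim x)
        then show ?case
          using q_iff[of x m i] b by (cases "0 \<le> x \<and> x < 1") auto
      qed
    qed (use s in auto)
    also have "\<dots> = ennreal (\<alpha> m i)"
      using mono[of i "Suc i" m] by (simp add: AS)
    finally show ?thesis .
  qed
  have q_div: "q m x = q (Suc m) x div R m" for m x
  proof (cases "0 \<le> x \<and> x < 1")
    case True
    let ?j = "q (Suc m) x" and ?i = "q (Suc m) x div R m"
    have j: "A (Suc m) ?j \<le> x" "x < A (Suc m) (Suc ?j)"
      using q_iff[of x "Suc m" ?j] True by auto
    have i: "?i < K m"
      using q_less[of "Suc m" x] K R by (simp add: less_mult_imp_div_less)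
    have "?i * R m \<le> ?j" "Suc ?j \<le> Suc ?i * R m"
      using R[of m] dividend_less_times_div[of "R m" ?j] by (auto simp: div_times_less_eq_dividend mult.commute)
    then have "A (Suc m) (?i * R m) \<le> A (Suc m) ?j" "A (Suc m) (Suc ?j) \<le> A (Suc m) (Suc ?i * R m)"
      by (auto intro: mono)
    then have "A m ?i \<le> x" "x < A m (Suc ?i)"
      using j Adiv[of ?i m] Adiv[of "Suc ?i" m] i by auto
    then show ?thesis
      using q_iff[of x m ?i] True by auto
  qed (auto simp: q_def)
  have q_pos: "0 < \<alpha> m (q m x)" if "0 \<le> x" "x < 1" for m x
    using q_iff[OF that, of m "q m x"] AS[of m "q m x"] by simp
  show ?thesis
    by (rule that[of q, OF q_less q_meas q_mass q_div q_pos])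
qed

section \<open>Densities of step kernels as finite sums\<close>

text \<open>The homomorphism density into a finite weighted graph with vertex weights \<alpha> and,
  for each edge \<open>e\<close>, its own edge weights \<open>b e\<close>.\<close>

definition label_sum :: "nat \<Rightarrow> nat set set \<Rightarrow> nat \<Rightarrow> (nat \<Rightarrow> real) \<Rightarrow> (nat set \<Rightarrow> nat \<Rightarrow> nat \<Rightarrow> real) \<Rightarrow> real" where
  "label_sum k E K \<alpha> b = (\<Sum>\<phi>\<in>{1..k} \<rightarrow>\<^sub>E {..<K}. (\<Prod>e\<in>E. b e (\<phi> (Min e)) (\<phi> (Max e))) * (\<Prod>i\<in>{1..k}. \<alpha> (\<phi> i)))"

text \<open>
  Block averages over cells whose mass tends to \<open>0\<close> need not converge; the second-moment bound makes
  their contribution vanish.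
\<close>

lemma label_sum_tendsto:
  assumes E: "simple_graph k E"
    and \<alpha>: "\<And>i. i < K \<Longrightarrow> (\<lambda>n. \<alpha> n i) \<longlonglongrightarrow> \<alpha>' i" "\<And>n i. 0 \<le> \<alpha> n i"
    and b: "\<And>e i j. e \<in> E \<Longrightarrow> i < K \<Longrightarrow> j < K \<Longrightarrow> 0 < \<alpha>' i \<Longrightarrow> 0 < \<alpha>' j \<Longrightarrow> (\<lambda>n. b n e i j) \<longlonglongrightarrow> b' e i j"
    and bound: "\<And>n. label_sum k E K (\<alpha> n) (\<lambda>e i j. (b n e i j)\<^sup>2) \<le> B"
  shows "(\<lambda>n. label_sum k E K (\<alpha> n) (b n)) \<longlonglongrightarrow> label_sum k E K \<alpha>' b'"
  unfolding label_sum_def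
proof (rule tendsto_sum)
  fix \<phi> assume \<phi>: "\<phi> \<in> {1..k} \<rightarrow>\<^sub>E {..<K}"
  let ?g = "\<lambda>n. \<Prod>e\<in>E. b n e (\<phi> (Min e)) (\<phi> (Max e))"
  let ?a = "\<lambda>n. \<Prod>i\<in>{1..k}. \<alpha> n (\<phi> i)" and ?a' = "\<Prod>i\<in>{1..k}. \<alpha>' (\<phi> i)"
  have \<phi>_less: "\<phi> i < K" if "i \<in> {1..k}" for i
    using \<phi> that by (auto simp: PiE_iff)
  have a: "?a \<longlonglongrightarrow> ?a'"
    using \<phi>_less by (intro tendsto_prod \<alpha>) auto
  have a_nonneg: "0 \<le> ?a n" for n
    by (intro prod_nonneg \<alpha>(2))
  have a'_nonneg: "0 \<le> \<alpha>' i" if "i < K" for i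
    using LIMSEQ_le_const[OF \<alpha>(1)[OF that]] \<alpha>(2) by auto
  show "(\<lambda>n. ?g n * ?a n) \<longlonglongrightarrow> (\<Prod>e\<in>E. b' e (\<phi> (Min e)) (\<phi> (Max e))) * ?a'"
  proof (cases "?a' = 0")
    case False
    have pos: "0 < \<alpha>' (\<phi> i)" if "i \<in> {1..k}" for i
      using False a'_nonneg[OF \<phi>_less[OF that]] that by (auto simp: less_le)
    have "?g \<longlonglongrightarrow> (\<Prod>e\<in>E. b' e (\<phi> (Min e)) (\<phi> (Max e)))"
      using simple_graph_edgeD(1,2)[OF E] by (intro tendsto_prod b pos \<phi>_less) auto
    then show ?thesis
      by (intro tendsto_mult a)
  next
    case True
    \<comment> \<open>The averages \<open>?g n\<close> may blow up while \<open>?a n\<close> tends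
      to 0. But \<open>(?g n)\<^sup>2 * ?a n\<close> is one summand of the bounded second-moment
      sum, and the other factor \<open>?a n\<close> still tends to 0.\<close>
    have "(?g n * ?a n)\<^sup>2 \<le> B * ?a n" for n
    proof -
      have "(?g n)\<^sup>2 * ?a n \<le> label_sum k E K (\<alpha> n) (\<lambda>e i j. (b n e i j)\<^sup>2)"
        unfolding label_sum_def prod_power_distrib
        by (rule member_le_sum[OF \<phi>, where f = "\<lambda>\<phi>. (\<Prod>e\<in>E. (b n e (\<phi> (Min e)) (\<phi> (Max e)))\<^sup>2) * (\<Prod>i\<in>{1..k}. \<alpha> n (\<phi> i))"])
          (auto intro!: mult_nonneg_nonneg prod_nonneg \<alpha>(2) finite_PiE)
      also have "\<dots> \<le> B"
        by (rule bound)
      finally have "((?g n)\<^sup>2 * ?a n) * ?a n \<le> B * ?a n"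
        by (intro mult_right_mono a_nonneg)
      then show ?thesis
        by (simp add: power_mult_distrib power2_eq_square mult_ac)
    qed
    moreover have "(\<lambda>n. B * ?a n) \<longlonglongrightarrow> 0"
      using tendsto_mult[OF tendsto_const[of B] a] unfolding True mult_zero_right .
    ultimately have "(\<lambda>n. (?g n * ?a n)\<^sup>2) \<longlonglongrightarrow> 0"
      by (rule tendsto_zero_squeeze[OF zero_le_power2])
    then have "(\<lambda>n. sqrt ((?g n * ?a n)\<^sup>2)) \<longlonglongrightarrow> sqrt 0"
      by (rule tendsto_real_sqrt)
    then have "(\<lambda>n. ?g n * ?a n) \<longlonglongrightarrow> 0"
      unfolding real_sqrt_abs real_sqrt_zero by (rule tendsto_rabs_zero_cancel)
    then show ?thesis
      unfolding True mult_zero_right .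
  qed
qed

text \<open>The summands are nonnegative, so cells whose mass tends to 0, where \<open>h\<close>
  need not converge, are dropped before the limit is taken. In the limit sum these cells have weight
  0.\<close>

lemma block_sum_le_limit:
  fixes h :: "nat \<Rightarrow> nat \<Rightarrow> nat \<Rightarrow> real"
  assumes \<alpha>: "\<And>i. i < K \<Longrightarrow> (\<lambda>n. \<alpha> n i) \<longlonglongrightarrow> \<alpha>' i" "\<And>n i. 0 \<le> \<alpha> n i"
    and h: "\<And>i j. i < K \<Longrightarrow> j < K \<Longrightarrow> 0 < \<alpha>' i \<Longrightarrow> 0 < \<alpha>' j \<Longrightarrow> (\<lambda>n. h n i j) \<longlonglongrightarrow> h' i j"
      "\<And>n i j. 0 \<le> h n i j"
    and le: "\<And>n. (\<Sum>i<K. \<Sum>j<K. h n i j * (\<alpha> n i * \<alpha> n j)) \<le> c n" and c: "c \<longlonglongrightarrow> c'"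
  shows "(\<Sum>i<K. \<Sum>j<K. h' i j * (\<alpha>' i * \<alpha>' j)) \<le> c'"
proof -
  have a'_nonneg: "0 \<le> \<alpha>' i" if "i < K" for i
    using LIMSEQ_le_const[OF \<alpha>(1)[OF that]] \<alpha>(2) by auto
  define ind where "ind i j = (of_bool (0 < \<alpha>' i \<and> 0 < \<alpha>' j) :: real)" for i j
  have "(\<lambda>n. \<Sum>i<K. \<Sum>j<K. ind i j * (h n i j * (\<alpha> n i * \<alpha> n j))) \<longlonglongrightarrow> (\<Sum>i<K. \<Sum>j<K. ind i j * (h' i j * (\<alpha>' i * \<alpha>' j)))"
  proof (intro tendsto_sum)
    fix i j assume "i \<in> {..<K}" "j \<in> {..<K}"
    then show "(\<lambda>n. ind i j * (h n i j * (\<alpha> n i * \<alpha> n j))) \<longlonglongrightarrow> ind i j * (h' i j * (\<alpha>' i * \<alpha>' j))"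
      by (cases "0 < \<alpha>' i \<and> 0 < \<alpha>' j") (auto simp: ind_def intro!: tendsto_mult h \<alpha>)
  qed
  moreover have "(\<Sum>i<K. \<Sum>j<K. ind i j * (h n i j * (\<alpha> n i * \<alpha> n j))) \<le> c n" for n
  proof -
    have "(\<Sum>i<K. \<Sum>j<K. ind i j * (h n i j * (\<alpha> n i * \<alpha> n j))) \<le> (\<Sum>i<K. \<Sum>j<K. h n i j * (\<alpha> n i * \<alpha> n j))"
      by (intro sum_mono) (auto simp: ind_def h \<alpha>)
    with le[of n] show ?thesis by simp
  qed
  ultimately have "(\<Sum>i<K. \<Sum>j<K. ind i j * (h' i j * (\<alpha>' i * \<alpha>' j))) \<le> c'"
    using c by (intro LIMSEQ_le) auto
  also have "(\<Sum>i<K. \<Sum>j<K. ind i j * (h' i j * (\<alpha>' i * \<alpha>' j))) = (\<Sum>i<K. \<Sum>j<K. h' i j * (\<alpha>' i * \<alpha>' j))"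
    using a'_nonneg by (intro sum.cong refl) (force simp: ind_def less_le)
  finally show ?thesis .
qed

context prob_space
begin

lemma sum_cell_mass:
  assumes "label_map K p"
  shows "(\<Sum>i<K. cell_mass p i) = 1"
proof -
  have "(\<Sum>i<K. cell_mass p i) = measure M (\<Union>i<K. {x \<in> space M. p x = i})"
    unfolding cell_mass_def using label_cell_sets[OF assms]
    by (intro finite_measure_finite_Union[symmetric]) (auto simp: disjoint_family_on_def)
  also have "(\<Union>i<K. {x \<in> space M. p x = i}) = space M"
    using label_mapD(2)[OF assms] by auto
  finally show ?thesis
    by (simp add: prob_space)
qed

lemma cell_mass_coarsen:
  assumes p: "label_map K p" and q: "label_map (K * R) q" and div: "\<And>x. p x = q x div R"
  shows "cell_mass p i = (\<Sum>t<R. cell_mass q (i * R + t))"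
proof -
  have "(\<Sum>t<R. cell_mass q (i * R + t)) = measure M (\<Union>t<R. {x \<in> space M. q x = i * R + t})"
    unfolding cell_mass_def using label_cell_sets[OF q]
    by (intro finite_measure_finite_Union[symmetric]) (auto simp: disjoint_family_on_def)
  also have "(\<Union>t<R. {x \<in> space M. q x = i * R + t}) = {x \<in> space M. p x = i}"
  proof -
    have "0 < R"
      using label_mapD(2)[OF q, of undefined] by (cases R) auto
    have "p x = i \<longleftrightarrow> (\<exists>t<R. q x = i * R + t)" for x
    proof
      assume "p x = i"
      then have "q x = i * R + q x mod R"
        unfolding div by (metis div_mult_mod_eq)
      then show "\<exists>t<R. q x = i * R + t"
        using \<open>0 < R\<close> by (intro exI[of _ "q x mod R"]) simp
    next
      assume "\<exists>t<R. q x = i * R + t"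
      then show "p x = i"
        unfolding div by auto
    qed
    then show ?thesis by auto
  qed
  finally show ?thesis
    by (simp add: cell_mass_def)
qed

text \<open>Split the cube according to the tuple of labels; on each piece the integrand is
  constant, and by independence the piece has the product of the cell masses as its measure.\<close>

lemma kernel_density_labels:
  fixes b :: "nat set \<Rightarrow> nat \<Rightarrow> nat \<Rightarrow> real"
  assumes E: "simple_graph k E" and p: "label_map K p"
  shows "kernel_density k E (\<lambda>e z. b e (p (fst z)) (p (snd z))) = label_sum k E K (cell_mass p) b"
proof -
  interpret P: product_prob_space "\<lambda>_. M" "{1..k}" ..
  let ?g = "\<lambda>\<phi>. \<Prod>e\<in>E. b e (\<phi> (Min e)) (\<phi> (Max e))"
  let ?\<Phi> = "{1..k} \<rightarrow>\<^sub>E {..<K}"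
  let ?c = "\<lambda>\<phi> x. \<Prod>i\<in>{1..k}. (of_bool (p (x i) = \<phi> i) :: real)"
  have fin: "finite ?\<Phi>"
    by (intro finite_PiE) auto
  have "?g (\<lambda>i. p (x i)) = (\<Sum>\<phi>\<in>?\<Phi>. ?g \<phi> * ?c \<phi> x)" for x
  proof -
    define \<psi> where "\<psi> = restrict (\<lambda>i. p (x i)) {1..k}"
    have \<psi>: "\<psi> \<in> ?\<Phi>"
      using label_mapD(2)[OF p] by (auto simp: \<psi>_def)
    have c: "?c \<phi> x = of_bool (\<phi> = \<psi>)" if "\<phi> \<in> ?\<Phi>" for \<phi>
    proof (cases "\<phi> = \<psi>")
      case False
      then obtain i where "\<phi> i \<noteq> \<psi> i" by auto
      then have "i \<in> {1..k}" "p (x i) \<noteq> \<phi> i"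
        using that by (auto simp: \<psi>_def PiE_iff extensional_def split: if_splits)
      then have "?c \<phi> x = 0"
        by (intro prod_zero) auto
      with False show ?thesis by simp
    qed (auto simp: \<psi>_def)
    have "(\<Sum>\<phi>\<in>?\<Phi>. ?g \<phi> * ?c \<phi> x) = (\<Sum>\<phi>\<in>?\<Phi>. if \<phi> = \<psi> then ?g \<phi> else 0)"
      by (intro sum.cong) (auto simp: c)
    also have "\<dots> = ?g \<psi>"
      using fin \<psi> by simp
    also have "\<dots> = ?g (\<lambda>i. p (x i))"
      using simple_graph_edgeD(1,2)[OF E] by (intro prod.cong) (auto simp: \<psi>_def)
    finally show ?thesis ..
  qed
  then have "kernel_density k E (\<lambda>e z. b e (p (fst z)) (p (snd z))) = (\<integral>x. (\<Sum>\<phi>\<in>?\<Phi>. ?g \<phi> * ?c \<phi> x) \<partial>cube k)"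
    by (simp add: kernel_density_def)
  have m: "(\<lambda>y. of_bool (p y = i) :: real) \<in> borel_measurable M" for i
    using measurable_compose[OF label_mapD(1)[OF p], of "\<lambda>j. of_bool (j = i) :: real" borel] by simp
  have i1: "integrable M (\<lambda>y. of_bool (p y = i) :: real)" for i
    by (rule integrable_const_bound[of _ 1]) (auto simp: m)
  have i2: "(\<integral>y. of_bool (p y = i) \<partial>M) = cell_mass p i" for i
  proof -
    have "(\<integral>y. of_bool (p y = i) \<partial>M) = (\<integral>y. indicator {x \<in> space M. p x = i} y \<partial>M)"
      by (intro Bochner_Integration.integral_cong) (auto simp: indicator_def)
    also have "\<dots> = cell_mass p i"
      using label_cell_sets[OF p, of i] by (simp add: cell_mass_def Int_absorb2 sets.sets_into_space)
    finally show ?thesis .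
  qed
  have int: "integrable (cube k) (?c \<phi>)" "integral\<^sup>L (cube k) (?c \<phi>) = (\<Prod>i\<in>{1..k}. cell_mass p (\<phi> i))" for \<phi>
    using P.product_integrable_prod[of "{1..k}" "\<lambda>i y. of_bool (p y = \<phi> i) :: real"]
      P.product_integral_prod[of "{1..k}" "\<lambda>i y. of_bool (p y = \<phi> i) :: real"] i1 i2 by simp_all
  show ?thesis
    unfolding \<open>kernel_density k E _ = _\<close> label_sum_def
    using int by (simp add: Bochner_Integration.integral_sum)
qed

lemma kernel_density_square_le:
  assumes E: "simple_graph k E" and mb: "\<And>e. e \<in> E \<Longrightarrow> moment_bounded C (v e)"
  shows "kernel_density k E (\<lambda>e z. (v e z)\<^sup>2) \<le> product_bound C (card E)"
proof -
  have "kernel_density k E (\<lambda>e z. (v e z)\<^sup>2) \<le> (\<integral>x. (\<Prod>e\<in>E. 1 + (v e (ends e x))\<^sup>2) \<partial>cube k)"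
    unfolding kernel_density_def
    by (rule integral_mono'[OF integrable_prod_one_plus_square[OF E mb]]) (auto intro!: prod_mono prod_nonneg)
  also have "\<dots> \<le> product_bound C (card E)"
    by (rule integral_prod_one_plus_square[OF E mb])
  finally show ?thesis .
qed

end

section \<open>Sequences of countable families of kernels\<close>

text \<open>\<open>n\<close> is the index of the sequence and \<open>l\<close> numbers the kernels
  that share the partitions for this \<open>n\<close>. The bounds depend on \<open>l\<close>
  alone.\<close>

locale kernel_sequence = prob_space +
  fixes u :: "nat \<Rightarrow> nat \<Rightarrow> 'a \<times> 'a \<Rightarrow> real" and C :: "nat \<Rightarrow> nat \<Rightarrow> real"
  assumes moment_bounded_u: "\<And>n l. moment_bounded (C l) (u n l)"
begin

lemma common_moment_bound:
  fixes lab :: "nat set \<Rightarrow> nat"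
  assumes "finite E"
  obtains D where "\<And>e. e \<in> E \<Longrightarrow> (\<And>N. C (lab e) N \<le> D N)"
proof (rule that[of "\<lambda>N. \<Sum>e\<in>E. C (lab e) N"])
  fix e N assume "e \<in> E"
  then show "C (lab e) N \<le> (\<Sum>e\<in>E. C (lab e) N)"
    using moment_bounded_nonneg[OF moment_bounded_u] assms
    by (intro member_le_sum[of e E "\<lambda>e. C (lab e) N"]) auto
qed

text \<open>\<open>R\<close> and \<open>K\<close> do not depend on n. Level m + 1 is regular for the
  kernels l \<le> m only, so that finitely many energies are summed. The sixth power makes (m+1)^2 *
  sqrt \<epsilon> = 1 / (m+1), matching the discretization error.\<close>

lemma regular_partitions:
  obtains R :: "nat \<Rightarrow> nat" and K :: "nat \<Rightarrow> nat" and p :: "nat \<Rightarrow> nat \<Rightarrow> 'a \<Rightarrow> nat" where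
    "\<And>m. 0 < R m" "\<And>m. K (Suc m) = K m * R m" "\<And>n m. label_map (K m) (p n m)"
    "\<And>n m x. p n m x = p n (Suc m) x div R m"
    "\<And>n m l. l \<le> m \<Longrightarrow> regular ((2 * Suc m * Suc m + 1)\<^sup>2) ((1 / real (Suc m)) ^ 6) (u n l) (p n (Suc m))"
proof -
  define r where "r m = (2 * Suc m * Suc m + 1)\<^sup>2" for m
  define \<epsilon> where "\<epsilon> m = (1 / real (Suc m)) ^ 6" for m
  define D where "D m = (\<Sum>l\<le>m. C l 1)" for m
  have \<epsilon>: "0 < \<epsilon> m" for m by (simp add: \<epsilon>_def)
  \<comment> \<open>With this many increments the start condition of
    \<open>regular_refinement\<close> holds for every partition, because energies are
    nonnegative.\<close>
  have "\<exists>T. D m - real T * \<epsilon> m < 0" for m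
    using reals_Archimedean3[OF \<epsilon>[of m]] by (auto simp: algebra_simps)
  then obtain T where T: "\<And>m. D m - real (T m) * \<epsilon> m < 0"
    by metis
  define R where "R m = r m ^ T m" for m
  define K where "K m = (\<Prod>i<m. R i)" for m
  have R: "0 < R m" for m by (simp add: R_def r_def)
  have step: "\<exists>c. label_map (R m) c \<and> (\<forall>l\<in>{..m}. regular (r m) (\<epsilon> m) (u n l) (refine (R m) q c))"
    if q: "label_map (K m) q" for n m q
    unfolding R_def
  proof (rule regular_refinement[where D = "D m", OF _ _ _ _ \<epsilon> q])
    show "(\<Sum>l\<in>{..m}. energy (u n l) q') \<le> D m" if "label_map K' q'" for K' q'
      unfolding D_def by (intro sum_mono energy_le[OF that] moment_bounded_u)
    have "0 \<le> (\<Sum>l\<in>{..m}. energy (u n l) q)"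
      by (intro sum_nonneg energy_nonneg)
    then show "D m - real (T m) * \<epsilon> m < (\<Sum>l\<in>{..m}. energy (u n l) q)"
      using T[of m] by linarith
  qed (auto simp: r_def intro: moment_bounded_integrable[OF moment_bounded_u])
  have "\<exists>p. \<forall>m. label_map (K m) (p m) \<and> ((\<forall>x. p m x = p (Suc m) x div R m) \<and>
      (\<forall>l\<le>m. regular (r m) (\<epsilon> m) (u n l) (p (Suc m))))" for n
  proof (rule dependent_nat_choice)
    show "\<exists>p. label_map (K 0) p"
      by (intro exI[of _ "\<lambda>_. 0"]) (simp add: K_def label_map_def)
    fix q m assume q: "label_map (K m) q"
    obtain c where c: "label_map (R m) c" "\<forall>l\<in>{..m}. regular (r m) (\<epsilon> m) (u n l) (refine (R m) q c)"
      using step[OF q] by blast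
    then show "\<exists>q'. label_map (K (Suc m)) q' \<and> (\<forall>x. q x = q' x div R m) \<and>
        (\<forall>l\<le>m. regular (r m) (\<epsilon> m) (u n l) q')"
      using label_map_refine[OF q c(1)] refine_div[OF c(1)] by (intro exI[of _ "refine (R m) q c"]) (auto simp: K_def mult.commute)
  qed
  then obtain p where p: "\<And>n m. label_map (K m) (p n m)" "\<And>n m x. p n m x = p n (Suc m) x div R m"
    "\<And>n m l. l \<le> m \<Longrightarrow> regular (r m) (\<epsilon> m) (u n l) (p n (Suc m))"
    by metis
  show ?thesis
    by (rule that[of R K p, OF R _ p(1,2) p(3)[unfolded r_def \<epsilon>_def]]) (simp_all add: K_def mult.commute)
qed

text \<open>\<open>m0\<close> depends on the graph, the labelling and \<epsilon>, but not on n. This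
  is what permits the exchange of the two limits.\<close>

lemma uniform_counting:
  assumes p: "\<And>n m. label_map (K m) (p n m)"
    and reg: "\<And>n m l. l \<le> m \<Longrightarrow> regular ((2 * Suc m * Suc m + 1)\<^sup>2) ((1 / real (Suc m)) ^ 6) (u n l) (p n (Suc m))"
    and E: "simple_graph k E" and \<epsilon>: "0 < \<epsilon>"
  shows "\<exists>m0. \<forall>m\<ge>m0. \<forall>n. \<bar>kernel_density k E (\<lambda>e. u n (lab e)) - kernel_density k E (\<lambda>e. step_kernel (u n (lab e)) (p n m))\<bar> \<le> \<epsilon>"
proof -
  obtain D where D: "\<And>e N. e \<in> E \<Longrightarrow> C (lab e) N \<le> D N"
    using common_moment_bound[OF simple_graph_finite[OF E]] by metis
  have mb: "moment_bounded D (u n (lab e))" if "e \<in> E" for n e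
    using moment_bounded_mono[OF moment_bounded_u D[OF that]] .
  define B where "B = real (card E) * (1 + 12 * product_bound (\<lambda>N. 2 * 4 ^ N * D N) (card E))"
  obtain m1 where m1: "\<And>e. e \<in> E \<Longrightarrow> lab e \<le> m1"
    using finite_nat_set_iff_bounded_le[of "lab ` E"] simple_graph_finite[OF E] by auto
  have "(\<lambda>m. B * inverse (real (Suc m))) \<longlonglongrightarrow> B * 0"
    by (intro tendsto_intros LIMSEQ_inverse_real_of_nat)
  then have "\<forall>\<^sub>F m in sequentially. B * inverse (real (Suc m)) < \<epsilon>"
    using \<epsilon> by (auto dest: order_tendstoD)
  then obtain m2 where m2: "\<And>m. m2 \<le> m \<Longrightarrow> B / real (Suc m) < \<epsilon>"
    by (auto simp: eventually_sequentially divide_inverse)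
  show ?thesis
  proof (intro exI[of _ "Suc (max m1 m2)"] allI impI)
    fix m n assume "Suc (max m1 m2) \<le> m"
    then obtain m' where m': "m = Suc m'" "m1 \<le> m'" "m2 \<le> m'"
      by (cases m) auto
    let ?\<epsilon> = "(1 / real (Suc m')) ^ 6"
    have s: "sqrt ?\<epsilon> = (1 / real (Suc m')) ^ 3"
      using real_sqrt_abs[of "(1 / real (Suc m')) ^ 3"] by (simp add: power_mult[symmetric])
    have "\<bar>kernel_density k E (\<lambda>e. u n (lab e)) - kernel_density k E (\<lambda>e. step_kernel (u n (lab e)) (p n m))\<bar> \<le>
      real (card E) * (real (Suc m') * real (Suc m') * sqrt ?\<epsilon> + 12 * product_bound (\<lambda>N. 2 * 4 ^ N * D N) (card E) / real (Suc m'))"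
      unfolding m'(1)
    proof (rule counting[OF E mb p])
      show "regular ((2 * Suc m' * Suc m' + 1)\<^sup>2) ?\<epsilon> (u n (lab e)) (p n (Suc m'))" if "e \<in> E" for e
        using m1[OF that] m'(2) by (intro reg) auto
    qed auto
    also have "real (Suc m') * real (Suc m') * sqrt ?\<epsilon> = 1 / real (Suc m')"
      unfolding s by (simp add: power3_eq_cube)
    also have "real (card E) * (1 / real (Suc m') + 12 * product_bound (\<lambda>N. 2 * 4 ^ N * D N) (card E) / real (Suc m')) = B / real (Suc m')"
      by (simp add: B_def add_divide_distrib distrib_left)
    also have "\<dots> \<le> \<epsilon>"
      using m2[OF m'(3)] by simp
    finally show "\<bar>kernel_density k E (\<lambda>e. u n (lab e)) - kernel_density k E (\<lambda>e. step_kernel (u n (lab e)) (p n m))\<bar> \<le> \<epsilon>" .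
  qed
qed

end

lemma prob_space_unit_interval: "prob_space (lebesgue_on {0..1::real})"
  by (rule prob_spaceI) (simp add: space_restrict_space emeasure_restrict_space)

context prob_space
begin

lemma kernel_density_tendsto_L2:
  assumes E: "simple_graph k E"
    and u: "\<And>j e. e \<in> E \<Longrightarrow> moment_bounded C (u j e)" and v: "\<And>e. e \<in> E \<Longrightarrow> moment_bounded C (v e)"
    and lim: "\<And>e. e \<in> E \<Longrightarrow> (\<lambda>j. \<integral>z. (u j e z - v e z)\<^sup>2 \<partial>M2) \<longlonglongrightarrow> 0"
  shows "(\<lambda>j. kernel_density k E (u j)) \<longlonglongrightarrow> kernel_density k E v"
proof (rule LIMSEQ_I)
  fix \<epsilon> :: real assume \<epsilon>: "0 < \<epsilon>"
  let ?n = "real (card E)" and ?B = "\<bar>product_bound C (card E)\<bar>"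
  define \<eta> where "\<eta> = \<epsilon> / 2 / (1 + ?n * ?B)"
  have pos: "0 < 1 + ?n * ?B"
    by (intro add_pos_nonneg mult_nonneg_nonneg) auto
  then have \<eta>: "0 < \<eta>"
    using \<epsilon> by (simp add: \<eta>_def)
  define d where "d j = (\<Sum>e\<in>E. \<integral>z. (u j e z - v e z)\<^sup>2 \<partial>M2)" for j
  have "d \<longlonglongrightarrow> (\<Sum>e\<in>E. 0)"
    unfolding d_def[abs_def] by (intro tendsto_sum lim)
  then have "(\<lambda>j. ?n * (d j / \<eta>)) \<longlonglongrightarrow> ?n * (0 / \<eta>)"
    using \<eta> by (intro tendsto_intros) auto
  then have "\<forall>\<^sub>F j in sequentially. ?n * (d j / \<eta>) < \<epsilon> / 2"
    using \<epsilon> by (intro order_tendstoD(2)) auto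
  then obtain j0 where j0: "\<And>j. j0 \<le> j \<Longrightarrow> ?n * (d j / \<eta>) < \<epsilon> / 2"
    by (auto simp: eventually_sequentially)
  show "\<exists>j0. \<forall>j\<ge>j0. norm (kernel_density k E (u j) - kernel_density k E v) < \<epsilon>"
  proof (intro exI[of _ j0] allI impI)
    fix j assume "j0 \<le> j"
    have d_le: "(\<integral>z. (u j e z - v e z)\<^sup>2 \<partial>M2) \<le> d j" if "e \<in> E" for e
      unfolding d_def
      by (rule member_le_sum[OF that, of "\<lambda>e. \<integral>z. (u j e z - v e z)\<^sup>2 \<partial>M2"])
        (simp_all add: simple_graph_finite[OF E])
    have "\<bar>kernel_density k E (u j) - kernel_density k E v\<bar> \<le> ?n * (d j / \<eta> + \<eta> * product_bound C (card E))"
      by (rule kernel_density_L2_bound[OF E u v d_le \<eta>])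
    also have "\<dots> \<le> ?n * (d j / \<eta> + \<eta> * ?B)"
      using \<eta> by (intro mult_left_mono add_left_mono) auto
    also have "\<dots> = ?n * (d j / \<eta>) + \<eta> * (?n * ?B)"
      by (simp add: algebra_simps)
    also have "\<eta> * (?n * ?B) \<le> \<eta> * (1 + ?n * ?B)"
      using \<eta> by (intro mult_left_mono) auto
    also have "\<eta> * (1 + ?n * ?B) = \<epsilon> / 2"
      using pos by (intro iffD1[OF nonzero_eq_divide_eq \<eta>_def]) simp
    finally show "norm (kernel_density k E (u j) - kernel_density k E v) < \<epsilon>"
      unfolding real_norm_def using j0[OF \<open>j0 \<le> j\<close>] by linarith
  qed
qed

text \<open>Block integrals, unlike block averages, are bounded independently of the cell masses; so
  they are the quantities for which a convergent subsequence is extracted.\<close>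

lemma abs_block_integral_le:
  assumes p: "label_map K p" and u: "moment_bounded C u"
  shows "\<bar>block_integral u p i j\<bar> \<le> 1 + C 1"
proof -
  interpret MM: prob_space M2 by (rule prob_space_M2)
  have "\<bar>block_integral u p i j\<bar> \<le> (\<integral>z. \<bar>of_bool (p (fst z) = i \<and> p (snd z) = j) * u z\<bar> \<partial>M2)"
    unfolding block_integral_def by (rule integral_abs_bound)
  also have "\<dots> \<le> (\<integral>z. 1 + (u z)\<^sup>2 \<partial>M2)"
    using moment_bounded_integrable_power[OF u, of 2]
    by (intro integral_mono') (auto simp: abs_mult abs_le_one_plus_square)
  also have "\<dots> = 1 + (\<integral>z. u z ^ (2 * 1) \<partial>M2)"
    using moment_bounded_integrable_power[OF u, of 2] by (simp add: MM.prob_space)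
  also have "\<dots> \<le> 1 + C 1"
    using u unfolding moment_bounded_def by (intro add_left_mono) blast
  finally show ?thesis .
qed

text \<open>Fatou for each even moment. Applied to a constant sequence it also carries moment bounds
  over to an almost everywhere equal function.\<close>

lemma moment_bounded_AE_limit:
  assumes h: "\<And>i. moment_bounded C (h i)" and g: "g \<in> borel_measurable M2"
    and lim: "AE z in M2. (\<lambda>i. h i z) \<longlonglongrightarrow> g z"
  shows "moment_bounded C g"
  unfolding moment_bounded_def
proof (intro conjI allI g)
  fix N
  have l: "AE z in M2. (\<lambda>i. h i z ^ (2 * N)) \<longlonglongrightarrow> g z ^ (2 * N)"
    using lim by eventually_elim (rule tendsto_power)
  have b: "\<forall>\<^sub>F i in sequentially. integrable M2 (\<lambda>z. h i z ^ (2 * N)) \<and> (\<integral>z. h i z ^ (2 * N) \<partial>M2) \<le> C N"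
    using h by (intro always_eventually) (auto simp: moment_bounded_def)
  have m: "(\<lambda>z. h i z ^ (2 * N)) \<in> borel_measurable M2" "(\<lambda>z. g z ^ (2 * N)) \<in> borel_measurable M2" for i
    using moment_bounded_measurable[OF h] g by auto
  show "integrable M2 (\<lambda>z. g z ^ (2 * N))" "(\<integral>z. g z ^ (2 * N) \<partial>M2) \<le> C N"
    by (rule fatou_integral_bound[OF m _ l b]; simp add: zero_le_even_power)+
qed

end

context kernel_sequence
begin

text \<open>Choose the subsequence so that masses, energies and block integrals converge at all
  levels; then let the level tend to infinity along a second subsequence. Densities are compared in
  three steps: kernel to step kernel (uniformly in n), step kernel to its limit in n, limit step
  kernel to \<open>g\<close>.\<close>

theorem limit_kernels:
  obtains s :: "nat \<Rightarrow> nat" and K :: "nat \<Rightarrow> nat" and p :: "nat \<Rightarrow> nat \<Rightarrow> 'a \<Rightarrow> nat"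
    and q :: "nat \<Rightarrow> real \<Rightarrow> nat" and b :: "nat \<Rightarrow> nat \<Rightarrow> nat \<Rightarrow> nat \<Rightarrow> real" and g :: "nat \<Rightarrow> real \<times> real \<Rightarrow> real"
  where "strict_mono s" "\<And>j n. label_map (K j) (p j n)"
    "\<And>j. prob_space.label_map (lebesgue_on {0..1}) (K j) (q j)"
    "\<And>j l x y. x \<in> {0..<1} \<Longrightarrow> y \<in> {0..<1} \<Longrightarrow>
      (\<lambda>n. block_avg (u (s n) l) (p j n) (q j x) (q j y)) \<longlonglongrightarrow> b j l (q j x) (q j y)"
    "\<And>l. prob_space.moment_bounded (lebesgue_on {0..1}) (C l) (g l)"
    "AE z in lebesgue_on {0..1} \<Otimes>\<^sub>M lebesgue_on {0..1}. \<forall>l. (\<lambda>j. b j l (q j (fst z)) (q j (snd z))) \<longlonglongrightarrow> g l z"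
    "\<And>k E lab. simple_graph k E \<Longrightarrow> (\<lambda>n. kernel_density k E (\<lambda>e. u (s n) (lab e))) \<longlonglongrightarrow>
      prob_space.kernel_density (lebesgue_on {0..1}) k E (\<lambda>e. g (lab e))"
proof -
  interpret N: prob_space "lebesgue_on {0..1::real}" by (rule prob_space_unit_interval)
  interpret NN: prob_space N.M2 by (rule N.prob_space_M2)
  obtain R K p where R: "\<And>m. 0 < R m" and K: "\<And>m. K (Suc m) = K m * R m"
    and p: "\<And>n m. label_map (K m) (p n m)"
    and p_div: "\<And>n m x. p n m x = p n (Suc m) x div R m"
    and reg: "\<And>n m l. l \<le> m \<Longrightarrow> regular ((2 * Suc m * Suc m + 1)\<^sup>2) ((1 / real (Suc m)) ^ 6) (u n l) (p n (Suc m))"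
    by (rule regular_partitions) blast
  \<comment> \<open>Packs the three families, told apart by t, into one countable family scaled to
    norm at most 1, so that one diagonal argument treats all of them.\<close>
  define F where "F n = (\<lambda>(t, m, l, i, j). if t = (0::nat) then cell_mass (p n m) i
    else if t = 1 then energy (u n l) (p n m) / (1 + C l 1) else block_integral (u n l) (p n m) i j / (1 + C l 1))" for n
  have C1: "0 \<le> C l 1" for l
    by (rule moment_bounded_nonneg[OF moment_bounded_u])
  have F_le: "norm (F n x) \<le> 1" for n x
  proof -
    obtain t m l i j where x: "x = (t, m, l, i, j)"
      by (metis prod_cases5)
    have "energy (u n l) (p n m) \<le> C l 1" "\<bar>block_integral (u n l) (p n m) i j\<bar> \<le> 1 + C l 1"
      by (rule energy_le[OF p moment_bounded_u] abs_block_integral_le[OF p moment_bounded_u])+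
    then show ?thesis
      using C1[of l] by (auto simp: F_def x cell_mass_def energy_nonneg abs_of_nonneg divide_le_eq)
  qed
  have "\<exists>s. strict_mono s \<and> (\<forall>x. \<exists>l. (\<lambda>n. F (s n) x) \<longlonglongrightarrow> l)"
  proof (rule function_convergent_subsequence[of UNIV F 1])
    show "norm (F n x) \<le> 1" for n x
      by (rule F_le)
    fix k assume k: "strict_mono (k :: nat \<Rightarrow> nat)" "\<And>x. x \<in> UNIV \<Longrightarrow> \<exists>l. (\<lambda>n. F (k n) x) \<longlonglongrightarrow> l"
    show "\<exists>s. strict_mono s \<and> (\<forall>x. \<exists>l. (\<lambda>n. F (s n) x) \<longlonglongrightarrow> l)"
      by (rule exI[of _ k], rule conjI[OF k(1)], rule allI, rule k(2)[OF UNIV_I])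
  qed (rule countableI_type)
  then obtain s where s: "strict_mono s" "\<And>x. \<exists>l. (\<lambda>n. F (s n) x) \<longlonglongrightarrow> l"
    by blast
  define G where "G x = lim (\<lambda>n. F (s n) x)" for x
  have G: "(\<lambda>n. F (s n) x) \<longlonglongrightarrow> G x" for x
    using s(2)[of x] by (auto simp: G_def limI)
  define \<alpha> where "\<alpha> m i = G (0, m, 0, i, 0)" for m i
  define en where "en m l = G (1, m, l, 0, 0) * (1 + C l 1)" for m l
  \<comment> \<open>A meaningful limit only where both masses are positive; elsewhere the value is 0
    by division by zero.\<close>
  define b where "b m l i j = G (2, m, l, i, j) * (1 + C l 1) / (\<alpha> m i * \<alpha> m j)" for m l i j
  let ?c = "\<lambda>n m. cell_mass (p (s n) m)" and ?a = "\<lambda>n m l. block_avg (u (s n) l) (p (s n) m)"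
  have \<alpha>: "(\<lambda>n. ?c n m i) \<longlonglongrightarrow> \<alpha> m i" for m i
    using G[of "(0, m, 0, i, 0)"] by (simp add: F_def \<alpha>_def)
  have en: "(\<lambda>n. energy (u (s n) l) (p (s n) m)) \<longlonglongrightarrow> en m l" for m l
    using tendsto_mult[OF G[of "(1, m, l, 0, 0)"] tendsto_const[of "1 + C l 1"]] C1[of l] by (simp add: F_def en_def)
  have "(\<lambda>n. block_integral (u (s n) l) (p (s n) m) i j) \<longlonglongrightarrow> G (2, m, l, i, j) * (1 + C l 1)" for m l i j
    using tendsto_mult[OF G[of "(2, m, l, i, j)"] tendsto_const[of "1 + C l 1"]] C1[of l] by (simp add: F_def)
  then have b: "(\<lambda>n. ?a n m l i j) \<longlonglongrightarrow> b m l i j" if "0 < \<alpha> m i" "0 < \<alpha> m j" for m l i j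
    unfolding block_avg_def b_def using that by (intro tendsto_divide tendsto_mult \<alpha>) auto
  have \<alpha>_nonneg: "0 \<le> \<alpha> m i" for m i
    by (rule LIMSEQ_le_const[OF \<alpha>]) (simp add: cell_mass_def)
  have mass_nonneg: "0 \<le> cell_mass p' i" for p' i
    by (simp add: cell_mass_def)
  have \<alpha>_sum: "(\<Sum>i<K m. \<alpha> m i) = 1" for m
  proof -
    have "(\<lambda>n. \<Sum>i<K m. ?c n m i) \<longlonglongrightarrow> (\<Sum>i<K m. \<alpha> m i)"
      by (intro tendsto_sum \<alpha>)
    then have "(\<lambda>n. 1) \<longlonglongrightarrow> (\<Sum>i<K m. \<alpha> m i)"
      by (simp add: sum_cell_mass[OF p])
    then show ?thesis
      using LIMSEQ_unique[OF tendsto_const] by metis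
  qed
  have \<alpha>_split: "\<alpha> m i = (\<Sum>t<R m. \<alpha> (Suc m) (i * R m + t))" for m i
  proof (rule LIMSEQ_unique[OF \<alpha>])
    have "?c n m i = (\<Sum>t<R m. cell_mass (p (s n) (Suc m)) (i * R m + t))" for n
      by (rule cell_mass_coarsen[OF p p[of "Suc m", unfolded K] p_div])
    then show "(\<lambda>n. ?c n m i) \<longlonglongrightarrow> (\<Sum>t<R m. \<alpha> (Suc m) (i * R m + t))"
      by (simp only:) (intro tendsto_sum \<alpha>)
  qed
  obtain q :: "nat \<Rightarrow> real \<Rightarrow> nat" where q_less: "\<And>m x. q m x < K m" and q_meas: "\<And>m. q m \<in> measurable borel (count_space UNIV)"
    and q_mass: "\<And>m i. i < K m \<Longrightarrow> emeasure lborel {x \<in> {0..1}. q m x = i} = ennreal (\<alpha> m i)"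
    and q_div: "\<And>m x. q m x = q (Suc m) x div R m"
    and q_pos: "\<And>m x. 0 \<le> x \<Longrightarrow> x < 1 \<Longrightarrow> 0 < \<alpha> m (q m x)"
    by (rule interval_labels[of R K \<alpha>, OF R K \<alpha>_nonneg \<alpha>_sum \<alpha>_split]) blast
  have q: "N.label_map (K m) (q m)" for m
  proof -
    have "q m \<in> measurable (lebesgue_on {0..1}) (count_space UNIV)"
      using q_meas by (intro measurable_restrict_space1 measurable_completion) simp
    then show ?thesis
      using q_less by (simp add: N.label_map_def)
  qed
  have mass: "N.cell_mass (q m) i = \<alpha> m i" if "i < K m" for m i
  proof -
    let ?S = "{x \<in> {0..1}. q m x = i}"
    have S: "?S \<in> sets lborel"
      using measurable_sets[OF q_meas, of "{i}" m] by (simp add: vimage_def Collect_conj_eq sets.Int)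
    have "N.cell_mass (q m) i = measure (lebesgue_on {0..1}) ?S"
      by (simp add: N.cell_mass_def space_restrict_space)
    also have "\<dots> = measure lebesgue ?S"
      by (rule measure_restrict_space) auto
    also have "\<dots> = measure lborel ?S"
      by (rule measure_completion[OF S])
    also have "\<dots> = \<alpha> m i"
      unfolding measure_def q_mass[OF that] using \<alpha>_nonneg by simp
    finally show ?thesis .
  qed
  define U where "U m l z = b m l (q m (fst z)) (q m (snd z))" for m l z
  \<comment> \<open>The same coarsening map serves the partitions of every n and the interval
    partitions, so identities between levels pass to the limit.\<close>
  have coarsen: "\<exists>\<pi>. (\<forall>n x. p n m x = \<pi> (p n m' x)) \<and> (\<forall>x. q m x = \<pi> (q m' x))" if "m \<le> m'" for m m'
    using that
  proof (induction m' rule: dec_induct)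
    case base
    then show ?case by (intro exI[of _ "\<lambda>i. i"]) auto
  next
    case (step m')
    then obtain \<pi> where "\<forall>n x. p n m x = \<pi> (p n m' x)" "\<forall>x. q m x = \<pi> (q m' x)"
      by blast
    then show ?case
      using p_div[of _ m'] q_div[of m'] by (intro exI[of _ "\<lambda>i. \<pi> (i div R m')"]) metis
  qed
  have U_int: "(\<integral>z. h (q m (fst z)) (q m (snd z)) \<partial>N.M2) = (\<Sum>i<K m. \<Sum>j<K m. h i j * (\<alpha> m i * \<alpha> m j))" for m and h :: "nat \<Rightarrow> nat \<Rightarrow> real"
    unfolding N.integral_label[OF q] by (intro sum.cong) (simp_all add: mass)
  have U_meas: "U m l \<in> borel_measurable N.M2" for m l
    unfolding U_def[abs_def] by (rule N.label_borel_measurable[OF q])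
  have U_mb: "N.moment_bounded (C l) (U m l)" for m l
    unfolding N.moment_bounded_def
  proof (intro conjI allI U_meas)
    fix n :: nat
    show "integrable N.M2 (\<lambda>z. U m l z ^ (2 * n))"
      using N.integrable_label_mult[OF q[of m], of "\<lambda>_. 1" "\<lambda>i j. b m l i j ^ (2 * n)"] by (simp add: U_def)
    have "(\<integral>z. U m l z ^ (2 * n) \<partial>N.M2) = (\<Sum>i<K m. \<Sum>j<K m. b m l i j ^ (2 * n) * (\<alpha> m i * \<alpha> m j))"
      unfolding U_def by (rule U_int)
    also have "\<dots> \<le> C l n"
    proof (rule block_sum_le_limit[where \<alpha> = "\<lambda>n. (?c n m)" and c = "\<lambda>_. C l n"])
      show "(\<lambda>n'. ?a n' m l i j ^ (2 * n)) \<longlonglongrightarrow> b m l i j ^ (2 * n)"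
        if "0 < \<alpha> m i" "0 < \<alpha> m j" for i j
        by (intro tendsto_power b that)
      fix n'
      have "(\<Sum>i<K m. \<Sum>j<K m. ?a n' m l i j ^ (2 * n) * (?c n' m i * ?c n' m j)) =
          (\<integral>z. step_kernel (u (s n') l) (p (s n') m) z ^ (2 * n) \<partial>M2)"
        unfolding step_kernel_def by (rule integral_label[OF p, symmetric])
      also have "\<dots> \<le> C l n"
        using moment_bounded_step_kernel[OF p moment_bounded_u] by (simp add: moment_bounded_def)
      finally show "(\<Sum>i<K m. \<Sum>j<K m. ?a n' m l i j ^ (2 * n) * (?c n' m i * ?c n' m j)) \<le> C l n" .
    qed (simp_all add: \<alpha> mass_nonneg zero_le_even_power)
    finally show "(\<integral>z. U m l z ^ (2 * n) \<partial>N.M2) \<le> C l n" .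
  qed
  \<comment> \<open>Pythagoras holds for each n and is passed to the limit by
    \<open>block_sum_le_limit\<close>. This yields an inequality, which is what
    \<open>L2_countable_limit\<close> asks for.\<close>
  have U_diff: "(\<integral>z. (U m' l z - U m l z)\<^sup>2 \<partial>N.M2) \<le> en m' l - en m l" if le: "m \<le> m'" for m m' l
  proof -
    obtain \<pi> where "(\<forall>n x. p n m x = \<pi> (p n m' x)) \<and> (\<forall>x. q m x = \<pi> (q m' x))"
      using coarsen[OF le] ..
    then have \<pi>: "\<And>n x. p n m x = \<pi> (p n m' x)" "\<And>x. q m x = \<pi> (q m' x)"
      by auto
    \<comment> \<open>Positive limit mass of a fine cell forces that of the coarse cell containing
      it, so both averages converge there.\<close>
    have \<alpha>_le: "\<alpha> m' i \<le> \<alpha> m (\<pi> i)" for i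
    proof (rule LIMSEQ_le[OF \<alpha> \<alpha>])
      have "?c n m' i \<le> ?c n m (\<pi> i)" for n
        unfolding cell_mass_def by (intro finite_measure_mono label_cell_sets[OF p]) (auto simp: \<pi>(1))
      then show "\<exists>N. \<forall>n\<ge>N. ?c n m' i \<le> ?c n m (\<pi> i)"
        by blast
    qed
    have "(\<integral>z. (U m' l z - U m l z)\<^sup>2 \<partial>N.M2) =
        (\<Sum>i<K m'. \<Sum>j<K m'. (b m' l i j - b m l (\<pi> i) (\<pi> j))\<^sup>2 * (\<alpha> m' i * \<alpha> m' j))"
      unfolding U_def \<pi>(2) by (rule U_int)
    also have "\<dots> \<le> en m' l - en m l"
    proof (rule block_sum_le_limit[where \<alpha> = "\<lambda>n. (?c n m')"
          and c = "\<lambda>n. energy (u (s n) l) (p (s n) m') - energy (u (s n) l) (p (s n) m)"])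
      show "(\<lambda>n. (?a n m' l i j - ?a n m l (\<pi> i) (\<pi> j))\<^sup>2) \<longlonglongrightarrow>
          (b m' l i j - b m l (\<pi> i) (\<pi> j))\<^sup>2" if "0 < \<alpha> m' i" "0 < \<alpha> m' j" for i j
        using that \<alpha>_le[of i] \<alpha>_le[of j] by (intro tendsto_intros b) auto
      fix n
      have "(\<Sum>i<K m'. \<Sum>j<K m'. (?a n m' l i j - ?a n m l (\<pi> i) (\<pi> j))\<^sup>2 *
            (?c n m' i * ?c n m' j)) =
          (\<integral>z. (step_kernel (u (s n) l) (p (s n) m') z - step_kernel (u (s n) l) (p (s n) m) z)\<^sup>2 \<partial>M2)"
        unfolding step_kernel_def \<pi>(1) by (rule integral_label[OF p, symmetric])
      also have "\<dots> = energy (u (s n) l) (p (s n) m') - energy (u (s n) l) (p (s n) m)"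
        by (rule integral_step_kernel_diff_square(2)[OF p p \<pi>(1) moment_bounded_integrable[OF moment_bounded_u]])
      finally show "(\<Sum>i<K m'. \<Sum>j<K m'. (?a n m' l i j - ?a n m l (\<pi> i) (\<pi> j))\<^sup>2 *
            (?c n m' i * ?c n m' j)) \<le> energy (u (s n) l) (p (s n) m') - energy (u (s n) l) (p (s n) m)"
        by simp
    qed (simp_all add: \<alpha> mass_nonneg en tendsto_diff)
    finally show ?thesis .
  qed
  have en_le: "en m l \<le> C l 1" for m l
    by (rule LIMSEQ_le_const2[OF en]) (auto intro: energy_le[OF p moment_bounded_u])
  obtain \<sigma> g where \<sigma>: "strict_mono \<sigma>" and g_meas: "\<And>l. g l \<in> borel_measurable N.M2"
    and g_lim: "AE z in N.M2. \<forall>l. (\<lambda>j. U (\<sigma> j) l z) \<longlonglongrightarrow> g l z"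
    and g_L2: "\<And>l. (\<lambda>j. \<integral>z. (U (\<sigma> j) l z - g l z)\<^sup>2 \<partial>N.M2) \<longlonglongrightarrow> 0"
    by (rule NN.L2_countable_limit[of U en "\<lambda>l. C l 1", OF U_meas
          N.moment_bounded_integrable_power[OF N.moment_bounded_diff[OF U_mb U_mb], of _ _ _ 2] U_diff en_le]) (assumption | rule that)+
  have g_mb: "N.moment_bounded (C l) (g l)" for l
  proof (rule N.moment_bounded_AE_limit[where h = "\<lambda>j. U (\<sigma> j) l", OF U_mb g_meas])
    show "AE z in N.M2. (\<lambda>j. U (\<sigma> j) l z) \<longlonglongrightarrow> g l z"
      using g_lim by eventually_elim blast
  qed
  have density: "(\<lambda>n. kernel_density k E (\<lambda>e. u (s n) (lab e))) \<longlonglongrightarrow> N.kernel_density k E (\<lambda>e. g (lab e))"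
    if E: "simple_graph k E" for k E lab
  proof -
    obtain D where D: "\<And>e N. e \<in> E \<Longrightarrow> C (lab e) N \<le> D N"
      using common_moment_bound[OF simple_graph_finite[OF E]] by metis
    let ?step = "\<lambda>m n e. step_kernel (u (s n) (lab e)) (p (s n) m)"
    have step: "(\<lambda>n. kernel_density k E (?step m n)) \<longlonglongrightarrow> N.kernel_density k E (\<lambda>e. U m (lab e))" for m
    proof -
      have 1: "kernel_density k E (?step m n) = label_sum k E (K m) (?c n m) (\<lambda>e. block_avg (u (s n) (lab e)) (p (s n) m))" for n
        using kernel_density_labels[OF E p[of m "s n"], of "\<lambda>e. block_avg (u (s n) (lab e)) (p (s n) m)"]
        by (simp add: step_kernel_def[abs_def])
      have 2: "N.kernel_density k E (\<lambda>e. U m (lab e)) = label_sum k E (K m) (N.cell_mass (q m)) (\<lambda>e. b m (lab e))"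
        using N.kernel_density_labels[OF E q[of m], of "\<lambda>e. b m (lab e)"] by (simp add: U_def[abs_def])
      show ?thesis
        unfolding 1 2
      proof (rule label_sum_tendsto[OF E, where B = "product_bound D (card E)"])
        fix n
        have "label_sum k E (K m) (?c n m) (\<lambda>e i j. (block_avg (u (s n) (lab e)) (p (s n) m) i j)\<^sup>2) =
            kernel_density k E (\<lambda>e z. (?step m n e z)\<^sup>2)"
          unfolding step_kernel_def by (rule kernel_density_labels[OF E p, symmetric])
        also have "\<dots> \<le> product_bound D (card E)"
          by (rule kernel_density_square_le[OF E moment_bounded_mono[OF moment_bounded_step_kernel[OF p moment_bounded_u] D]])
        finally show "label_sum k E (K m) (?c n m) (\<lambda>e i j. (block_avg (u (s n) (lab e)) (p (s n) m) i j)\<^sup>2) \<le>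
            product_bound D (card E)" .
      qed (simp_all add: mass \<alpha> b mass_nonneg)
    qed
    have lim: "(\<lambda>j. N.kernel_density k E (\<lambda>e. U (\<sigma> j) (lab e))) \<longlonglongrightarrow> N.kernel_density k E (\<lambda>e. g (lab e))"
      by (rule N.kernel_density_tendsto_L2[OF E N.moment_bounded_mono[OF U_mb D] N.moment_bounded_mono[OF g_mb D] g_L2])
    show ?thesis
    proof (rule LIMSEQ_I)
      fix \<epsilon> :: real assume \<epsilon>: "0 < \<epsilon>"
      then have \<epsilon>3: "0 < \<epsilon> / 3" by simp
      obtain m0 where m0: "\<And>m n. m0 \<le> m \<Longrightarrow> \<bar>kernel_density k E (\<lambda>e. u n (lab e)) -
          kernel_density k E (\<lambda>e. step_kernel (u n (lab e)) (p n m))\<bar> \<le> \<epsilon> / 3"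
        using uniform_counting[of K p, OF p reg E \<epsilon>3, of lab] by blast
      obtain j0 where j0: "\<And>j. j0 \<le> j \<Longrightarrow> norm (N.kernel_density k E (\<lambda>e. U (\<sigma> j) (lab e)) - N.kernel_density k E (\<lambda>e. g (lab e))) < \<epsilon> / 3"
        using LIMSEQ_D[OF lim \<epsilon>3] by blast
      \<comment> \<open>Since \<sigma> j \<ge> j, this level is late enough both for the uniform
        counting estimate and for the limit in the level.\<close>
      define j where "j = max j0 m0"
      have j: "j0 \<le> j" "m0 \<le> \<sigma> j"
        using seq_suble[OF \<sigma>, of j] by (auto simp: j_def)
      obtain n0 where n0: "\<And>n. n0 \<le> n \<Longrightarrow> norm (kernel_density k E (?step (\<sigma> j) n) - N.kernel_density k E (\<lambda>e. U (\<sigma> j) (lab e))) < \<epsilon> / 3"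
        using LIMSEQ_D[OF step \<epsilon>3] by blast
      show "\<exists>n0. \<forall>n\<ge>n0. norm (kernel_density k E (\<lambda>e. u (s n) (lab e)) - N.kernel_density k E (\<lambda>e. g (lab e))) < \<epsilon>"
      proof (intro exI[of _ n0] allI impI)
        fix n assume "n0 \<le> n"
        from m0[OF j(2), of "s n"] n0[OF this] j0[OF j(1)]
        show "norm (kernel_density k E (\<lambda>e. u (s n) (lab e)) - N.kernel_density k E (\<lambda>e. g (lab e))) < \<epsilon>"
          unfolding real_norm_def by linarith
      qed
    qed
  qed
  show ?thesis
  proof (rule that[of s "\<lambda>j. K (\<sigma> j)" "\<lambda>j n. p (s n) (\<sigma> j)" "\<lambda>j. q (\<sigma> j)" "\<lambda>j. b (\<sigma> j)" g])
    show "(\<lambda>n. block_avg (u (s n) l) (p (s n) (\<sigma> j)) (q (\<sigma> j) x) (q (\<sigma> j) y)) \<longlonglongrightarrow> b (\<sigma> j) l (q (\<sigma> j) x) (q (\<sigma> j) y)"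
      if "x \<in> {0..<1}" "y \<in> {0..<1}" for j l x y
      using that by (intro b q_pos) auto
  qed (use s p q g_mb g_lim density in \<open>simp_all add: U_def\<close>)
qed

end

section \<open>Lebesgue measure on the square and the cube\<close>

interpretation I: prob_space "lebesgue_on {0..1::real}"
  by (rule prob_space_unit_interval)

lemma AE_lborel_fst_snd:
  assumes "AE x in lborel. P (x::real)"
  shows "AE z in lborel. P (fst (z :: real \<times> real))" "AE z in lborel. P (snd (z :: real \<times> real))"
proof -
  obtain N where N: "{x \<in> space lborel. \<not> P x} \<subseteq> N" "N \<in> null_sets lborel"
    using assms by (auto elim!: AE_E simp: null_sets_def)
  have "N \<times> UNIV \<in> null_sets (lborel \<Otimes>\<^sub>M (lborel :: real measure))" "UNIV \<times> N \<in> null_sets ((lborel :: real measure) \<Otimes>\<^sub>M lborel)"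
    using N(2) by (auto intro: lborel.times_in_null_sets1 lborel.times_in_null_sets2)
  then have "N \<times> UNIV \<in> null_sets (lborel :: (real \<times> real) measure)" "UNIV \<times> N \<in> null_sets (lborel :: (real \<times> real) measure)"
    by (simp_all add: lborel_prod)
  then show "AE z in lborel. P (fst (z :: real \<times> real))" "AE z in lborel. P (snd (z :: real \<times> real))"
    using N(1) by - (rule AE_I'[of "N \<times> UNIV"], auto, rule AE_I'[of "UNIV \<times> N"], auto)
qed

text \<open>For the completed sigma-algebra Borel measurability is not enough: preimages of null
  sets must be null as well, which holds because strips over null sets are null.\<close>

lemma measurable_fst_snd_lebesgue:
  "fst \<in> measurable (lebesgue :: (real \<times> real) measure) lebesgue"
  "snd \<in> measurable (lebesgue :: (real \<times> real) measure) lebesgue"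
proof -
  have m: "fst \<in> measurable (lebesgue :: (real \<times> real) measure) (lborel :: real measure)"
    "snd \<in> measurable (lebesgue :: (real \<times> real) measure) (lborel :: real measure)"
    by (auto intro: measurable_completion simp: borel_prod[symmetric])
  have null: "N \<in> null_sets (distr lebesgue lborel f)"
    if f: "f \<in> measurable (lebesgue :: (real \<times> real) measure) (lborel :: real measure)"
      and AE: "AE z in lborel. f z \<notin> N" and N: "N \<in> null_sets lborel" for N and f :: "real \<times> real \<Rightarrow> real"
  proof -
    have "AE z in lebesgue. f z \<notin> N"
      using AE by (rule AE_completion)
    moreover have "f -` N \<inter> space lebesgue \<in> sets lebesgue"
      using measurable_sets[OF f, of N] N by auto
    moreover have "{z \<in> space lebesgue. \<not> f z \<notin> N} = f -` N \<inter> space lebesgue"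
      by auto
    ultimately have "emeasure lebesgue (f -` N \<inter> space lebesgue) = 0"
      by (intro AE_iff_measurable[THEN iffD1, of _ lebesgue "\<lambda>z. f z \<notin> N"]) auto
    then have "emeasure (distr lebesgue lborel f) N = 0"
      using emeasure_distr[OF f, of N] N by auto
    then show ?thesis
      using N by (simp add: null_sets_def)
  qed
  have "null_sets lborel \<subseteq> null_sets (distr lebesgue lborel (fst :: real \<times> real \<Rightarrow> real))"
    using AE_lborel_fst_snd(1)[OF AE_not_in] by (auto intro!: null m(1))
  then show "fst \<in> measurable (lebesgue :: (real \<times> real) measure) lebesgue"
    by (rule completion.measurable_completion2[OF m(1)])
  have "null_sets lborel \<subseteq> null_sets (distr lebesgue lborel (snd :: real \<times> real \<Rightarrow> real))"
    using AE_lborel_fst_snd(2)[OF AE_not_in] by (auto intro!: null m(2))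
  then show "snd \<in> measurable (lebesgue :: (real \<times> real) measure) lebesgue"
    by (rule completion.measurable_completion2[OF m(2)])
qed

lemma unit_square_sets: "({0..1} \<times> {0..1} :: (real \<times> real) set) \<in> sets lebesgue"
  by (intro sets_completionI_sets) (simp add: borel_prod[symmetric])

lemma space_unit_square: "space unit_square = {0..1} \<times> {0..1}"
  by (simp add: unit_square_def space_restrict_space)

text \<open>The product of the two Lebesgue sigma-algebras is contained in the Lebesgue
  sigma-algebra of the square. With \<open>distr_unit_square\<close>, integrals of
  product-measurable functions agree for both measures.\<close>

lemma measurable_id_unit_square: "(\<lambda>z. z) \<in> measurable unit_square I.M2"
proof -
  have "fst \<in> measurable unit_square lebesgue" "snd \<in> measurable unit_square lebesgue"
    using measurable_fst_snd_lebesgue unfolding unit_square_def by (auto intro: measurable_restrict_space1)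
  then have "fst \<in> measurable unit_square (lebesgue_on {0..1})" "snd \<in> measurable unit_square (lebesgue_on {0..1})"
    by (auto intro!: measurable_restrict_space2 simp: space_unit_square)
  then have "(\<lambda>z. (fst z, snd z)) \<in> measurable unit_square I.M2"
    by (rule measurable_Pair)
  then show ?thesis by simp
qed

text \<open>On rectangles: replace each side by its Borel main part, which changes it by a null set,
  and use that the Borel measure of the plane is a product.\<close>

lemma distr_unit_square: "distr unit_square I.M2 (\<lambda>z. z) = I.M2"
proof (rule pair_measure_eqI[symmetric])
  fix A B :: "real set"
  assume "A \<in> sets (lebesgue_on {0..1})" "B \<in> sets (lebesgue_on {0..1})"
  then have A: "A \<in> sets lebesgue" "A \<subseteq> {0..1}" and B: "B \<in> sets lebesgue" "B \<subseteq> {0..1}"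
    by (auto simp: sets_restrict_space_iff)
  let ?A = "main_part lborel A" and ?B = "main_part lborel B"
  have m: "?A \<in> sets lborel" "?B \<in> sets lborel"
    by (rule main_part_sets[OF A(1)], rule main_part_sets[OF B(1)])
  have "(fst -` A \<inter> space lebesgue) \<inter> (snd -` B \<inter> space lebesgue) \<in> sets lebesgue"
    using A B by (intro sets.Int measurable_sets[OF measurable_fst_snd_lebesgue(1)] measurable_sets[OF measurable_fst_snd_lebesgue(2)])
  also have "(fst -` A \<inter> space lebesgue) \<inter> (snd -` B \<inter> space lebesgue) = A \<times> B"
    by auto
  finally have AB: "A \<times> B \<in> sets lebesgue" .
  have "emeasure (distr unit_square I.M2 (\<lambda>z. z)) (A \<times> B) = emeasure unit_square (A \<times> B)"
    using A B \<open>A \<in> sets (lebesgue_on {0..1})\<close> \<open>B \<in> sets (lebesgue_on {0..1})\<close>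
    by (subst emeasure_distr[OF measurable_id_unit_square]) (auto simp: space_unit_square intro!: arg_cong[where f = "emeasure unit_square"])
  also have "\<dots> = emeasure lebesgue (A \<times> B)"
    using A(2) B(2) unit_square_sets unfolding unit_square_def by (intro emeasure_restrict_space) auto
  also have "\<dots> = emeasure lebesgue (?A \<times> ?B)"
  proof (rule emeasure_eq_AE)
    have "AE z in lborel. fst (z :: real \<times> real) \<in> ?A \<longleftrightarrow> fst z \<in> A" "AE z in lborel. snd (z :: real \<times> real) \<in> ?B \<longleftrightarrow> snd z \<in> B"
      using AE_lborel_fst_snd(1)[OF AE_in_main_part[OF A(1)]] AE_lborel_fst_snd(2)[OF AE_in_main_part[OF B(1)]] .
    then have "AE z in lborel. z \<in> A \<times> B \<longleftrightarrow> z \<in> ?A \<times> ?B"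
      by eventually_elim (auto simp: mem_Times_iff)
    then show "AE z in lebesgue. z \<in> A \<times> B \<longleftrightarrow> z \<in> ?A \<times> ?B"
      by (rule AE_completion)
    show "?A \<times> ?B \<in> sets lebesgue"
      using m by (intro sets_completionI_sets) (simp add: borel_prod[symmetric])
  qed (rule AB)
  also have "\<dots> = emeasure (lborel \<Otimes>\<^sub>M lborel) (?A \<times> ?B)"
    using m by (simp add: lborel_prod borel_prod[symmetric])
  also have "\<dots> = emeasure lebesgue A * emeasure lebesgue B"
    using m A B by (simp add: lborel.emeasure_pair_measure_Times)
  also have "\<dots> = emeasure (lebesgue_on {0..1}) A * emeasure (lebesgue_on {0..1}) B"
    using A B by (simp add: emeasure_restrict_space)
  finally show "emeasure (lebesgue_on {0..1}) A * emeasure (lebesgue_on {0..1}) B = emeasure (distr unit_square I.M2 (\<lambda>z. z)) (A \<times> B)" ..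
qed (simp_all add: I.sigma_finite_measure_axioms)

lemma measurable_M2_borel: "(\<lambda>z. z) \<in> measurable I.M2 (borel :: (real \<times> real) measure)"
proof -
  have id: "(\<lambda>x. x) \<in> measurable (lebesgue_on {0..1}) (borel :: real measure)"
    by (intro measurable_restrict_space1 measurable_completion) simp
  have "(\<lambda>z. (fst z, snd z)) \<in> measurable I.M2 (borel \<Otimes>\<^sub>M borel)"
    by (intro measurable_Pair measurable_compose[OF measurable_fst id] measurable_compose[OF measurable_snd id])
  then show ?thesis
    by (simp add: borel_prod)
qed

lemma AE_lborel_M2:
  assumes "AE z in lborel. P (z :: real \<times> real)"
  shows "AE z in I.M2. P z"
proof -
  obtain N where N: "{z \<in> space lborel. \<not> P z} \<subseteq> N" "N \<in> null_sets lborel"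
    using assms by (auto elim!: AE_E simp: null_sets_def)
  have sets: "N \<inter> space I.M2 \<in> sets I.M2"
    using measurable_sets[OF measurable_M2_borel, of N] N(2) by auto
  have "emeasure I.M2 (N \<inter> space I.M2) = emeasure (distr unit_square I.M2 (\<lambda>z. z)) (N \<inter> space I.M2)"
    by (simp only: distr_unit_square)
  also have "\<dots> \<le> emeasure lebesgue N"
    using sets N(2) unit_square_sets
    by (subst emeasure_distr[OF measurable_id_unit_square sets])
      (auto simp: unit_square_def emeasure_restrict_space space_restrict_space intro!: emeasure_mono)
  also have "\<dots> = 0"
    using N(2) by (simp add: null_sets_def)
  finally have "N \<inter> space I.M2 \<in> null_sets I.M2"
    using sets by (simp add: null_sets_def)
  then show ?thesis
    by (rule AE_I') (use N(1) in auto)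
qed

lemma AE_M2_unit_square: "AE z in I.M2. P z \<Longrightarrow> AE z in unit_square. P z"
  using AE_distrD[OF measurable_id_unit_square, of P] by (simp only: distr_unit_square)

lemma unit_square_measurable: "v \<in> borel_measurable I.M2 \<Longrightarrow> v \<in> borel_measurable unit_square"
  using measurable_compose[OF measurable_id_unit_square] by auto

lemma
  fixes v g :: "real \<times> real \<Rightarrow> real"
  assumes v: "v \<in> borel_measurable I.M2" and g: "g \<in> borel_measurable unit_square"
    and AE: "AE z in I.M2. g z = v z"
  shows integrable_unit_square: "integrable I.M2 v \<longleftrightarrow> integrable unit_square g"
    and integral_unit_square: "integral\<^sup>L I.M2 v = integral\<^sup>L unit_square g"
proof -
  have "integrable I.M2 v \<longleftrightarrow> integrable unit_square v"
    using integrable_distr_eq[OF measurable_id_unit_square v] by (simp only: distr_unit_square)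
  also have "\<dots> \<longleftrightarrow> integrable unit_square g"
    using g unit_square_measurable[OF v] AE_M2_unit_square[OF AE]
    by (intro integrable_cong_AE) auto
  finally show "integrable I.M2 v \<longleftrightarrow> integrable unit_square g" .
  have "integral\<^sup>L I.M2 v = integral\<^sup>L unit_square v"
    using integral_distr[OF measurable_id_unit_square v] by (simp only: distr_unit_square)
  also have "\<dots> = integral\<^sup>L unit_square g"
    using g unit_square_measurable[OF v] AE_M2_unit_square[OF AE]
    by (intro integral_cong_AE) auto
  finally show "integral\<^sup>L I.M2 v = integral\<^sup>L unit_square g" .
qed

text \<open>A Lebesgue measurable function agrees almost everywhere with a Borel function, and Borel
  sets of the plane are product measurable.\<close>

lemma product_version:
  fixes g :: "real \<times> real \<Rightarrow> real"
  assumes "g \<in> borel_measurable unit_square"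
  obtains v where "v \<in> borel_measurable I.M2" "AE z in I.M2. g z = v z"
proof -
  let ?S = "{0..1} \<times> {0..1} :: (real \<times> real) set"
  have "(\<lambda>z. indicator ?S z *\<^sub>R g z) \<in> borel_measurable lebesgue"
    using assms borel_measurable_restrict_space_iff[of ?S lebesgue g] unit_square_sets by (simp add: unit_square_def)
  then obtain v where v: "v \<in> borel_measurable lborel" "AE z in lborel. indicator ?S z *\<^sub>R g z = v z"
    using completion_ex_borel_measurable_real by blast
  have "AE z in I.M2. g z = v z"
    using AE_lborel_M2[OF v(2)] AE_space
    by eventually_elim (auto simp: space_pair_measure space_restrict_space)
  then show ?thesis
    using that measurable_compose[OF measurable_M2_borel] v(1) by auto
qed

section \<open>From decorated densities to product-measurable kernels\<close>

lemma measurable_completion_AE: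
  fixes F G :: "'a \<Rightarrow> real"
  assumes G: "G \<in> borel_measurable M" and AE: "AE x in M. F x = G x"
  shows "F \<in> borel_measurable (completion M)"
proof (rule measurableI)
  fix A :: "real set" assume A: "A \<in> sets borel"
  show "F -` A \<inter> space (completion M) \<in> sets (completion M)"
  proof (rule completion.in_sets_AE)
    show "G -` A \<inter> space (completion M) \<in> sets (completion M)"
      using measurable_sets[OF G A] by auto
    show "AE x in completion M. x \<in> G -` A \<inter> space (completion M) \<longleftrightarrow> x \<in> F -` A \<inter> space (completion M)"
      using AE_completion[OF AE] by eventually_elim auto
  qed auto
qed auto

abbreviation act :: "(real \<Rightarrow> real \<Rightarrow> 'b::real_normed_vector \<Rightarrow>\<^sub>L real) \<Rightarrow> real \<times> real \<Rightarrow> 'b \<Rightarrow> real" where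
  "act W z \<equiv> blinfun_apply (W (fst z) (snd z))"

text \<open>The integrand of \<open>hom_density\<close> is only almost everywhere equal to a
  product-measurable function; the completion in \<open>unit_cube\<close> makes it measurable, so
  both integrals agree.\<close>

lemma hom_density_eq_kernel_density:
  assumes E: "simple_graph k E" and v: "\<And>e. e \<in> E \<Longrightarrow> v e \<in> borel_measurable I.M2"
    and AE: "\<And>e. e \<in> E \<Longrightarrow> AE z in I.M2. act W z (f e) = v e z"
  shows "hom_density k E f W = I.kernel_density k E v"
proof -
  let ?F = "\<lambda>x. \<Prod>e\<in>E. blinfun_apply (W (x (Min e)) (x (Max e))) (f e)"
  let ?G = "\<lambda>x. \<Prod>e\<in>E. v e (ends e x)"
  have G: "?G \<in> borel_measurable (I.cube k)"
    using I.edge_measurable[OF E] v by (auto intro!: borel_measurable_prod)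
  have "AE x in I.cube k. \<forall>e\<in>E. blinfun_apply (W (x (Min e)) (x (Max e))) (f e) = v e (ends e x)"
    using simple_graph_finite[OF E] I.AE_edge[OF E _ AE] by (simp add: AE_finite_all)
  then have FG: "AE x in I.cube k. ?F x = ?G x"
    by eventually_elim (auto intro: prod.cong)
  have "hom_density k E f W = integral\<^sup>L (completion (I.cube k)) ?F"
    by (simp add: hom_density_def unit_cube_def)
  also have "\<dots> = integral\<^sup>L (completion (I.cube k)) ?G"
    using measurable_completion_AE[OF G FG] measurable_completion[OF G] AE_completion[OF FG]
    by (rule integral_cong_AE)
  also have "\<dots> = I.kernel_density k E v"
    by (simp add: integral_completion[OF G] I.kernel_density_def)
  finally show ?thesis .
qed

text \<open>The hypothesis on L^p norms recast for even natural exponents;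
  \<open>dual_graphon_norm_moments\<close> and \<open>dual_graphonI\<close> translate from and to
  graphons.\<close>

definition norm_moments_le :: "(nat \<Rightarrow> real) \<Rightarrow> (real \<Rightarrow> real \<Rightarrow> 'b::real_normed_vector \<Rightarrow>\<^sub>L real) \<Rightarrow> bool" where
  "norm_moments_le D W \<longleftrightarrow> weak_star_measurable W \<and> (\<lambda>(x, y). norm (W x y)) \<in> borel_measurable unit_square \<and>
    (\<forall>N. integrable unit_square (\<lambda>(x, y). norm (W x y) ^ (2 * N)) \<and>
      (\<integral>(x, y). norm (W x y) ^ (2 * N) \<partial>unit_square) \<le> D N)"

lemma prob_space_unit_square: "prob_space unit_square"
  using prob_space_distrD[OF measurable_id_unit_square] I.prob_space_M2 by (simp add: distr_unit_square)

section \<open>Decorated densities\<close>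

lemma version_moment_bounded:
  fixes g :: "real \<times> real \<Rightarrow> real"
  assumes g: "g \<in> borel_measurable unit_square"
    and int: "\<And>N. integrable unit_square (\<lambda>z. g z ^ (2 * N))"
    and le: "\<And>N. (\<integral>z. g z ^ (2 * N) \<partial>unit_square) \<le> C N"
  shows "\<exists>v. I.moment_bounded C v \<and> (AE z in I.M2. g z = v z)"
proof -
  obtain v where v: "v \<in> borel_measurable I.M2" and AE: "AE z in I.M2. g z = v z"
    by (rule product_version[OF g])
  have m: "(\<lambda>z. v z ^ n) \<in> borel_measurable I.M2" "(\<lambda>z. g z ^ n) \<in> borel_measurable unit_square" for n
    using v g by auto
  have A: "AE z in I.M2. g z ^ n = v z ^ n" for n
    using AE by eventually_elim simp
  have "I.moment_bounded C v"
    unfolding I.moment_bounded_def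
    using integrable_unit_square[OF m A] integral_unit_square[OF m A] int le v by simp
  with AE show ?thesis by blast
qed

lemma norm_version:
  assumes "norm_moments_le D W"
  shows "\<exists>v. I.moment_bounded D v \<and> (AE z in I.M2. norm (W (fst z) (snd z)) = v z)"
  using assms by (intro version_moment_bounded) (auto simp: norm_moments_le_def split_beta')

lemma abs_blinfun_apply_le: "\<bar>blinfun_apply z b\<bar> \<le> norm b * norm z"
  for z :: "'b::real_normed_vector \<Rightarrow>\<^sub>L real"
  using norm_blinfun[of z b] by (simp add: mult.commute)

lemma decoration_version:
  assumes W: "norm_moments_le D W"
  shows "\<exists>v. I.moment_bounded (\<lambda>N. norm b ^ (2 * N) * D N) v \<and> (AE z in I.M2. act W z b = v z)"
proof (rule version_moment_bounded)
  let ?g = "\<lambda>z. act W z b"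
  show g: "?g \<in> borel_measurable unit_square"
    using W by (auto simp: norm_moments_le_def weak_star_measurable_def split_beta')
  fix N
  have i: "integrable unit_square (\<lambda>z. norm (W (fst z) (snd z)) ^ (2 * N))"
    "(\<integral>z. norm (W (fst z) (snd z)) ^ (2 * N) \<partial>unit_square) \<le> D N"
    using W by (auto simp: norm_moments_le_def split_beta')
  then have i': "integrable unit_square (\<lambda>z. norm b ^ (2 * N) * norm (W (fst z) (snd z)) ^ (2 * N))"
    by simp
  have le: "?g z ^ (2 * N) \<le> norm b ^ (2 * N) * norm (W (fst z) (snd z)) ^ (2 * N)" for z
  proof -
    have "?g z ^ (2 * N) = \<bar>?g z\<bar> ^ (2 * N)"
      by (simp add: power_mult)
    also have "\<dots> \<le> (norm b * norm (W (fst z) (snd z))) ^ (2 * N)"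
      by (intro power_mono abs_blinfun_apply_le) auto
    finally show ?thesis by (simp add: power_mult_distrib)
  qed
  show i2: "integrable unit_square (\<lambda>z. ?g z ^ (2 * N))"
    using g le by (intro Bochner_Integration.integrable_bound[OF i']) (auto simp: zero_le_even_power)
  have "(\<integral>z. ?g z ^ (2 * N) \<partial>unit_square) \<le> (\<integral>z. norm b ^ (2 * N) * norm (W (fst z) (snd z)) ^ (2 * N) \<partial>unit_square)"
    by (intro integral_mono i2 i' le)
  also have "\<dots> \<le> norm b ^ (2 * N) * D N"
    using i(2) by (simp add: mult_left_mono)
  finally show "(\<integral>z. ?g z ^ (2 * N) \<partial>unit_square) \<le> norm b ^ (2 * N) * D N" .
qed

text \<open>Chosen for each \<open>b\<close> separately, so linearity in \<open>b\<close> holds only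
  outside a null set that depends on the vectors involved.\<close>

definition version :: "(real \<Rightarrow> real \<Rightarrow> 'b::real_normed_vector \<Rightarrow>\<^sub>L real) \<Rightarrow> 'b \<Rightarrow> real \<times> real \<Rightarrow> real" where
  "version W b = (SOME v. v \<in> borel_measurable I.M2 \<and> (AE z in I.M2. act W z b = v z))"

lemma
  assumes W: "norm_moments_le D W"
  shows version_moments: "I.moment_bounded (\<lambda>N. norm b ^ (2 * N) * D N) (version W b)"
    and AE_version: "AE z in I.M2. act W z b = version W b z"
proof -
  obtain v where v: "I.moment_bounded (\<lambda>N. norm b ^ (2 * N) * D N) v" "AE z in I.M2. act W z b = v z"
    using decoration_version[OF W, of b] by blast
  have "\<exists>v. v \<in> borel_measurable I.M2 \<and> (AE z in I.M2. act W z b = v z)"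
    by (intro exI[of _ v] conjI I.moment_bounded_measurable[OF v(1)] v(2))
  from someI_ex[OF this] have ver: "version W b \<in> borel_measurable I.M2"
    and AE: "AE z in I.M2. act W z b = version W b z"
    unfolding version_def by (rule conjunct1, rule conjunct2)
  show "AE z in I.M2. act W z b = version W b z"
    by (rule AE)
  have "AE z in I.M2. v z = version W b z"
    using AE v(2) by eventually_elim simp
  show "I.moment_bounded (\<lambda>N. norm b ^ (2 * N) * D N) (version W b)"
  proof (rule I.moment_bounded_AE_limit[OF v(1) ver])
    show "AE z in I.M2. (\<lambda>i. v z) \<longlonglongrightarrow> version W b z"
      using \<open>AE z in I.M2. v z = version W b z\<close> by eventually_elim simp
  qed
qed

lemma version_measurable: "norm_moments_le D W \<Longrightarrow> version W b \<in> borel_measurable I.M2"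
  using version_moments[THEN I.moment_bounded_measurable] .

lemma hom_density_version:
  assumes "norm_moments_le D W" "simple_graph k E"
  shows "hom_density k E f W = I.kernel_density k E (\<lambda>e. version W (f e))"
  by (rule hom_density_eq_kernel_density[OF assms(2) version_measurable[OF assms(1)] AE_version[OF assms(1)]])

lemma norm_moments_nonneg: "norm_moments_le D W \<Longrightarrow> 0 \<le> D N"
  using norm_version[of D W] I.moment_bounded_nonneg by blast

lemma version_moments_le:
  assumes "norm_moments_le D W" "norm b \<le> c"
  shows "I.moment_bounded (\<lambda>N. c ^ (2 * N) * D N) (version W b)"
proof (rule I.moment_bounded_mono[OF version_moments[OF assms(1)]])
  show "norm b ^ (2 * N) * D N \<le> c ^ (2 * N) * D N" for N
    by (intro mult_right_mono power_mono assms(2) norm_moments_nonneg[OF assms(1)]) simp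
qed

lemma abs_hom_density_le:
  assumes "norm_moments_le D W" "simple_graph k E" "\<And>e. e \<in> E \<Longrightarrow> norm (f e) \<le> c"
  shows "\<bar>hom_density k E f W\<bar> \<le> product_bound (\<lambda>N. c ^ (2 * N) * D N) (card E)"
  unfolding hom_density_version[OF assms(1,2)]
  by (rule I.abs_kernel_density_le[OF assms(2) version_moments_le[OF assms(1,3)]])

lemma hom_density_linear_edge:
  assumes W: "norm_moments_le D W" and E: "simple_graph k E" "e \<in> E"
  shows "hom_density k E (f(e := a *\<^sub>R b + b')) W = a * hom_density k E (f(e := b)) W + hom_density k E (f(e := b')) W"
proof -
  \<comment> \<open>Any common bound of the norms would do: it gives all kernels in the product one
    moment sequence.\<close>
  define c where "c = norm b + norm b' + norm (a *\<^sub>R b + b') + (\<Sum>e\<in>E. norm (f e))"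
  note fin = simple_graph_finite[OF E(1)]
  have c: "norm b \<le> c" "norm b' \<le> c" "norm (f e') \<le> c" if "e' \<in> E" for e'
  proof -
    have "0 \<le> (\<Sum>e\<in>E. norm (f e))" "norm (f e') \<le> (\<Sum>e\<in>E. norm (f e))"
      using member_le_sum[OF that, of "\<lambda>e. norm (f e)"] fin by (auto intro: sum_nonneg)
    then show "norm b \<le> c" "norm b' \<le> c" "norm (f e') \<le> c"
      unfolding c_def using norm_ge_zero[of b] norm_ge_zero[of b'] norm_ge_zero[of "a *\<^sub>R b + b'"] by linarith+
  qed
  let ?C = "\<lambda>N. c ^ (2 * N) * D N" and ?v = "\<lambda>e. version W (f e)"
  have upd: "(\<lambda>e'. version W ((f(e := x)) e')) = ?v(e := version W x)" for x
    by auto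
  have mb: "I.moment_bounded ?C (version W b)" "I.moment_bounded ?C (version W b')"
    "e' \<in> E - {e} \<Longrightarrow> I.moment_bounded ?C (?v e')" for e'
    using c E by (auto intro!: version_moments_le[OF W])
  have AE: "AE z in I.M2. version W (a *\<^sub>R b + b') z = a * version W b z + version W b' z"
    using AE_version[OF W, of b] AE_version[OF W, of b'] AE_version[OF W, of "a *\<^sub>R b + b'"]
    by eventually_elim (simp add: blinfun.add_right blinfun.scaleR_right)
  have "I.kernel_density k E (?v(e := version W (a *\<^sub>R b + b'))) =
      I.kernel_density k E (?v(e := (\<lambda>z. a * version W b z + version W b' z)))"
    using version_measurable[OF W] AE by (intro I.kernel_density_cong_AE[OF E(1)]) auto
  also have "\<dots> = a * I.kernel_density k E (?v(e := version W b)) + I.kernel_density k E (?v(e := version W b'))"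
    by (rule I.kernel_density_linear_edge[OF E mb(3,1,2)])
  finally show ?thesis
    unfolding hom_density_version[OF W E(1)] upd .
qed

section \<open>Extension from the generating set\<close>

lemma generating_dense:
  fixes F :: "'b::real_normed_vector set"
  assumes "generating F" "subspace S" "F \<subseteq> S" "0 < \<epsilon>"
  obtains b' where "b' \<in> S" "norm (b - b') < \<epsilon>"
proof -
  have "b \<in> closure (span F)"
    using assms(1) by (simp add: generating_def)
  then obtain b' where "b' \<in> span F" "dist b' b < \<epsilon>"
    using assms(4) by (auto simp: closure_approachable)
  then show ?thesis
    using that[of b'] span_minimal[OF assms(3,2)] by (auto simp: dist_norm norm_minus_commute)
qed

text \<open>The vectors with convergent values form a subspace, and equicontinuity extends
  convergence to its closure. It is applied to averages in n, to their limits in the level, and to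
  differences of densities.\<close>

lemma generating_convergent:
  fixes T :: "nat \<Rightarrow> 'b::real_normed_vector \<Rightarrow> real"
  assumes F: "generating F" and lin: "\<And>n. linear (T n)" and bound: "\<And>n b. \<bar>T n b\<bar> \<le> B * norm b"
    and conv: "\<And>b. b \<in> F \<Longrightarrow> convergent (\<lambda>n. T n b)"
  shows "convergent (\<lambda>n. T n b)"
proof -
  define S where "S = {b. convergent (\<lambda>n. T n b)}"
  have S: "subspace S"
    unfolding S_def subspace_def
    using lin by (auto simp: linear_0 linear_add linear_scale convergent_const intro!: convergent_add convergent_mult)
  have "Cauchy (\<lambda>n. T n b)"
  proof (rule metric_CauchyI)
    fix \<epsilon> :: real assume \<epsilon>: "0 < \<epsilon>"
    define \<delta> where "\<delta> = \<epsilon> / (3 * (\<bar>B\<bar> + 1))"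
    have \<delta>: "0 < \<delta>" using \<epsilon> by (simp add: \<delta>_def)
    obtain b' where b': "b' \<in> S" "norm (b - b') < \<delta>"
      by (rule generating_dense[OF F S _ \<delta>]) (use conv in \<open>auto simp: S_def\<close>)
    have close: "\<bar>T n b - T n b'\<bar> < \<epsilon> / 3" for n
    proof -
      have "\<bar>T n b - T n b'\<bar> = \<bar>T n (b - b')\<bar>"
        using lin by (simp add: linear_diff)
      also have "\<dots> \<le> B * norm (b - b')"
        by (rule bound)
      also have "\<dots> \<le> (\<bar>B\<bar> + 1) * norm (b - b')"
        by (intro mult_right_mono) auto
      also have "\<dots> < (\<bar>B\<bar> + 1) * \<delta>"
        using b'(2) by (intro mult_strict_left_mono) auto
      also have "\<dots> = \<epsilon> / 3"
        by (simp add: \<delta>_def field_simps)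
      finally show ?thesis .
    qed
    have "Cauchy (\<lambda>n. T n b')"
      using b'(1) by (simp add: S_def convergent_Cauchy)
    then obtain M where M: "\<And>m n. M \<le> m \<Longrightarrow> M \<le> n \<Longrightarrow> dist (T m b') (T n b') < \<epsilon> / 3"
      using metric_CauchyD[of "\<lambda>n. T n b'" "\<epsilon> / 3"] \<epsilon> by auto
    have "dist (T m b) (T n b) < \<epsilon>" if "M \<le> m" "M \<le> n" for m n
      using M[OF that] close[of m] close[of n] unfolding dist_real_def by linarith
    then show "\<exists>M. \<forall>m\<ge>M. \<forall>n\<ge>M. dist (T m b) (T n b) < \<epsilon>"
      by blast
  qed
  then show ?thesis
    by (simp add: Cauchy_convergent_iff)
qed

lemma linear_lim:
  fixes T :: "nat \<Rightarrow> 'b::real_normed_vector \<Rightarrow> real"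
  assumes lin: "\<And>n. linear (T n)" and conv: "\<And>b. convergent (\<lambda>n. T n b)"
  shows "linear (\<lambda>b. lim (\<lambda>n. T n b))"
proof (rule linearI)
  note L = conv[unfolded convergent_LIMSEQ_iff]
  show "lim (\<lambda>n. T n (b + b')) = lim (\<lambda>n. T n b) + lim (\<lambda>n. T n b')" for b b'
    using lin tendsto_add[OF L[of b] L[of b']] by (intro limI) (simp add: linear_add)
  show "lim (\<lambda>n. T n (r *\<^sub>R b)) = r *\<^sub>R lim (\<lambda>n. T n b)" for r b
    using lin tendsto_scaleR[OF tendsto_const L[of b], of r] by (intro limI) (simp add: linear_scale)
qed

lemma generating_eq_zero:
  fixes T :: "'b::real_normed_vector \<Rightarrow> real"
  assumes F: "generating F" and lin: "linear T" and bound: "\<And>b. \<bar>T b\<bar> \<le> B * norm b"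
    and zero: "\<And>b. b \<in> F \<Longrightarrow> T b = 0"
  shows "T b = 0"
proof -
  have "bounded_linear T"
    using lin bound by (intro bounded_linear_intro[of T B]) (auto simp: linear_add linear_scale mult.commute)
  then have cont: "continuous_on UNIV T"
    by (simp add: linear_continuous_on)
  have sub: "subspace {b. T b = 0}"
    using lin by (simp add: subspace_def linear_0 linear_add linear_scale)
  have "closure (span F) \<subseteq> {b. T b = 0}"
    using span_minimal[OF _ sub] zero cont by (intro closure_minimal closed_Collect_eq) auto
  then show ?thesis
    using F by (auto simp: generating_def)
qed

text \<open>Free the decorations edge by edge. In one decoration the difference of densities is
  linear with a bound uniform in n, so it converges for every vector; the limit is a bounded
  functional vanishing on \<open>F\<close>, hence 0.\<close>

lemma hom_density_tendsto_generating:
  fixes W :: "nat \<Rightarrow> real \<Rightarrow> real \<Rightarrow> 'b::real_normed_vector \<Rightarrow>\<^sub>L real"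
  assumes F: "generating F" and W: "\<And>n. norm_moments_le D (W n)" and U: "norm_moments_le D U"
    and E: "simple_graph k E"
    and conv: "\<And>f. f ` E \<subseteq> F \<Longrightarrow> (\<lambda>n. hom_density k E f (W n)) \<longlonglongrightarrow> hom_density k E f U"
  shows "(\<lambda>n. hom_density k E f (W n)) \<longlonglongrightarrow> hom_density k E f U"
proof -
  have fin: "finite E" by (rule simple_graph_finite[OF E])
  \<comment> \<open>\<open>S\<close> is the set of edges with arbitrary decoration; \<open>f\<close>
    is universally quantified because the induction changes it at the new edge.\<close>
  have "\<forall>f. f ` (E - S) \<subseteq> F \<longrightarrow> (\<lambda>n. hom_density k E f (W n)) \<longlonglongrightarrow> hom_density k E f U" if "S \<subseteq> E" for S
    using finite_subset[OF that fin] that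
  proof (induction S rule: finite_induct)
    case empty
    then show ?case using conv by auto
  next
    case (insert e S)
    then have e: "e \<in> E" by simp
    show ?case
    proof (intro allI impI)
      fix f assume f: "f ` (E - insert e S) \<subseteq> F"
      define T where "T n b = hom_density k E (f(e := b)) (W n) - hom_density k E (f(e := b)) U" for n b
      define c where "c = 1 + (\<Sum>e\<in>E. norm (f e))"
      define B where "B = product_bound (\<lambda>N. c ^ (2 * N) * D N) (card E)"
      have hd_linear: "linear (\<lambda>b. hom_density k E (f(e := b)) V)" if V: "norm_moments_le D V" for V
      proof (rule linearI)
        note lin = hom_density_linear_edge[OF V E e, of f]
        have zero: "hom_density k E (f(e := 0)) V = 0"
          using lin[of 1 0 0] by simp
        show "hom_density k E (f(e := b + b')) V = hom_density k E (f(e := b)) V + hom_density k E (f(e := b')) V" for b b'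
          using lin[of 1 b b'] by simp
        show "hom_density k E (f(e := r *\<^sub>R b)) V = r *\<^sub>R hom_density k E (f(e := b)) V" for r b
          using lin[of r b 0] zero by simp
      qed
      have hd_bound: "\<bar>hom_density k E (f(e := b)) V\<bar> \<le> B * norm b" if V: "norm_moments_le D V" for V b
      proof (cases "b = 0")
        case True
        then show ?thesis using linear_0[OF hd_linear[OF V]] by simp
      next
        case False
        \<comment> \<open>\<open>abs_hom_density_le\<close> bounds densities on a ball; scaling to a
          unit vector turns this into a bound linear in the norm. The 1 in \<open>c\<close> accounts
          for the unit vector.\<close>
        have "norm ((f(e := b /\<^sub>R norm b)) e') \<le> c" if "e' \<in> E" for e'
        proof -
          have "norm (f e') \<le> (\<Sum>e\<in>E. norm (f e))" "0 \<le> (\<Sum>e\<in>E. norm (f e))"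
            using member_le_sum[OF that, of "\<lambda>e. norm (f e)"] fin by (auto intro: sum_nonneg)
          then show ?thesis
            using False by (auto simp: c_def)
        qed
        then have "\<bar>hom_density k E (f(e := b /\<^sub>R norm b)) V\<bar> \<le> B"
          unfolding B_def by (rule abs_hom_density_le[OF V E])
        then have "norm b * \<bar>hom_density k E (f(e := b /\<^sub>R norm b)) V\<bar> \<le> norm b * B"
          by (intro mult_left_mono) auto
        also have "norm b * \<bar>hom_density k E (f(e := b /\<^sub>R norm b)) V\<bar> = \<bar>hom_density k E (f(e := norm b *\<^sub>R (b /\<^sub>R norm b))) V\<bar>"
          unfolding linear_scale[OF hd_linear[OF V]] by (simp add: abs_mult)
        finally show ?thesis
          using False by (simp add: mult.commute)
      qed
      have T_lin: "linear (T n)" for n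
        unfolding T_def[abs_def] by (rule linear_compose_sub[OF hd_linear[OF W] hd_linear[OF U]])
      have T_bound: "\<bar>T n b\<bar> \<le> (2 * B) * norm b" for n b
        unfolding T_def using hd_bound[OF W[of n], of b] hd_bound[OF U, of b] by linarith
      have T_F: "(\<lambda>n. T n b) \<longlonglongrightarrow> 0" if "b \<in> F" for b
      proof -
        have "(f(e := b)) ` (E - S) \<subseteq> F"
          using f that by auto
        then have "(\<lambda>n. hom_density k E (f(e := b)) (W n)) \<longlonglongrightarrow> hom_density k E (f(e := b)) U"
          using insert by auto
        then show ?thesis
          unfolding T_def by (rule LIM_zero)
      qed
      have T_conv: "convergent (\<lambda>n. T n b)" for b
        by (rule generating_convergent[OF F T_lin T_bound]) (rule convergentI, rule T_F)
      have lim_bound: "\<bar>lim (\<lambda>n. T n b)\<bar> \<le> (2 * B) * norm b" for b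
        using T_bound by (intro LIMSEQ_le_const2[OF tendsto_rabs[OF T_conv[unfolded convergent_LIMSEQ_iff]]]) auto
      have "lim (\<lambda>n. T n (f e)) = 0"
        by (rule generating_eq_zero[OF F linear_lim[OF T_lin T_conv] lim_bound]) (rule limI, rule T_F)
      then have "(\<lambda>n. T n (f e)) \<longlonglongrightarrow> 0"
        using T_conv[of "f e"] by (simp add: convergent_LIMSEQ_iff)
      then show "(\<lambda>n. hom_density k E f (W n)) \<longlonglongrightarrow> hom_density k E f U"
        unfolding T_def by (auto dest: LIM_zero_cancel)
    qed
  qed
  from this[of E] show ?thesis by simp
qed

text \<open>Raising the bound on the p-norm to the power p = 2N recovers the moment. Order 0 lies
  outside the range p \<ge> 1; its moment is the area 1 of the square.\<close>

lemma dual_graphon_norm_moments: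
  assumes W: "dual_graphon W" and d: "\<And>p. 1 \<le> p \<Longrightarrow> graphon_norm p W \<le> d p"
  shows "norm_moments_le (\<lambda>N. if N = 0 then 1 else d (real (2 * N)) powr real (2 * N)) W"
proof -
  interpret U: prob_space unit_square by (rule prob_space_unit_square)
  have W': "weak_star_measurable W" "(\<lambda>x y. norm (W x y)) \<in> L_all"
    using W by (auto simp: dual_graphon_def)
  then have L: "(\<lambda>(x, y). norm (W x y)) \<in> borel_measurable unit_square"
    "\<And>p. 1 \<le> p \<Longrightarrow> integrable unit_square (\<lambda>(x, y). \<bar>norm (W x y)\<bar> powr p)"
    by (auto simp: L_all_def Lp_sym_def)
  have "integrable unit_square (\<lambda>(x, y). norm (W x y) ^ (2 * N)) \<and>
      (\<integral>(x, y). norm (W x y) ^ (2 * N) \<partial>unit_square) \<le> (if N = 0 then 1 else d (real (2 * N)) powr real (2 * N))" for N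
  proof (cases "N = 0")
    case True
    then show ?thesis
      by (simp add: split_beta' U.prob_space)
  next
    case False
    define p where "p = real (2 * N)"
    have p: "1 \<le> p" using False by (simp add: p_def)
    have pw: "norm (W x y) powr p = norm (W x y) ^ (2 * N)" for x y
      unfolding p_def using False by (intro powr_realpow') auto
    let ?I = "\<integral>(x, y). norm (W x y) powr p \<partial>unit_square"
    have I: "0 \<le> ?I"
      by (intro Bochner_Integration.integral_nonneg) auto
    have "?I = (?I powr (1 / p)) powr p"
      using p I by (simp add: powr_powr)
    also have "\<dots> \<le> d p powr p"
      using d[OF p] p unfolding graphon_norm_def by (intro powr_mono2) auto
    finally have "(\<integral>(x, y). norm (W x y) ^ (2 * N) \<partial>unit_square) \<le> d p powr p"
      by (simp add: pw)
    moreover have "integrable unit_square (\<lambda>(x, y). norm (W x y) ^ (2 * N))"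
      using L(2)[OF p] by (simp add: pw)
    ultimately show ?thesis
      using False by (simp add: p_def)
  qed
  then show ?thesis
    using W'(1) L(1) by (simp add: norm_moments_le_def)
qed

section \<open>Construction of the limit\<close>

lemma AE_M2_swap:
  assumes "AE z in I.M2. P z"
  shows "AE z in I.M2. P (snd z, fst z)"
proof -
  interpret P: pair_sigma_finite "lebesgue_on {0..1::real}" "lebesgue_on {0..1::real}" ..
  have "AE z in distr I.M2 I.M2 (\<lambda>(x, y). (y, x)). P z"
    using assms by (subst P.distr_pair_swap[symmetric])
  from AE_distrD[OF measurable_pair_swap' this] show ?thesis
    by (simp add: split_beta')
qed

lemma block_integral_swap:
  assumes p: "I.label_map K p" and v: "v \<in> borel_measurable I.M2" and sym: "AE z in I.M2. v (snd z, fst z) = v z"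
  shows "I.block_integral v p i j = I.block_integral v p j i"
proof -
  interpret P: pair_sigma_finite "lebesgue_on {0..1::real}" "lebesgue_on {0..1::real}" ..
  let ?h = "\<lambda>i j z. of_bool (p (fst z) = i \<and> p (snd z) = j) * v z"
  have m: "?h i j \<in> borel_measurable I.M2" for i j
    using I.label_borel_measurable[OF p, of "\<lambda>i' j'. of_bool (i' = i \<and> j' = j)"] v by (intro borel_measurable_times) auto
  have m': "(\<lambda>z. ?h i j (snd z, fst z)) \<in> borel_measurable I.M2"
    using measurable_pair_swap[OF m[of i j]] by (simp add: split_beta')
  have "I.block_integral v p i j = (\<integral>z. ?h i j (snd z, fst z) \<partial>I.M2)"
    using P.integral_product_swap[of "?h i j", OF m] by (simp add: I.block_integral_def split_beta')
  also have "\<dots> = I.block_integral v p j i"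
    unfolding I.block_integral_def
    by (intro integral_cong_AE m m') (use sym in eventually_elim, auto)
  finally show ?thesis .
qed

lemma block_avg_swap:
  assumes "I.label_map K p" "v \<in> borel_measurable I.M2" "AE z in I.M2. v (snd z, fst z) = v z"
  shows "I.block_avg v p i j = I.block_avg v p j i"
  using block_integral_swap[OF assms, of i j] by (simp add: I.block_avg_def mult.commute)

text \<open>\<open>F\<close> is either the norm or the pairing with a fixed vector, so this covers
  all kernels of the family.\<close>

lemma version_swap:
  assumes sym: "symmetric_kernel W" and AE: "AE z in I.M2. F (W (fst z) (snd z)) = v z"
  shows "AE z in I.M2. v (snd z, fst z) = v z"
  using AE AE_M2_swap[OF AE] AE_space
  by eventually_elim (use sym in \<open>auto simp: symmetric_kernel_def space_pair_measure space_restrict_space\<close>)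

text \<open>Versions are linear in the vector only almost everywhere, with varying null sets;
  integration removes them, and the averages are linear without exception.\<close>

lemma linear_block_avg_version:
  assumes W: "norm_moments_le D W" and p: "I.label_map K p"
  shows "linear (\<lambda>b. I.block_avg (version W b) p i j)"
proof -
  let ?o = "\<lambda>z. of_bool (p (fst z) = i \<and> p (snd z) = j) :: real"
  have int: "integrable I.M2 (\<lambda>z. ?o z * version W b z)" for b
    using I.integrable_label_mult[OF p I.moment_bounded_integrable[OF version_moments[OF W]], of "\<lambda>i' j'. of_bool (i' = i \<and> j' = j)"] .
  have eq: "I.block_integral (version W (a *\<^sub>R b + b')) p i j = a * I.block_integral (version W b) p i j + I.block_integral (version W b') p i j" for a b b'
  proof -
    have "I.block_integral (version W (a *\<^sub>R b + b')) p i j = (\<integral>z. a * (?o z * version W b z) + ?o z * version W b' z \<partial>I.M2)"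
      unfolding I.block_integral_def
    proof (rule integral_cong_AE)
      show "AE z in I.M2. ?o z * version W (a *\<^sub>R b + b') z = a * (?o z * version W b z) + ?o z * version W b' z"
        using AE_version[OF W, of b] AE_version[OF W, of b'] AE_version[OF W, of "a *\<^sub>R b + b'"]
        by eventually_elim (auto simp: blinfun.add_right blinfun.scaleR_right)
      show "(\<lambda>z. ?o z * version W (a *\<^sub>R b + b') z) \<in> borel_measurable I.M2"
        using int by (rule borel_measurable_integrable)
      have "integrable I.M2 (\<lambda>z. a * (?o z * version W b z) + ?o z * version W b' z)"
        by (intro Bochner_Integration.integrable_add integrable_mult_right int)
      then show "(\<lambda>z. a * (?o z * version W b z) + ?o z * version W b' z) \<in> borel_measurable I.M2"
        by (rule borel_measurable_integrable)
    qed
    also have "\<dots> = a * I.block_integral (version W b) p i j + I.block_integral (version W b') p i j"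
      unfolding I.block_integral_def
      by (subst Bochner_Integration.integral_add) (auto intro: integrable_mult_right int)
    finally show ?thesis .
  qed
  have zero: "I.block_integral (version W 0) p i j = 0"
    using eq[of 1 0 0] by simp
  show ?thesis
  proof (rule linearI)
    show "I.block_avg (version W (b + b')) p i j = I.block_avg (version W b) p i j + I.block_avg (version W b') p i j" for b b'
      using eq[of 1 b b'] by (simp add: I.block_avg_def add_divide_distrib)
    show "I.block_avg (version W (r *\<^sub>R b)) p i j = r *\<^sub>R I.block_avg (version W b) p i j" for r b
      using eq[of r b 0] zero by (simp add: I.block_avg_def)
  qed
qed

text \<open>The averages of the norm dominate those of all pairings. This is why the norm is carried
  along as a kernel of its own.\<close>

lemma abs_block_avg_version_le:
  assumes W: "norm_moments_le D W" and p: "I.label_map K p"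
    and v: "I.moment_bounded C v" "AE z in I.M2. norm (W (fst z) (snd z)) = v z"
  shows "\<bar>I.block_avg (version W b) p i j\<bar> \<le> I.block_avg v p i j * norm b"
proof -
  let ?o = "\<lambda>z. of_bool (p (fst z) = i \<and> p (snd z) = j) :: real"
  have int: "integrable I.M2 (\<lambda>z. ?o z * w z)" if "I.moment_bounded C' w" for C' w
    using I.integrable_label_mult[OF p I.moment_bounded_integrable[OF that], of "\<lambda>i' j'. of_bool (i' = i \<and> j' = j)"] .
  have "\<bar>I.block_integral (version W b) p i j\<bar> \<le> (\<integral>z. \<bar>?o z * version W b z\<bar> \<partial>I.M2)"
    unfolding I.block_integral_def by (rule integral_abs_bound)
  also have "\<dots> \<le> (\<integral>z. norm b * (?o z * v z) \<partial>I.M2)"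
  proof (rule integral_mono_AE)
    show "AE z in I.M2. \<bar>?o z * version W b z\<bar> \<le> norm b * (?o z * v z)"
      using AE_version[OF W, of b] v(2)
    proof eventually_elim
      case (elim z)
      have "\<bar>version W b z\<bar> \<le> norm b * v z"
        unfolding elim[symmetric] by (rule abs_blinfun_apply_le)
      then show ?case by simp
    qed
  qed (auto intro: integrable_mult_right int[OF v(1)] integrable_abs int[OF version_moments[OF W]])
  also have "\<dots> = norm b * I.block_integral v p i j"
    unfolding I.block_integral_def by (rule integral_mult_right_zero)
  finally have "\<bar>I.block_integral (version W b) p i j\<bar> / (I.cell_mass p i * I.cell_mass p j) \<le>
      norm b * I.block_integral v p i j / (I.cell_mass p i * I.cell_mass p j)"
    by (intro divide_right_mono) (auto simp: I.cell_mass_def)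
  then show ?thesis
    by (simp add: I.block_avg_def abs_mult I.cell_mass_def mult.commute)
qed

section \<open>Norms in the dual space\<close>

text \<open>The vectors violating the bound form an open set; if it were nonempty it would meet the
  dense set.\<close>

lemma norm_blinfun_le_dense:
  fixes z :: "'b::real_normed_vector \<Rightarrow>\<^sub>L real"
  assumes A: "\<And>X. open X \<Longrightarrow> X \<noteq> {} \<Longrightarrow> \<exists>d\<in>A. d \<in> X" and a: "0 \<le> a"
    and le: "\<And>b. b \<in> A \<Longrightarrow> \<bar>blinfun_apply z b\<bar> \<le> a * norm b"
  shows "norm z \<le> a"
proof (rule norm_blinfun_bound[OF a], rule ccontr)
  fix b assume "\<not> norm (blinfun_apply z b) \<le> a * norm b"
  then have "b \<in> {b. a * norm b < \<bar>blinfun_apply z b\<bar>}"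
    by simp
  then have "{b. a * norm b < \<bar>blinfun_apply z b\<bar>} \<noteq> {}"
    by blast
  moreover have "open {b. a * norm b < \<bar>blinfun_apply z b\<bar>}"
    by (intro open_Collect_less continuous_intros)
  ultimately obtain d where "d \<in> A" "a * norm d < \<bar>blinfun_apply z d\<bar>"
    using A by blast
  then show False
    using le[of d] by simp
qed

text \<open>Separability reduces each sublevel set of the norm to countably many conditions on
  pairings.\<close>

lemma norm_blinfun_borel_measurable:
  fixes U :: "'a \<Rightarrow> 'b::{banach, second_countable_topology} \<Rightarrow>\<^sub>L real"
  assumes m: "\<And>b. (\<lambda>z. blinfun_apply (U z) b) \<in> borel_measurable M"
  shows "(\<lambda>z. norm (U z)) \<in> borel_measurable M"
  unfolding borel_measurable_iff_le
proof
  fix a :: real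
  obtain A :: "'b set" where A: "countable A" "\<And>X. open X \<Longrightarrow> X \<noteq> {} \<Longrightarrow> \<exists>d\<in>A. d \<in> X"
    by (rule countable_dense_setE) (rule that)
  show "{z \<in> space M. norm (U z) \<le> a} \<in> sets M"
  proof (cases "0 \<le> a")
    case True
    have "norm (U z) \<le> a \<longleftrightarrow> (\<forall>b\<in>A. \<bar>blinfun_apply (U z) b\<bar> \<le> a * norm b)" for z
    proof
      assume le: "norm (U z) \<le> a"
      show "\<forall>b\<in>A. \<bar>blinfun_apply (U z) b\<bar> \<le> a * norm b"
      proof
        fix b
        have "\<bar>blinfun_apply (U z) b\<bar> \<le> norm b * norm (U z)"
          by (rule abs_blinfun_apply_le)
        also have "\<dots> \<le> norm b * a"
          by (intro mult_left_mono le) simp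
        finally show "\<bar>blinfun_apply (U z) b\<bar> \<le> a * norm b"
          by (simp add: mult.commute)
      qed
    qed (use norm_blinfun_le_dense[OF A(2) True] in blast)
    moreover have "{z \<in> space M. \<forall>b\<in>A. \<bar>blinfun_apply (U z) b\<bar> \<le> a * norm b} \<in> sets M"
      using m A(1) by measurable
    ultimately show ?thesis by simp
  next
    case False
    then have "{z \<in> space M. norm (U z) \<le> a} = {}"
      by (auto simp: not_le intro: less_le_trans)
    then show ?thesis by (simp only: sets.empty_sets)
  qed
qed

text \<open>For a real exponent p choose an even integer 2N \<ge> p and dominate t^p by 1 +
  t^(2N).\<close>

lemma dual_graphonI:
  assumes sym: "symmetric_kernel U" and U: "norm_moments_le D U"
  shows "dual_graphon U"
  unfolding dual_graphon_def
proof (intro conjI)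
  interpret S: prob_space unit_square by (rule prob_space_unit_square)
  show "symmetric_kernel U" by (rule sym)
  show "weak_star_measurable U" using U by (simp add: norm_moments_le_def)
  have m: "(\<lambda>(x, y). norm (U x y)) \<in> borel_measurable unit_square"
    using U by (simp add: norm_moments_le_def)
  have "integrable unit_square (\<lambda>(x, y). \<bar>norm (U x y)\<bar> powr p)" if "1 \<le> p" for p
  proof -
    define N where "N = nat \<lceil>p\<rceil>"
    have N: "p \<le> real (2 * N)" "N \<noteq> 0"
      using that unfolding N_def by linarith+
    have i: "integrable unit_square (\<lambda>(x, y). 1 + norm (U x y) ^ (2 * N))"
      using U by (auto simp: norm_moments_le_def split_beta')
    have le: "\<bar>t\<bar> powr p \<le> 1 + t ^ (2 * N)" if "0 \<le> t" for t :: real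
    proof (cases "t \<le> 1")
      case True
      then have "\<bar>t\<bar> powr p \<le> 1 powr p"
        using that \<open>1 \<le> p\<close> by (intro powr_mono2) auto
      then show ?thesis using that by (simp add: add_increasing2)
    next
      case False
      then have "\<bar>t\<bar> powr p \<le> t powr real (2 * N)"
        using N by (auto intro: powr_mono)
      also have "\<dots> = t ^ (2 * N)"
        using N False by (intro powr_realpow) auto
      finally show ?thesis by simp
    qed
    show ?thesis
    proof (rule Bochner_Integration.integrable_bound[OF i])
      show "(\<lambda>(x, y). \<bar>norm (U x y)\<bar> powr p) \<in> borel_measurable unit_square"
        using m unfolding split_beta' by measurable
      show "AE z in unit_square. norm (case z of (x, y) \<Rightarrow> \<bar>norm (U x y)\<bar> powr p) \<le> norm (case z of (x, y) \<Rightarrow> 1 + norm (U x y) ^ (2 * N))"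
        using le by (auto simp: split_beta' abs_of_nonneg add_nonneg_nonneg)
    qed
  qed
  then show "(\<lambda>x y. norm (U x y)) \<in> L_all"
    using sym m by (auto simp: L_all_def Lp_sym_def symmetric_kernel_def)
qed

text \<open>At a point of the square the functional is obtained by two limits of cell averages,
  first in n and then in the level. Each time, convergence on \<open>F\<close> and the bound by
  averages of the norm give convergence for all vectors.\<close>

lemma graphon_subsequence_limit:
  fixes F :: "'b::{banach, second_countable_topology} set"
    and W :: "nat \<Rightarrow> real \<Rightarrow> real \<Rightarrow> 'b \<Rightarrow>\<^sub>L real"
  assumes F: "countable F" "generating F" and W: "\<And>n. norm_moments_le D (W n)"
    and W_sym: "\<And>n. symmetric_kernel (W n)"
  obtains s U where "strict_mono s" "symmetric_kernel U" "norm_moments_le D U"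
    "\<And>k E f. simple_graph k E \<Longrightarrow> f ` E \<subseteq> F \<Longrightarrow>
      (\<lambda>n. hom_density k E f (W (s n))) \<longlonglongrightarrow> hom_density k E f U"
proof -
  \<comment> \<open>The vector 0 is inserted so that the enumeration makes sense even for empty
    \<open>F\<close>, which can generate the zero space.\<close>
  define fs where "fs = from_nat_into (insert 0 F)"
  have fs: "range fs = insert 0 F"
    unfolding fs_def using F(1) by (intro range_from_nat_into) auto
  have "\<forall>n. \<exists>v. I.moment_bounded D v \<and> (AE z in I.M2. norm (W n (fst z) (snd z)) = v z)"
    by (intro allI norm_version[OF W])
  from choice[OF this] obtain nv where
    "\<forall>n. I.moment_bounded D (nv n) \<and> (AE z in I.M2. norm (W n (fst z) (snd z)) = nv n z)" ..
  then have nv: "I.moment_bounded D (nv n)" "AE z in I.M2. norm (W n (fst z) (snd z)) = nv n z" for n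
    by auto
  \<comment> \<open>Kernel 0 is the norm; kernel l + 1 is the pairing with the l-th vector.\<close>
  define u where "u n l = (case l of 0 \<Rightarrow> nv n | Suc l' \<Rightarrow> version (W n) (fs l'))" for n l
  define C where "C l = (case l of 0 \<Rightarrow> D | Suc l' \<Rightarrow> (\<lambda>N. norm (fs l') ^ (2 * N) * D N))" for l
  have u_mb: "I.moment_bounded (C l) (u n l)" for n l
    using nv(1) version_moments[OF W] by (cases l) (auto simp: u_def C_def)
  interpret KS: kernel_sequence "lebesgue_on {0..1::real}" u C
    by unfold_locales (rule u_mb)
  obtain s K p q b g where s: "strict_mono s" and p: "\<And>j n. I.label_map (K j) (p j n)"
    and q: "\<And>j. I.label_map (K j) (q j)"
    and b: "\<And>j l x y. x \<in> {0..<1} \<Longrightarrow> y \<in> {0..<1} \<Longrightarrow>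
      (\<lambda>n. I.block_avg (u (s n) l) (p j n) (q j x) (q j y)) \<longlonglongrightarrow> b j l (q j x) (q j y)"
    and g: "\<And>l. I.moment_bounded (C l) (g l)"
    and g_lim: "AE z in I.M2. \<forall>l. (\<lambda>j. b j l (q j (fst z)) (q j (snd z))) \<longlonglongrightarrow> g l z"
    and density: "\<And>k E lab. simple_graph k E \<Longrightarrow> (\<lambda>n. I.kernel_density k E (\<lambda>e. u (s n) (lab e))) \<longlonglongrightarrow>
      I.kernel_density k E (\<lambda>e. g (lab e))"
    by (rule KS.limit_kernels) (rule that)
  define \<Phi> where "\<Phi> j n x y \<beta> = I.block_avg (version (W (s n)) \<beta>) (p j n) (q j x) (q j y)" for j n x y \<beta>
  define \<Psi> where "\<Psi> j x y \<beta> = lim (\<lambda>n. \<Phi> j n x y \<beta>)" for j x y \<beta>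
  have \<Phi>_lin: "linear (\<Phi> j n x y)" for j n x y
    unfolding \<Phi>_def[abs_def] by (rule linear_block_avg_version[OF W p])
  have \<Phi>_le: "\<bar>\<Phi> j n x y \<beta>\<bar> \<le> I.block_avg (u (s n) 0) (p j n) (q j x) (q j y) * norm \<beta>" for j n x y \<beta>
    unfolding \<Phi>_def u_def by (simp add: abs_block_avg_version_le[OF W p nv])
  have \<Phi>_fs: "\<Phi> j n x y (fs l) = I.block_avg (u (s n) (Suc l)) (p j n) (q j x) (q j y)" for j n x y l
    by (simp add: \<Phi>_def u_def)
  have F_fs: "\<exists>l. \<beta> = fs l" if "\<beta> \<in> F" for \<beta>
    using that fs by (metis insertI2 rangeE)
  have \<Psi>_fs: "(\<lambda>n. \<Phi> j n x y (fs l)) \<longlonglongrightarrow> b j (Suc l) (q j x) (q j y)" if "x \<in> {0..<1}" "y \<in> {0..<1}" for j x y l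
    unfolding \<Phi>_fs by (rule b[OF that])
  have \<Phi>_conv: "convergent (\<lambda>n. \<Phi> j n x y \<beta>)" if xy: "x \<in> {0..<1}" "y \<in> {0..<1}" for j x y \<beta>
  proof -
    obtain B where B: "\<And>n. \<bar>I.block_avg (u (s n) 0) (p j n) (q j x) (q j y)\<bar> \<le> B"
      using Bseq_def[of "\<lambda>n. I.block_avg (u (s n) 0) (p j n) (q j x) (q j y)"] convergent_imp_Bseq[OF convergentI[OF b[OF xy]]]
      by (metis real_norm_def)
    show ?thesis
    proof (rule generating_convergent[OF F(2), of "\<lambda>n. \<Phi> j n x y" B])
      show "\<bar>\<Phi> j n x y \<beta>\<bar> \<le> B * norm \<beta>" for n \<beta>
        using B[of n] by (intro order_trans[OF \<Phi>_le] mult_right_mono) auto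
      show "convergent (\<lambda>n. \<Phi> j n x y \<beta>)" if "\<beta> \<in> F" for \<beta>
        using F_fs[OF that] \<Psi>_fs[OF xy] convergentI by blast
    qed (rule \<Phi>_lin)
  qed
  have \<Psi>_lin: "linear (\<Psi> j x y)" if "x \<in> {0..<1}" "y \<in> {0..<1}" for j x y
    unfolding \<Psi>_def[abs_def] by (rule linear_lim[OF \<Phi>_lin \<Phi>_conv[OF that]])
  have \<Psi>_le: "\<bar>\<Psi> j x y \<beta>\<bar> \<le> b j 0 (q j x) (q j y) * norm \<beta>" if xy: "x \<in> {0..<1}" "y \<in> {0..<1}" for j x y \<beta>
  proof (rule LIMSEQ_le)
    show "(\<lambda>n. \<bar>\<Phi> j n x y \<beta>\<bar>) \<longlonglongrightarrow> \<bar>\<Psi> j x y \<beta>\<bar>"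
      unfolding \<Psi>_def using \<Phi>_conv[OF xy] by (intro tendsto_rabs) (simp add: convergent_LIMSEQ_iff)
    show "(\<lambda>n. I.block_avg (u (s n) 0) (p j n) (q j x) (q j y) * norm \<beta>) \<longlonglongrightarrow> b j 0 (q j x) (q j y) * norm \<beta>"
      by (intro tendsto_intros b xy)
  qed (use \<Phi>_le in blast)
  have \<Psi>_eq: "\<Psi> j x y (fs l) = b j (Suc l) (q j x) (q j y)" if "x \<in> {0..<1}" "y \<in> {0..<1}" for j x y l
    unfolding \<Psi>_def by (rule limI[OF \<Psi>_fs[OF that]])
  have sym_u: "I.block_avg (u (s n) l) (p j n) i i' = I.block_avg (u (s n) l) (p j n) i' i" for n l j i i'
  proof (rule block_avg_swap[OF p I.moment_bounded_measurable[OF u_mb]])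
    show "AE z in I.M2. u (s n) l (snd z, fst z) = u (s n) l z"
      using version_swap[OF W_sym nv(2)[of "s n"]] version_swap[OF W_sym AE_version[OF W], of "s n"]
      by (cases l) (auto simp: u_def)
  qed
  have \<Phi>_sym: "\<Phi> j n x y \<beta> = \<Phi> j n y x \<beta>" for j n x y \<beta>
    unfolding \<Phi>_def
    by (rule block_avg_swap[OF p version_measurable[OF W] version_swap[OF W_sym AE_version[OF W]]])
  have b_sym: "b j l (q j x) (q j y) = b j l (q j y) (q j x)" if "x \<in> {0..<1}" "y \<in> {0..<1}" for j l x y
  proof (rule LIMSEQ_unique[OF b[OF that]])
    show "(\<lambda>n. I.block_avg (u (s n) l) (p j n) (q j x) (q j y)) \<longlonglongrightarrow> b j l (q j y) (q j x)"
      by (subst sym_u) (rule b[OF that(2,1)])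
  qed
  have \<Psi>_sym: "\<Psi> j x y \<beta> = \<Psi> j y x \<beta>" for j x y \<beta>
    unfolding \<Psi>_def by (subst \<Phi>_sym) simp
  \<comment> \<open>The good points. Countably many convergence conditions suffice for all vectors,
    so \<open>G\<close> does not depend on \<beta>. The value 1 is excluded because labels there are
    arbitrary and may name a null cell.\<close>
  define G where "G = {z \<in> space I.M2. fst z < 1 \<and> snd z < 1 \<and> (\<forall>l. convergent (\<lambda>j. b j l (q j (fst z)) (q j (snd z))))}"
  have G_range: "fst z \<in> {0..<1}" "snd z \<in> {0..<1}" if "z \<in> G" for z
    using that by (auto simp: G_def space_pair_measure space_restrict_space)
  define \<Lambda> where "\<Lambda> x y \<beta> = lim (\<lambda>j. \<Psi> j x y \<beta>)" for x y \<beta>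
  have \<Psi>_conv: "convergent (\<lambda>j. \<Psi> j (fst z) (snd z) \<beta>)" if z: "z \<in> G" for z \<beta>
  proof -
    note xy = G_range[OF z]
    have conv: "convergent (\<lambda>j. b j l (q j (fst z)) (q j (snd z)))" for l
      using z by (simp add: G_def)
    obtain B where B: "\<And>j. \<bar>b j 0 (q j (fst z)) (q j (snd z))\<bar> \<le> B"
      using Bseq_def[of "\<lambda>j. b j 0 (q j (fst z)) (q j (snd z))"] convergent_imp_Bseq[OF conv] by (metis real_norm_def)
    show ?thesis
    proof (rule generating_convergent[OF F(2), of "\<lambda>j. \<Psi> j (fst z) (snd z)" B])
      show "\<bar>\<Psi> j (fst z) (snd z) \<beta>\<bar> \<le> B * norm \<beta>" for j \<beta>
        using B[of j] by (intro order_trans[OF \<Psi>_le[OF xy]] mult_right_mono) auto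
      show "convergent (\<lambda>j. \<Psi> j (fst z) (snd z) \<beta>)" if "\<beta> \<in> F" for \<beta>
        using F_fs[OF that] conv \<Psi>_eq[OF xy] by auto
    qed (rule \<Psi>_lin[OF xy])
  qed
  define L where "L z = lim (\<lambda>j. b j 0 (q j (fst z)) (q j (snd z)))" for z
  have \<Lambda>_le: "\<bar>\<Lambda> (fst z) (snd z) \<beta>\<bar> \<le> L z * norm \<beta>" if z: "z \<in> G" for z \<beta>
  proof (rule LIMSEQ_le)
    show "(\<lambda>j. \<bar>\<Psi> j (fst z) (snd z) \<beta>\<bar>) \<longlonglongrightarrow> \<bar>\<Lambda> (fst z) (snd z) \<beta>\<bar>"
      unfolding \<Lambda>_def using \<Psi>_conv[OF z] by (intro tendsto_rabs) (simp add: convergent_LIMSEQ_iff)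
    have "convergent (\<lambda>j. b j 0 (q j (fst z)) (q j (snd z)))"
      using z by (simp add: G_def)
    then show "(\<lambda>j. b j 0 (q j (fst z)) (q j (snd z)) * norm \<beta>) \<longlonglongrightarrow> L z * norm \<beta>"
      unfolding L_def by (intro tendsto_intros) (simp add: convergent_LIMSEQ_iff)
  qed (use \<Psi>_le[OF G_range[OF z]] in blast)
  have \<Lambda>_bl: "bounded_linear (\<Lambda> (fst z) (snd z))" if z: "z \<in> G" for z
  proof -
    have "linear (\<Lambda> (fst z) (snd z))"
      unfolding \<Lambda>_def[abs_def] by (rule linear_lim[OF \<Psi>_lin[OF G_range[OF z]] \<Psi>_conv[OF z]])
    then show ?thesis
      using \<Lambda>_le[OF z] by (intro bounded_linear_intro[of _ "L z"]) (auto simp: linear_add linear_scale mult.commute)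
  qed
  \<comment> \<open>\<open>Blinfun\<close> is meaningful only where \<Lambda> is bounded linear,
    hence the value 0 off \<open>G\<close>. As \<open>G\<close> is symmetric and of full measure,
    symmetry and densities are unaffected.\<close>
  define U where "U x y = (if (x, y) \<in> G then Blinfun (\<Lambda> x y) else 0)" for x y
  have U: "act U z \<beta> = \<Lambda> (fst z) (snd z) \<beta>" if "z \<in> G" for z \<beta>
    using that \<Lambda>_bl[OF that] by (simp add: U_def bounded_linear_Blinfun_apply)
  have G_sym: "(y, x) \<in> G" if "(x, y) \<in> G" for x y
    using that G_range[OF that] b_sym[of x y] by (auto simp: G_def space_pair_measure)
  have U_sym: "symmetric_kernel U"
    using G_sym \<Psi>_sym by (auto simp: symmetric_kernel_def U_def \<Lambda>_def[abs_def])
  have b_meas: "(\<lambda>z. b j l (q j (fst z)) (q j (snd z))) \<in> borel_measurable I.M2" for j l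
    by (rule I.label_borel_measurable[OF q])
  have G_sets: "G \<in> sets I.M2"
  proof -
    have m: "(\<lambda>z. fst z) \<in> borel_measurable I.M2" "(\<lambda>z. snd z) \<in> borel_measurable I.M2"
      using measurable_compose[OF measurable_M2_borel, of fst borel] measurable_compose[OF measurable_M2_borel, of snd borel]
      by (auto simp: borel_prod[symmetric])
    have "{z \<in> space I.M2. convergent (\<lambda>j. b j l (q j (fst z)) (q j (snd z)))} \<in> sets I.M2" for l
      unfolding Cauchy_convergent_iff[symmetric] by (rule sets_Collect_Cauchy) (rule b_meas)
    then show ?thesis
      unfolding G_def
      by (intro sets.sets_Collect_conj sets.sets_Collect_countable_All borel_measurable_less[OF m(1)] borel_measurable_less[OF m(2)] borel_measurable_const)
  qed
  have U_meas: "(\<lambda>z. act U z \<beta>) \<in> borel_measurable I.M2" for \<beta>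
  proof -
    \<comment> \<open>\<Psi> depends on the point only through its two labels, so it is a step
      function.\<close>
    have "(\<lambda>z. \<Psi> j (fst z) (snd z) \<beta>) \<in> borel_measurable I.M2" for j
      using I.label_borel_measurable[OF q[of j], of "\<lambda>i i'. lim (\<lambda>n. I.block_avg (version (W (s n)) \<beta>) (p j n) i i')"]
      by (simp add: \<Psi>_def \<Phi>_def)
    then have "(\<lambda>z. \<Lambda> (fst z) (snd z) \<beta>) \<in> borel_measurable I.M2"
      unfolding \<Lambda>_def by (intro borel_measurable_lim_metric)
    then have "(\<lambda>z. if z \<in> G then \<Lambda> (fst z) (snd z) \<beta> else 0) \<in> borel_measurable I.M2"
      using G_sets by (intro measurable_If_set) auto
    also have "(\<lambda>z. if z \<in> G then \<Lambda> (fst z) (snd z) \<beta> else 0) = (\<lambda>z. act U z \<beta>)"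
      using U by (auto simp: U_def)
    finally show ?thesis .
  qed
  have normU_meas: "(\<lambda>z. norm (U (fst z) (snd z))) \<in> borel_measurable I.M2"
    by (rule norm_blinfun_borel_measurable[OF U_meas])
  have less1: "AE z in I.M2. fst z < 1 \<and> snd z < 1"
  proof -
    have "AE z in lborel. fst (z :: real \<times> real) \<noteq> 1" "AE z in lborel. snd (z :: real \<times> real) \<noteq> 1"
      by (rule AE_lborel_fst_snd[OF AE_lborel_singleton])+
    from AE_lborel_M2[OF this(1)] AE_lborel_M2[OF this(2)] AE_space show ?thesis
      by eventually_elim (auto simp: space_pair_measure space_restrict_space)
  qed
  have AE_G: "AE z in I.M2. z \<in> G \<and> (\<forall>l. (\<lambda>j. b j l (q j (fst z)) (q j (snd z))) \<longlonglongrightarrow> g l z)"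
    using g_lim less1 AE_space by eventually_elim (auto simp: G_def convergent_def)
  \<comment> \<open>The limit of the averages of the norm dominates the norm of the limit. Its
    moments are bounded by \<open>D\<close>, so \<open>U\<close> inherits the bounds of the
    sequence.\<close>
  have AE_norm: "AE z in I.M2. norm (U (fst z) (snd z)) \<le> \<bar>g 0 z\<bar>"
    using AE_G
  proof eventually_elim
    case (elim z)
    then have "L z = g 0 z"
      unfolding L_def by (intro limI) blast
    have "\<bar>\<Lambda> (fst z) (snd z) \<beta>\<bar> \<le> \<bar>g 0 z\<bar> * norm \<beta>" for \<beta>
    proof -
      have "\<bar>\<Lambda> (fst z) (snd z) \<beta>\<bar> \<le> L z * norm \<beta>"
        using elim by (intro \<Lambda>_le) simp
      also have "\<dots> \<le> \<bar>g 0 z\<bar> * norm \<beta>"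
        using \<open>L z = g 0 z\<close> by (intro mult_right_mono) auto
      finally show ?thesis .
    qed
    then show ?case
      using elim by (intro norm_blinfun_bound) (auto simp: U)
  qed
  have U_mom: "norm_moments_le D U"
    unfolding norm_moments_le_def weak_star_measurable_def split_beta'
  proof (intro conjI allI)
    show "(\<lambda>z. act U z \<beta>) \<in> borel_measurable unit_square" for \<beta>
      by (rule unit_square_measurable[OF U_meas])
    show "(\<lambda>z. norm (U (fst z) (snd z))) \<in> borel_measurable unit_square"
      by (rule unit_square_measurable[OF normU_meas])
    fix N
    have m: "(\<lambda>z. norm (U (fst z) (snd z)) ^ (2 * N)) \<in> borel_measurable I.M2"
      using normU_meas by measurable
    have g0: "integrable I.M2 (\<lambda>z. g 0 z ^ (2 * N))" "(\<integral>z. g 0 z ^ (2 * N) \<partial>I.M2) \<le> D N"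
      using g[of 0] by (auto simp: I.moment_bounded_def C_def)
    have le: "AE z in I.M2. norm (U (fst z) (snd z)) ^ (2 * N) \<le> g 0 z ^ (2 * N)"
      using AE_norm
    proof eventually_elim
      case (elim z)
      then have "norm (U (fst z) (snd z)) ^ (2 * N) \<le> \<bar>g 0 z\<bar> ^ (2 * N)"
        by (intro power_mono) auto
      then show ?case by (simp add: power_mult)
    qed
    have i: "integrable I.M2 (\<lambda>z. norm (U (fst z) (snd z)) ^ (2 * N))"
      by (rule Bochner_Integration.integrable_bound[OF g0(1) m]) (use le in eventually_elim, simp)
    have "(\<integral>z. norm (U (fst z) (snd z)) ^ (2 * N) \<partial>I.M2) \<le> D N"
      using integral_mono_AE[OF i g0(1) le] g0(2) by simp
    then show "integrable unit_square (\<lambda>z. norm (U (fst z) (snd z)) ^ (2 * N))"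
      "(\<integral>z. norm (U (fst z) (snd z)) ^ (2 * N) \<partial>unit_square) \<le> D N"
      using i integrable_unit_square[OF m unit_square_measurable[OF m]] integral_unit_square[OF m unit_square_measurable[OF m]]
      by simp_all
  qed
  have lim: "(\<lambda>n. hom_density k E f (W (s n))) \<longlonglongrightarrow> hom_density k E f U"
    if E: "simple_graph k E" and f: "f ` E \<subseteq> F" for k E f
  proof -
    have "\<forall>e\<in>E. \<exists>l. f e = fs l"
      using f F_fs by blast
    then obtain l where l: "\<And>e. e \<in> E \<Longrightarrow> f e = fs (l e)"
      by metis
    have "hom_density k E f (W (s n)) = I.kernel_density k E (\<lambda>e. u (s n) (Suc (l e)))" for n
      unfolding hom_density_version[OF W E] I.kernel_density_def
      by (intro Bochner_Integration.integral_cong prod.cong) (simp_all add: u_def l)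
    moreover have "hom_density k E f U = I.kernel_density k E (\<lambda>e. g (Suc (l e)))"
    proof (rule hom_density_eq_kernel_density[OF E])
      show "g (Suc (l e)) \<in> borel_measurable I.M2" for e
        by (rule I.moment_bounded_measurable[OF g])
      fix e assume e: "e \<in> E"
      show "AE z in I.M2. act U z (f e) = g (Suc (l e)) z"
        using AE_G
      proof eventually_elim
        case (elim z)
        then have "(\<lambda>j. \<Psi> j (fst z) (snd z) (fs (l e))) \<longlonglongrightarrow> g (Suc (l e)) z"
          using \<Psi>_eq[OF G_range] by simp
        then show ?case
          using elim by (simp add: U l[OF e] \<Lambda>_def limI)
      qed
    qed
    ultimately show ?thesis
      using density[OF E, of "\<lambda>e. Suc (l e)"] by simp
  qed
  show ?thesis
    by (rule that[OF s U_sym U_mom lim])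
qed

theorem theorem3p10:
  fixes \<F> :: "'b::{banach, second_countable_topology} set"
    and W :: "nat \<Rightarrow> real \<Rightarrow> real \<Rightarrow> 'b \<Rightarrow>\<^sub>L real"
  assumes "countable \<F>" and "generating \<F>"
    and "\<And>n. dual_graphon (W n)"
    and "\<And>p::real. 1 \<le> p \<Longrightarrow> \<exists>d>0. \<forall>n. graphon_norm p (W n) \<le> d"
    and "\<And>k E f. decorated_graph \<F> k E f \<Longrightarrow> convergent (\<lambda>n. hom_density k E f (W n))"
  shows "\<exists>U :: real \<Rightarrow> real \<Rightarrow> 'b \<Rightarrow>\<^sub>L real. dual_graphon U \<and>
    (\<forall>k E f. decorated_graph UNIV k E f \<longrightarrow>
       (\<lambda>n. hom_density k E f (W n)) \<longlonglongrightarrow> hom_density k E f U)"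
proof -
  have "\<forall>p. \<exists>d. 1 \<le> p \<longrightarrow> (\<forall>n. graphon_norm p (W n) \<le> d)"
    using assms(4) by blast
  then obtain d where d: "\<And>p n. 1 \<le> p \<Longrightarrow> graphon_norm p (W n) \<le> d p"
    by metis
  define D where "D N = (if N = 0 then 1 else d (real (2 * N)) powr real (2 * N))" for N :: nat
  have W: "norm_moments_le D (W n)" for n
    unfolding D_def[abs_def] by (rule dual_graphon_norm_moments[OF assms(3) d])
  have W_sym: "symmetric_kernel (W n)" for n
    using assms(3) by (simp add: dual_graphon_def)
  obtain s U where s: "strict_mono s" and U_sym: "symmetric_kernel U" and U: "norm_moments_le D U"
    and lim: "\<And>k E f. simple_graph k E \<Longrightarrow> f ` E \<subseteq> \<F> \<Longrightarrow>
      (\<lambda>n. hom_density k E f (W (s n))) \<longlonglongrightarrow> hom_density k E f U"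
    by (rule graphon_subsequence_limit[OF assms(1,2) W W_sym]) (rule that)
  have "(\<lambda>n. hom_density k E f (W n)) \<longlonglongrightarrow> hom_density k E f U"
    if "decorated_graph UNIV k E f" for k E f
  proof (rule hom_density_tendsto_generating[OF assms(2) W U])
    show E: "simple_graph k E"
      using that by (simp add: decorated_graph_def)
    fix f' assume f': "f' ` E \<subseteq> \<F>"
    then have "convergent (\<lambda>n. hom_density k E f' (W n))"
      using E by (intro assms(5)) (simp add: decorated_graph_def)
    \<comment> \<open>The full sequence converges by assumption, so its limit is the one found along
      the subsequence.\<close>
    then obtain c where c: "(\<lambda>n. hom_density k E f' (W n)) \<longlonglongrightarrow> c"
      by (auto simp: convergent_def)
    then have "(\<lambda>n. hom_density k E f' (W (s n))) \<longlonglongrightarrow> c"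
      using LIMSEQ_subseq_LIMSEQ[OF c s] by (simp add: comp_def)
    then show "(\<lambda>n. hom_density k E f' (W n)) \<longlonglongrightarrow> hom_density k E f' U"
      using c LIMSEQ_unique[OF _ lim[OF E f']] by blast
  qed
  then show ?thesis
    using dual_graphonI[OF U_sym U] by blast
qed

end
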